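(* Let $r\ge 1$ and $k_1,\dots,k_r\ge 1$ be integers, at most one of the $k_i$ being equal to $1$. Let $P(k_1,k_2,\dots,k_r)$ denote the graph consisting of two distinct vertices joined by $r$ internally disjoint paths of lengths (numbers of edges) $k_1,k_2,\dots,k_r$. Then $P(k_1,k_2,\dots,k_r)$ is extra-good.
   Context: All graphs are finite and simple; $V(G)$, $E(G)$ are the vertex and edge sets, $\mathrm{v}(G)=|V(G)|$, $\mathrm{e}(G)=|E(G)|$. $\mu$ is Lebesgue measure on $[0,1]$. $\mathcal{H}$ is the space of bounded measurable real functions on $[0,1]^2$. A bounded measurable nonnegative symmetric function $g$ on $[0,1]^2$ is called doubly nonnegative if there is $h\in\mathcal{H}$ (possibly taking negative values) with $g(x,y)=\int_{[0,1]}h(x,z)h(y,z)\,d\mu(z)$ for (almost) all $x,y$. A graph $G$ with vertices $v_1,\dots,v_n$, $n=\mathrm{v}(G)$, and at least one edge is called extra-good if for every doubly nonnegative function $g$ and all bounded measurable nonnegative functions $f_1,\dots,f_n$ on $[0,1]$, $$\int_{[0,1]^n}\prod_{\{v_i,v_j\}\in E(G)}g(x_i,x_j)\prod_{i=1}^n f_i(x_i)\,d\mu^n\;\ge\;\Big(\int_{[0,1]^2}f(x)g(x,y)f(y)\,d\mu^2\Big)^{\mathrm{e}(G)},$$ where $f(x)=\big(\prod_{i=1}^n f_i(x)\big)^{1/(2\mathrm{e}(G))}$. *)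

theory Defs
  imports "HOL-Analysis.Analysis"
begin

text \<open>A graph is a pair of a vertex set and a set of edges, an edge being a two-element
  set of vertices.\<close>

type_synonym 'a ugraph = "'a set \<times> 'a set set"

abbreviation vertices :: "'a ugraph \<Rightarrow> 'a set" where
  "vertices G \<equiv> fst G"

abbreviation edges :: "'a ugraph \<Rightarrow> 'a set set" where
  "edges G \<equiv> snd G"

definition simple_graph :: "'a ugraph \<Rightarrow> bool" where
  "simple_graph G \<longleftrightarrow> finite (vertices G) \<and>
     (\<forall>e\<in>edges G. \<exists>u\<in>vertices G. \<exists>v\<in>vertices G. u \<noteq> v \<and> e = {u, v})"

text \<open>Lebesgue measure on the interval, the square and the cube. Product measures of
  complete measures are not complete, so they are completed; ``measurable'' on the square
  thus means Lebesgue measurable.\<close>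

definition unit_interval :: "real measure" where
  "unit_interval = lebesgue_on {0..1}"

definition unit_square :: "(real \<times> real) measure" where
  "unit_square = completion (unit_interval \<Otimes>\<^sub>M unit_interval)"

definition unit_cube :: "'a set \<Rightarrow> ('a \<Rightarrow> real) measure" where
  "unit_cube V = completion (Pi\<^sub>M V (\<lambda>_. unit_interval))"

definition bounded_measurable :: "'b measure \<Rightarrow> ('b \<Rightarrow> real) \<Rightarrow> bool" where
  "bounded_measurable M f \<longleftrightarrow> f \<in> borel_measurable M \<and> bounded (f ` space M)"

text \<open>The identity relating \<open>g\<close> and \<open>h\<close> is only required almost everywhere; this also
  accounts for the null set of \<open>x\<close> for which the section \<open>h x\<close> is not measurable.\<close>

definition doubly_nonnegative :: "(real \<Rightarrow> real \<Rightarrow> real) \<Rightarrow> bool" where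
  "doubly_nonnegative g \<longleftrightarrow>
     bounded_measurable unit_square (\<lambda>(x, y). g x y) \<and>
     (\<forall>x\<in>{0..1}. \<forall>y\<in>{0..1}. 0 \<le> g x y \<and> g x y = g y x) \<and>
     (\<exists>h :: real \<Rightarrow> real \<Rightarrow> real.
        bounded_measurable unit_square (\<lambda>(x, y). h x y) \<and>
        (AE (x, y) in unit_square. g x y = (\<integral>z. h x z * h y z \<partial>unit_interval)))"

text \<open>The value of \<open>g\<close> at the endpoints of an edge; for symmetric \<open>g\<close> the order in which
  the endpoints are chosen is irrelevant.\<close>

definition edge_value :: "('b \<Rightarrow> 'b \<Rightarrow> real) \<Rightarrow> ('a \<Rightarrow> 'b) \<Rightarrow> 'a set \<Rightarrow> real" where
  "edge_value g x e = (let p = (SOME p. e = {fst p, snd p}) in g (x (fst p)) (x (snd p)))"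

lemma edge_value_insert:
  assumes "g (x u) (x v) = g (x v) (x u)"
  shows "edge_value g x {u, v} = g (x u) (x v)"
proof -
  define p where "p = (SOME p. {u, v} = {fst p, snd p})"
  have "{u, v} = {fst p, snd p}"
    unfolding p_def by (rule someI[of _ "(u, v)"]) simp
  then have "fst p = u \<and> snd p = v \<or> fst p = v \<and> snd p = u"
    by (auto simp: doubleton_eq_iff)
  then show ?thesis
    using assms by (auto simp: edge_value_def Let_def p_def[symmetric])
qed

definition extra_good :: "'a ugraph \<Rightarrow> bool" where
  "extra_good G \<longleftrightarrow> simple_graph G \<and> edges G \<noteq> {} \<and>
     (\<forall>g (f :: 'a \<Rightarrow> real \<Rightarrow> real).
        doubly_nonnegative g \<longrightarrow>
        (\<forall>v\<in>vertices G. bounded_measurable unit_interval (f v) \<and> (\<forall>t\<in>{0..1}. 0 \<le> f v t)) \<longrightarrow>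
        (let F = (\<lambda>t. (\<Prod>v\<in>vertices G. f v t) powr (1 / (2 * real (card (edges G))))) in
           (\<integral>x. (\<Prod>e\<in>edges G. edge_value g x e) * (\<Prod>v\<in>vertices G. f v (x v))
              \<partial>unit_cube (vertices G))
           \<ge> (\<integral>(s, t). F s * g s t * F t \<partial>unit_square) ^ card (edges G)))"

text \<open>\<open>P(k\<^sub>1, \<dots>, k\<^sub>r)\<close>, with vertex \<open>j\<close> (counted from \<open>0\<close>) of the path with index \<open>i\<close> given
  by \<open>path_vertex ks i j\<close>: all paths share their first and their last vertex, and no others.\<close>

datatype pvertex = Start | Finish | Inner nat nat

definition path_vertex :: "nat list \<Rightarrow> nat \<Rightarrow> nat \<Rightarrow> pvertex" where
  "path_vertex ks i j = (if j = 0 then Start else if j = ks ! i then Finish else Inner i j)"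

definition path_graph :: "nat list \<Rightarrow> pvertex ugraph" where
  "path_graph ks =
     ({path_vertex ks i j |i j. i < length ks \<and> j \<le> ks ! i},
      {{path_vertex ks i j, path_vertex ks i (Suc j)} |i j. i < length ks \<and> j < ks ! i})"

end

theory Submission
  imports Defs "HOL-Probability.Probability"
begin

text \<open>
  Integrating out the inner vertices turns the left-hand side into a double integral over the
  two ends, \<open>\<integral>\<integral> a(u) b(v) \<Prod>\<^sub>i A\<^sub>i(u, v) du dv\<close>, where \<open>A\<^sub>i\<close> is the weighted number of walks
  along the \<open>i\<close>-th path. The proof cuts every path in the middle, which leaves two copies of a
  spider (a tree with one branching vertex), and then proves the inequality for spiders.

  The cut needs a graph that is symmetric under exchanging its two ends. The graph is, but the
  vertex weights \<open>f\<^sub>v\<close> need not be. Averaging the integrand with its reflection and applying the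
  inequality of arithmetic and geometric means replaces the weight of each vertex by the
  geometric mean of its weight and that of its mirror image; the product of all weights, hence
  the right-hand side, stays the same (\<open>integral_symmetrise_le\<close>).

  Now \<open>g(x, y) = \<integral> h(x, z) h(y, z) dz\<close> comes in. By symmetry each \<open>A\<^sub>i\<close> is a Gram kernel
  \<open>A\<^sub>i(u, v) = \<integral> D\<^sub>i(u, z) D\<^sub>i(v, z) dz\<close>: a path of even length is cut at its middle vertex, a
  path of odd length in its middle edge, where \<open>h\<close> makes \<open>D\<^sub>i\<close> possibly negative. Products of
  Gram kernels are positive semidefinite (Schur), so for any \<open>\<psi>\<close> the Cauchy--Schwarz inequality
  allows to replace a single factor \<open>A\<^sub>i(u, v)\<close> by
  \<open>\<beta>(u) \<beta>(v) / \<integral> \<psi>\<^sup>2\<close>, with \<open>\<beta>(u) = \<integral> D\<^sub>i(u, z) \<psi>(z) dz\<close> (\<open>form_gram_ge\<close>). Write \<open>Z\<close> for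
  \<open>\<integral>\<integral> f g f\<close>. For even paths take \<open>\<psi> = 1\<close>. For odd paths take \<open>\<psi>(z) = \<integral> f(y) h(y, z) dy\<close>:
  then \<open>\<integral> \<psi>\<^sup>2 = Z\<close>, and \<open>\<beta>\<close> is half of the path prolonged by half an edge to a new end vertex of
  weight \<open>f\<close>. In both cases \<open>\<beta>\<close> has \<open>\<lceil>k\<^sub>i/2\<rceil>\<close> edges (\<open>halve_path\<close>). After all paths are cut, the
  double integral is the square of the integral of the spider with these legs, divided by \<open>Z\<close>
  to the number of odd paths, and this power is exactly the number of edges by which the two
  spiders exceed the graph (\<open>theta_ge_spider\<close>).

  So the spider with \<open>e\<close> edges has to have integral at least \<open>Z\<^sup>e\<close>, its vertex weights having
  product \<open>f\<^sup>2\<^sup>e\<close>. As for every tree this holds for all nonnegative symmetric \<open>g\<close>, by entropy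
  (\<open>spider_ge_pos\<close>): the density \<open>f(x) g(x, y) f(y) / Z\<close> is a reversible Markov chain, which
  is run along the tree, and Jensen's inequality bounds the logarithm of the integral from below
  by an expectation. All vertices have the same distribution \<open>p / Z\<close>, with \<open>p(x) = f(x) \<integral> g(x, y)
  f(y) dy\<close>; hence only the product of the weights matters, and what remains is \<open>e - 1\<close> times the
  relative entropy of \<open>p / Z\<close>, which is nonnegative. The logarithms are kept finite by adding
  \<open>1/n\<close> to \<open>g\<close> and to all weights (\<open>spider_ge\<close>).
\<close>

section \<open>Bounded measurable functions\<close>

lemma bounded_measurable_iff:
  "bounded_measurable M f \<longleftrightarrow> f \<in> borel_measurable M \<and> (\<exists>B. \<forall>x\<in>space M. \<bar>f x\<bar> \<le> B)"
  by (auto simp: bounded_measurable_def bounded_iff)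

lemma bounded_measurable_const [simp, intro]: "bounded_measurable M (\<lambda>_. c)"
  by (auto simp: bounded_measurable_iff)

lemma bounded_measurable_mult [intro]:
  assumes "bounded_measurable M f" "bounded_measurable M g"
  shows "bounded_measurable M (\<lambda>x. f x * g x)"
proof -
  obtain B C where "\<forall>x\<in>space M. \<bar>f x\<bar> \<le> B" "\<forall>x\<in>space M. \<bar>g x\<bar> \<le> C"
    using assms by (auto simp: bounded_measurable_iff)
  then have "\<bar>f x * g x\<bar> \<le> B * C" if "x \<in> space M" for x
    unfolding abs_mult using that by (intro mult_mono) (auto intro: order_trans[OF abs_ge_zero])
  with assms show ?thesis by (auto simp: bounded_measurable_iff)
qed

lemma bounded_measurable_add [intro]:
  assumes "bounded_measurable M f" "bounded_measurable M g"
  shows "bounded_measurable M (\<lambda>x. f x + g x)"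
proof -
  obtain B C where "\<forall>x\<in>space M. \<bar>f x\<bar> \<le> B" "\<forall>x\<in>space M. \<bar>g x\<bar> \<le> C"
    using assms by (auto simp: bounded_measurable_iff)
  then have "\<bar>f x + g x\<bar> \<le> B + C" if "x \<in> space M" for x
    using that by (meson abs_triangle_ineq add_mono order_trans)
  with assms show ?thesis by (auto simp: bounded_measurable_iff)
qed

lemma bounded_measurable_diff [intro]:
  assumes "bounded_measurable M f" "bounded_measurable M g"
  shows "bounded_measurable M (\<lambda>x. f x - g x)"
  using bounded_measurable_add[OF assms(1) bounded_measurable_mult[OF bounded_measurable_const[of M "-1"] assms(2)]]
  by simp

lemma bounded_measurable_divide_const [intro]: "bounded_measurable M f \<Longrightarrow> bounded_measurable M (\<lambda>x. f x / c)"
  using bounded_measurable_mult[OF _ bounded_measurable_const[of M "1 / c"]] by force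

lemma bounded_measurable_prod_list [intro]:
  "(\<And>f. f \<in> set fs \<Longrightarrow> bounded_measurable M (F f)) \<Longrightarrow> bounded_measurable M (\<lambda>x. \<Prod>f\<leftarrow>fs. F f x)"
  by (induction fs) auto

lemma bounded_measurable_sum_list [intro]:
  "(\<And>f. f \<in> set fs \<Longrightarrow> bounded_measurable M (F f)) \<Longrightarrow> bounded_measurable M (\<lambda>x. \<Sum>f\<leftarrow>fs. F f x)"
  by (induction fs) auto

lemma bounded_measurable_prod [intro]:
  assumes "\<And>i. i \<in> I \<Longrightarrow> bounded_measurable M (f i)"
  shows "bounded_measurable M (\<lambda>x. \<Prod>i\<in>I. f i x)"
proof (cases "finite I")
  case True
  then show ?thesis using assms by (induction I) auto
qed simp

lemma bounded_measurable_sqrt [intro]: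
  assumes "bounded_measurable M f" shows "bounded_measurable M (\<lambda>x. sqrt (f x))"
proof -
  obtain B where B: "\<forall>x\<in>space M. \<bar>f x\<bar> \<le> B" using assms by (auto simp: bounded_measurable_iff)
  have "\<bar>sqrt (f x)\<bar> \<le> sqrt B" if "x \<in> space M" for x
    using B that by (auto simp: abs_real_def real_sqrt_minus[symmetric] split: if_splits)
  with assms show ?thesis by (auto simp: bounded_measurable_iff)
qed

lemma bounded_measurable_comp:
  assumes f: "bounded_measurable N f" and p: "p \<in> measurable M N"
  shows "bounded_measurable M (\<lambda>x. f (p x))"
proof -
  obtain B where "\<forall>x\<in>space N. \<bar>f x\<bar> \<le> B" using f by (auto simp: bounded_measurable_iff)
  then have "\<forall>x\<in>space M. \<bar>f (p x)\<bar> \<le> B" using measurable_space[OF p] by auto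
  then show ?thesis using f p by (auto simp: bounded_measurable_iff)
qed

lemma (in finite_measure) integrable_bounded_measurable [intro]:
  assumes "bounded_measurable M f" shows "integrable M f"
proof -
  obtain B where "\<And>x. x \<in> space M \<Longrightarrow> \<bar>f x\<bar> \<le> B" using assms by (auto simp: bounded_measurable_iff)
  then show ?thesis using assms by (intro integrable_const_bound[of f B]) (auto simp: bounded_measurable_iff)
qed

lemma (in prob_space) integral_abs_le:
  fixes f :: "'a \<Rightarrow> real"
  assumes "\<And>x. x \<in> space M \<Longrightarrow> \<bar>f x\<bar> \<le> B"
  shows "\<bar>\<integral>x. f x \<partial>M\<bar> \<le> B"
proof (cases "integrable M f")
  case True
  have "f x \<le> B" "- B \<le> f x" if "x \<in> space M" for x using assms[OF that] by auto
  then have "(\<integral>x. f x \<partial>M) \<le> B" "- B \<le> (\<integral>x. f x \<partial>M)"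
    using True by (auto intro: integral_le_const integral_ge_const)
  then show ?thesis by simp
next
  case False
  obtain x where "x \<in> space M" using not_empty by auto
  then have "0 \<le> B" using order_trans[OF abs_ge_zero assms] by blast
  with False show ?thesis by (simp add: not_integrable_integral_eq)
qed

lemma (in prob_space) bounded_measurable_integral [intro]:
  assumes "bounded_measurable (N \<Otimes>\<^sub>M M) (\<lambda>(x, y). f x y)"
  shows "bounded_measurable N (\<lambda>x. \<integral>y. f x y \<partial>M)"
proof -
  obtain B where "\<And>x y. x \<in> space N \<Longrightarrow> y \<in> space M \<Longrightarrow> \<bar>f x y\<bar> \<le> B"
    using assms by (auto simp: bounded_measurable_iff space_pair_measure)
  moreover have "(\<lambda>x. \<integral>y. f x y \<partial>M) \<in> borel_measurable N"
    using assms by (intro borel_measurable_lebesgue_integral) (auto simp: bounded_measurable_iff)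
  ultimately show ?thesis by (auto simp: bounded_measurable_iff intro!: integral_abs_le)
qed

text \<open>A kernel may be used inside a larger product; the coordinates are then selected by
  measurable maps.\<close>

lemma bounded_measurable_comp2:
  assumes "bounded_measurable (M \<Otimes>\<^sub>M N) (\<lambda>(x, y). f x y)" "p \<in> measurable L M" "q \<in> measurable L N"
  shows "bounded_measurable L (\<lambda>x. f (p x) (q x))"
  using bounded_measurable_comp[OF assms(1), of "\<lambda>x. (p x, q x)" L] assms(2,3) by simp

lemma bounded_measurable_section:
  assumes "bounded_measurable (M \<Otimes>\<^sub>M N) (\<lambda>(x, y). f x y)" "x \<in> space M"
  shows "bounded_measurable N (f x)"
  using bounded_measurable_comp2[OF assms(1), of "\<lambda>_. x" N "\<lambda>y. y"] assms(2) by simp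

section \<open>Fubini's theorem for bounded kernels\<close>

context prob_space
begin

lemma pair_sigma_finite_self: "pair_sigma_finite M M"
  by (simp add: pair_sigma_finite_def sigma_finite_measure_axioms)

lemma prob_space_pair_self: "prob_space (M \<Otimes>\<^sub>M M)"
  by (intro prob_space_pair prob_space_axioms)

lemma integral_swap:
  assumes "bounded_measurable (M \<Otimes>\<^sub>M M) (\<lambda>(x, y). f x y)"
  shows "(\<integral>x. (\<integral>y. f x y \<partial>M) \<partial>M) = (\<integral>y. (\<integral>x. f x y \<partial>M) \<partial>M)"
proof -
  interpret P: pair_sigma_finite M M by (rule pair_sigma_finite_self)
  interpret Q: prob_space "M \<Otimes>\<^sub>M M" by (rule prob_space_pair_self)
  show ?thesis by (rule P.Fubini_integral[symmetric]) (rule Q.integrable_bounded_measurable[OF assms])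
qed

lemma integral_pair_eq:
  assumes "bounded_measurable (M \<Otimes>\<^sub>M M) (\<lambda>(x, y). f x y)"
  shows "(\<integral>(x, y). f x y \<partial>(M \<Otimes>\<^sub>M M)) = (\<integral>x. (\<integral>y. f x y \<partial>M) \<partial>M)"
proof -
  interpret P: pair_sigma_finite M M by (rule pair_sigma_finite_self)
  interpret Q: prob_space "M \<Otimes>\<^sub>M M" by (rule prob_space_pair_self)
  show ?thesis using P.integral_fst'[OF Q.integrable_bounded_measurable[OF assms]] by simp
qed

lemma integral_rotate:
  assumes f: "bounded_measurable ((M \<Otimes>\<^sub>M M) \<Otimes>\<^sub>M M) (\<lambda>((x, y), z). f x y z)"
  shows "(\<integral>x. (\<integral>y. (\<integral>z. f x y z \<partial>M) \<partial>M) \<partial>M) = (\<integral>z. (\<integral>x. (\<integral>y. f x y z \<partial>M) \<partial>M) \<partial>M)"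
proof -
  interpret Q: prob_space "M \<Otimes>\<^sub>M M" by (rule prob_space_pair_self)
  interpret R: prob_space "(M \<Otimes>\<^sub>M M) \<Otimes>\<^sub>M M"
    by (intro prob_space_pair prob_space_axioms prob_space_pair_self)
  interpret P: pair_sigma_finite "M \<Otimes>\<^sub>M M" M
    by (simp add: pair_sigma_finite_def sigma_finite_measure_axioms Q.sigma_finite_measure_axioms)
  have f': "bounded_measurable ((M \<Otimes>\<^sub>M M) \<Otimes>\<^sub>M M) (\<lambda>(p, z). f (fst p) (snd p) z)"
    using f by (simp add: case_prod_unfold)
  have "(\<integral>x. (\<integral>y. (\<integral>z. f x y z \<partial>M) \<partial>M) \<partial>M) = (\<integral>p. (\<integral>z. f (fst p) (snd p) z \<partial>M) \<partial>(M \<Otimes>\<^sub>M M))"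
    using integral_pair_eq[of "\<lambda>x y. \<integral>z. f x y z \<partial>M"] bounded_measurable_integral[OF f']
    by (simp add: case_prod_unfold)
  also have "\<dots> = (\<integral>z. (\<integral>p. f (fst p) (snd p) z \<partial>(M \<Otimes>\<^sub>M M)) \<partial>M)"
    by (rule P.Fubini_integral[symmetric]) (rule R.integrable_bounded_measurable[OF f'])
  also have "\<dots> = (\<integral>z. (\<integral>x. (\<integral>y. f x y z \<partial>M) \<partial>M) \<partial>M)"
  proof (rule Bochner_Integration.integral_cong[OF refl])
    fix z assume "z \<in> space M"
    then have "bounded_measurable (M \<Otimes>\<^sub>M M) (\<lambda>p. f (fst p) (snd p) z)"
      using bounded_measurable_comp2[OF f', of "\<lambda>p. p" "M \<Otimes>\<^sub>M M" "\<lambda>_. z"] by simp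
    then show "(\<integral>p. f (fst p) (snd p) z \<partial>(M \<Otimes>\<^sub>M M)) = (\<integral>x. (\<integral>y. f x y z \<partial>M) \<partial>M)"
      using integral_pair_eq[of "\<lambda>x y. f x y z"] by (simp add: case_prod_unfold)
  qed
  finally show ?thesis .
qed

end

section \<open>Cauchy--Schwarz for Gram kernels\<close>

context prob_space
begin

definition gram :: "('a \<Rightarrow> 'a \<Rightarrow> real) \<Rightarrow> 'a \<Rightarrow> 'a \<Rightarrow> real" where
  "gram D u v = (\<integral>z. D u z * D v z \<partial>M)"

definition form :: "('a \<Rightarrow> 'a \<Rightarrow> real) \<Rightarrow> ('a \<Rightarrow> real) \<Rightarrow> real" where
  "form B \<phi> = (\<integral>u. (\<integral>v. \<phi> u * B u v * \<phi> v \<partial>M) \<partial>M)"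

definition psd :: "('a \<Rightarrow> 'a \<Rightarrow> real) \<Rightarrow> bool" where
  "psd B \<longleftrightarrow> bounded_measurable (M \<Otimes>\<^sub>M M) (\<lambda>(u, v). B u v) \<and> (\<forall>\<phi>. bounded_measurable M \<phi> \<longrightarrow> 0 \<le> form B \<phi>)"

lemma bounded_measurable_gram:
  assumes "bounded_measurable (M \<Otimes>\<^sub>M M) (\<lambda>(u, z). D u z)"
  shows "bounded_measurable (M \<Otimes>\<^sub>M M) (\<lambda>(u, v). gram D u v)"
proof -
  have "bounded_measurable ((M \<Otimes>\<^sub>M M) \<Otimes>\<^sub>M M) (\<lambda>(p, z). D (fst p) z * D (snd p) z)"
    unfolding case_prod_unfold
    by (intro bounded_measurable_mult bounded_measurable_comp2[OF assms]) measurable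
  from bounded_measurable_integral[OF this] show ?thesis
    by (simp add: gram_def case_prod_unfold)
qed

text \<open>The Schur product with a Gram kernel is an average, over \<open>z\<close>, of rescalings of \<open>B\<close> by
  \<open>D(\<cdot>, z)\<close>; this is why it preserves positivity.\<close>

lemma form_mult_gram:
  assumes B: "bounded_measurable (M \<Otimes>\<^sub>M M) (\<lambda>(u, v). B u v)"
    and D: "bounded_measurable (M \<Otimes>\<^sub>M M) (\<lambda>(u, z). D u z)"
    and \<phi>: "bounded_measurable M \<phi>"
  shows "form (\<lambda>u v. B u v * gram D u v) \<phi> = (\<integral>z. form B (\<lambda>u. \<phi> u * D u z) \<partial>M)"
proof -
  have "form (\<lambda>u v. B u v * gram D u v) \<phi> =
      (\<integral>u. (\<integral>v. (\<integral>z. \<phi> u * D u z * B u v * (\<phi> v * D v z) \<partial>M) \<partial>M) \<partial>M)"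
    unfolding form_def gram_def
    by (simp add: mult.commute mult.left_commute flip: integral_mult_right_zero)
  also have "\<dots> = (\<integral>z. form B (\<lambda>u. \<phi> u * D u z) \<partial>M)"
    unfolding form_def
  proof (rule integral_rotate)
    show "bounded_measurable ((M \<Otimes>\<^sub>M M) \<Otimes>\<^sub>M M) (\<lambda>((u, v), z). \<phi> u * D u z * B u v * (\<phi> v * D v z))"
      unfolding case_prod_unfold
      by (intro bounded_measurable_mult bounded_measurable_comp2[OF D] bounded_measurable_comp2[OF B] bounded_measurable_comp[OF \<phi>])
         measurable
  qed
  finally show ?thesis .
qed

lemma psd_mult_gram:
  assumes B: "psd B" and D: "bounded_measurable (M \<Otimes>\<^sub>M M) (\<lambda>(u, z). D u z)"
  shows "psd (\<lambda>u v. B u v * gram D u v)"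
  unfolding psd_def
proof (intro conjI allI impI)
  show "bounded_measurable (M \<Otimes>\<^sub>M M) (\<lambda>(u, v). B u v * gram D u v)"
    using B bounded_measurable_gram[OF D] by (auto simp: psd_def case_prod_unfold)
  fix \<phi> assume \<phi>: "bounded_measurable M \<phi>"
  have "0 \<le> (\<integral>z. form B (\<lambda>u. \<phi> u * D u z) \<partial>M)"
  proof (rule Bochner_Integration.integral_nonneg_AE, rule AE_I2)
    fix z assume z: "z \<in> space M"
    have "bounded_measurable M (\<lambda>u. \<phi> u * D u z)"
      using z by (intro bounded_measurable_mult \<phi> bounded_measurable_comp2[OF D]) auto
    then show "0 \<le> form B (\<lambda>u. \<phi> u * D u z)" using B by (auto simp: psd_def)
  qed
  then show "0 \<le> form (\<lambda>u v. B u v * gram D u v) \<phi>"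
    using B by (simp add: form_mult_gram[OF _ D \<phi>] psd_def)
qed

lemma form_one: "form (\<lambda>_ _. 1) \<phi> = (\<integral>u. \<phi> u \<partial>M)\<^sup>2"
  by (simp add: form_def power2_eq_square)

lemma psd_one: "psd (\<lambda>_ _. 1)"
  by (simp add: psd_def form_one case_prod_unfold)

text \<open>The Gram kernel of \<open>D\<close> dominates \<open>\<beta>(u) \<beta>(v) / \<integral> \<psi>\<^sup>2\<close> in the positive semidefinite
  order, because projecting \<open>D(u, \<cdot>)\<close> to the line spanned by \<open>\<psi>\<close> shortens all vectors at once.
  The order is kept by Schur multiplication with \<open>B\<close>.\<close>

lemma form_gram_ge:
  assumes B: "psd B" and D: "bounded_measurable (M \<Otimes>\<^sub>M M) (\<lambda>(u, z). D u z)"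
    and \<phi>: "bounded_measurable M \<phi>" and \<psi>: "bounded_measurable M \<psi>"
    and \<beta>: "\<And>u. u \<in> space M \<Longrightarrow> \<beta> u = (\<integral>z. D u z * \<psi> z \<partial>M)"
    and s: "0 < (\<integral>z. (\<psi> z)\<^sup>2 \<partial>M)"
  shows "form B (\<lambda>u. \<phi> u * \<beta> u) \<le> (\<integral>z. (\<psi> z)\<^sup>2 \<partial>M) * form (\<lambda>u v. B u v * gram D u v) \<phi>"
proof -
  define s where "s = (\<integral>z. (\<psi> z)\<^sup>2 \<partial>M)"
  have s': "s > 0" using s by (simp add: s_def)
  define \<beta>' where "\<beta>' u = (\<integral>z. D u z * \<psi> z \<partial>M)" for u
  have \<beta>_eq: "\<beta> u = \<beta>' u" if "u \<in> space M" for u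
    using that by (simp add: \<beta> \<beta>'_def)
  have \<beta>'_bd: "bounded_measurable M \<beta>'"
    unfolding \<beta>'_def
    using bounded_measurable_mult[OF D bounded_measurable_comp[OF \<psi>, of snd]]
    by (intro bounded_measurable_integral) (simp add: case_prod_unfold)
  \<comment> \<open>\<open>E\<close> is the part of \<open>D\<close> orthogonal to \<open>\<psi>\<close>; its Gram kernel is that of \<open>D\<close> minus
    the rank one kernel \<open>\<beta> u * \<beta> v / s\<close>.\<close>
  define E where "E u z = D u z - \<beta>' u * \<psi> z / s" for u z
  have E: "bounded_measurable (M \<Otimes>\<^sub>M M) (\<lambda>(u, z). E u z)"
  proof -
    have "bounded_measurable (M \<Otimes>\<^sub>M M) (\<lambda>p. D (fst p) (snd p) - (1 / s) * (\<beta>' (fst p) * \<psi> (snd p)))"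
      by (intro bounded_measurable_diff bounded_measurable_mult bounded_measurable_const bounded_measurable_comp2[OF D]
          bounded_measurable_comp[OF \<beta>'_bd] bounded_measurable_comp[OF \<psi>]) measurable
    then show ?thesis by (simp add: E_def case_prod_unfold)
  qed
  have gram_E: "gram E u v = gram D u v - \<beta> u * \<beta> v / s" if "u \<in> space M" "v \<in> space M" for u v
  proof -
    have sec: "bounded_measurable M (\<lambda>z. D u z)" "bounded_measurable M (\<lambda>z. D v z)"
      using that by (auto intro: bounded_measurable_section[OF D])
    have int: "integrable M (\<lambda>z. D u z * D v z)" "integrable M (\<lambda>z. D u z * \<psi> z)"
      "integrable M (\<lambda>z. D v z * \<psi> z)" "integrable M (\<lambda>z. (\<psi> z)\<^sup>2)"
      using sec \<psi> by (auto simp: power2_eq_square)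
    have "gram E u v = (\<integral>z. D u z * D v z - \<beta>' v / s * (D u z * \<psi> z) - \<beta>' u / s * (D v z * \<psi> z)
        + \<beta>' u * \<beta>' v / s\<^sup>2 * (\<psi> z)\<^sup>2 \<partial>M)"
      unfolding gram_def E_def
      by (rule Bochner_Integration.integral_cong[OF refl]) (use s' in \<open>simp add: field_simps power2_eq_square\<close>)
    also have "\<dots> = gram D u v - \<beta>' v / s * \<beta>' u - \<beta>' u / s * \<beta>' v + \<beta>' u * \<beta>' v / s\<^sup>2 * s"
      using int by (simp add: gram_def \<beta>'_def s_def)
    also have "\<dots> = gram D u v - \<beta>' u * \<beta>' v / s"
      using s by (simp add: field_simps power2_eq_square s_def[symmetric])
    finally show ?thesis using that by (simp add: \<beta>_eq)
  qed
  have bdB: "bounded_measurable (M \<Otimes>\<^sub>M M) (\<lambda>(u, v). B u v)" using B by (simp add: psd_def)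
  have \<beta>_bd: "bounded_measurable (M \<Otimes>\<^sub>M M) (\<lambda>(u, v). \<phi> u * \<beta>' u * B u v * (\<phi> v * \<beta>' v))"
    unfolding case_prod_unfold
    by (intro bounded_measurable_mult bounded_measurable_comp2[OF bdB] bounded_measurable_comp[OF \<beta>'_bd] bounded_measurable_comp[OF \<phi>])
       measurable
  have D_bd: "bounded_measurable (M \<Otimes>\<^sub>M M) (\<lambda>(u, v). \<phi> u * (B u v * gram D u v) * \<phi> v)"
    unfolding case_prod_unfold
    by (intro bounded_measurable_mult bounded_measurable_comp2[OF bdB] bounded_measurable_comp2[OF bounded_measurable_gram[OF D]]
         bounded_measurable_comp[OF \<phi>]) measurable
  have form_\<beta>: "form B (\<lambda>u. \<phi> u * \<beta> u) = form B (\<lambda>u. \<phi> u * \<beta>' u)"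
    unfolding form_def by (intro Bochner_Integration.integral_cong refl) (simp add: \<beta>_eq)
  have "0 \<le> form (\<lambda>u v. B u v * gram E u v) \<phi>"
    using psd_mult_gram[OF B E] \<phi> by (auto simp: psd_def)
  also have "\<dots> = (\<integral>u. (\<integral>v. \<phi> u * (B u v * gram D u v) * \<phi> v
      - 1 / s * (\<phi> u * \<beta>' u * B u v * (\<phi> v * \<beta>' v)) \<partial>M) \<partial>M)"
    unfolding form_def
    by (intro Bochner_Integration.integral_cong refl)
       (simp add: gram_E \<beta>_eq field_simps)
  also have "\<dots> = (\<integral>u. (\<integral>v. \<phi> u * (B u v * gram D u v) * \<phi> v \<partial>M)
      - 1 / s * (\<integral>v. \<phi> u * \<beta>' u * B u v * (\<phi> v * \<beta>' v) \<partial>M) \<partial>M)"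
    using bounded_measurable_section[OF D_bd] bounded_measurable_section[OF \<beta>_bd]
    by (intro Bochner_Integration.integral_cong refl,
        subst Bochner_Integration.integral_diff)
       (auto intro!: integrable_bounded_measurable bounded_measurable_mult[OF bounded_measurable_const])
  also have "\<dots> = form (\<lambda>u v. B u v * gram D u v) \<phi> - 1 / s * form B (\<lambda>u. \<phi> u * \<beta>' u)"
    unfolding form_def
    using bounded_measurable_integral[OF D_bd] bounded_measurable_integral[OF \<beta>_bd]
    by (subst Bochner_Integration.integral_diff)
       (auto intro!: integrable_bounded_measurable bounded_measurable_mult[OF bounded_measurable_const] simp del: integral_mult_right_zero integral_mult_left_zero)
  finally show ?thesis
    using s unfolding s_def[symmetric] form_\<beta> by (simp add: field_simps)
qed

end

section \<open>Weighted walks\<close>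

context prob_space
begin

text \<open>Starting from \<open>x\<close>, \<open>transfer K ws \<rho> x\<close> integrates over all walks whose further vertices
  carry the weights \<open>ws\<close>, and evaluates \<open>\<rho>\<close> at their last vertex. A leg of a spider is the case
  \<open>\<rho> = 1\<close>; a path with fixed ends is the case in which \<open>\<rho>\<close> is one more edge.\<close>

primrec transfer :: "('a \<Rightarrow> 'a \<Rightarrow> real) \<Rightarrow> ('a \<Rightarrow> real) list \<Rightarrow> ('a \<Rightarrow> real) \<Rightarrow> 'a \<Rightarrow> real" where
  "transfer K [] \<rho> = \<rho>"
| "transfer K (w # ws) \<rho> = (\<lambda>x. \<integral>z. K x z * (w z * transfer K ws \<rho> z) \<partial>M)"

definition path_kernel :: "('a \<Rightarrow> 'a \<Rightarrow> real) \<Rightarrow> ('a \<Rightarrow> real) list \<Rightarrow> 'a \<Rightarrow> 'a \<Rightarrow> real" where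
  "path_kernel K ws u v = transfer K ws (\<lambda>t. K t v) u"

lemma transfer_append: "transfer K (xs @ ys) \<rho> = transfer K xs (transfer K ys \<rho>)"
  by (induction xs) auto

lemma transfer_cong:
  assumes "\<And>t. t \<in> space M \<Longrightarrow> \<rho> t = \<rho>' t" "u \<in> space M"
  shows "transfer K ws \<rho> u = transfer K ws \<rho>' u"
  using assms(2)
proof (induction ws arbitrary: u)
  case (Cons w ws)
  then show ?case by (auto intro: Bochner_Integration.integral_cong)
qed (simp add: assms)

lemma bounded_measurable_transfer2:
  assumes K: "bounded_measurable (M \<Otimes>\<^sub>M M) (\<lambda>(x, y). K x y)" and ws: "\<And>w. w \<in> set ws \<Longrightarrow> bounded_measurable M w"
    and \<rho>: "bounded_measurable (M \<Otimes>\<^sub>M N) (\<lambda>(t, z). \<rho> t z)"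
  shows "bounded_measurable (M \<Otimes>\<^sub>M N) (\<lambda>(u, z). transfer K ws (\<lambda>t. \<rho> t z) u)"
  using ws
proof (induction ws)
  case Nil
  then show ?case using \<rho> by simp
next
  case (Cons w ws)
  have w: "bounded_measurable M w" and
    IH: "bounded_measurable (M \<Otimes>\<^sub>M N) (\<lambda>(u, z). transfer K ws (\<lambda>t. \<rho> t z) u)"
    using Cons by auto
  have "bounded_measurable ((M \<Otimes>\<^sub>M N) \<Otimes>\<^sub>M M)
      (\<lambda>(p, t). K (fst p) t * (w t * transfer K ws (\<lambda>t. \<rho> t (snd p)) t))"
    unfolding case_prod_unfold
    by (intro bounded_measurable_mult bounded_measurable_comp2[OF K] bounded_measurable_comp[OF w] bounded_measurable_comp2[OF IH])
       measurable
  from bounded_measurable_integral[OF this] show ?case by (simp add: case_prod_unfold)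
qed

lemma bounded_measurable_path_kernel:
  assumes "bounded_measurable (M \<Otimes>\<^sub>M M) (\<lambda>(x, y). K x y)" "\<And>w. w \<in> set ws \<Longrightarrow> bounded_measurable M w"
  shows "bounded_measurable (M \<Otimes>\<^sub>M M) (\<lambda>(u, v). path_kernel K ws u v)"
  unfolding path_kernel_def using assms by (intro bounded_measurable_transfer2) auto

lemma bounded_measurable_transfer:
  assumes K: "bounded_measurable (M \<Otimes>\<^sub>M M) (\<lambda>(x, y). K x y)" and ws: "\<And>w. w \<in> set ws \<Longrightarrow> bounded_measurable M w"
    and \<rho>: "bounded_measurable M \<rho>"
  shows "bounded_measurable M (transfer K ws \<rho>)"
  using ws
proof (induction ws)
  case Nil
  then show ?case using \<rho> by simp
next
  case (Cons w ws)
  then have "bounded_measurable (M \<Otimes>\<^sub>M M) (\<lambda>(x, z). K x z * (w z * transfer K ws \<rho> z))"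
    unfolding case_prod_unfold
    by (intro bounded_measurable_mult bounded_measurable_comp2[OF K] bounded_measurable_comp[where N = M and p = snd]) auto
  then show ?case by (simp add: bounded_measurable_integral)
qed

text \<open>A transfer operator commutes with integration over a parameter of its argument. All
  manipulations of walks below (reversal, cutting) are instances of this.\<close>

lemma integral_transfer:
  assumes K: "bounded_measurable (M \<Otimes>\<^sub>M M) (\<lambda>(x, y). K x y)" and ws: "\<And>w. w \<in> set ws \<Longrightarrow> bounded_measurable M w"
    and \<rho>: "bounded_measurable (M \<Otimes>\<^sub>M M) (\<lambda>(t, z). \<rho> t z)" and c: "bounded_measurable M c"
    and u: "u \<in> space M"
  shows "(\<integral>z. transfer K ws (\<lambda>t. \<rho> t z) u * c z \<partial>M) = transfer K ws (\<lambda>t. \<integral>z. \<rho> t z * c z \<partial>M) u"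
  using ws u
proof (induction ws arbitrary: u)
  case (Cons w ws)
  have w: "bounded_measurable M w" and
    T: "bounded_measurable (M \<Otimes>\<^sub>M M) (\<lambda>(u, z). transfer K ws (\<lambda>t. \<rho> t z) u)"
    using Cons.prems bounded_measurable_transfer2[OF K _ \<rho>] by auto
  have "(\<integral>z. transfer K (w # ws) (\<lambda>t. \<rho> t z) u * c z \<partial>M) =
      (\<integral>z. (\<integral>t. K u t * (w t * (transfer K ws (\<lambda>t. \<rho> t z) t * c z)) \<partial>M) \<partial>M)"
    by (simp add: mult.assoc flip: integral_mult_left_zero)
  also have "\<dots> = (\<integral>t. (\<integral>z. K u t * (w t * (transfer K ws (\<lambda>t. \<rho> t z) t * c z)) \<partial>M) \<partial>M)"
  proof (rule integral_swap[symmetric])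
    show "bounded_measurable (M \<Otimes>\<^sub>M M) (\<lambda>(t, z). K u t * (w t * (transfer K ws (\<lambda>t. \<rho> t z) t * c z)))"
      unfolding case_prod_unfold
      by (intro bounded_measurable_mult bounded_measurable_comp2[OF K] bounded_measurable_comp[OF w] bounded_measurable_comp[OF c]
          bounded_measurable_comp2[OF T]) (use Cons.prems in measurable)
  qed
  also have "\<dots> = (\<integral>t. K u t * (w t * (\<integral>z. transfer K ws (\<lambda>t. \<rho> t z) t * c z \<partial>M)) \<partial>M)"
    by simp
  also have "\<dots> = transfer K (w # ws) (\<lambda>t. \<integral>z. \<rho> t z * c z \<partial>M) u"
    using Cons by (auto intro!: Bochner_Integration.integral_cong)
  finally show ?case .
qed simp

lemma path_kernel_rev:
  assumes K: "bounded_measurable (M \<Otimes>\<^sub>M M) (\<lambda>(x, y). K x y)" and sym: "\<And>x y. K x y = K y x"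
    and "\<And>w. w \<in> set ws \<Longrightarrow> bounded_measurable M w" "u \<in> space M" "v \<in> space M"
  shows "path_kernel K (rev ws) u v = path_kernel K ws v u"
  using assms(3-)
proof (induction ws arbitrary: u v)
  case Nil
  then show ?case by (simp add: path_kernel_def sym)
next
  case (Cons w ws)
  have bd: "bounded_measurable M (\<lambda>z. w z * K z v)"
    using Cons.prems by (intro bounded_measurable_mult bounded_measurable_comp2[OF K]) auto
  have "path_kernel K (rev (w # ws)) u v = transfer K (rev ws) (\<lambda>t. \<integral>z. K t z * (w z * K z v) \<partial>M) u"
    by (simp add: path_kernel_def transfer_append)
  also have "\<dots> = (\<integral>z. path_kernel K (rev ws) u z * (w z * K z v) \<partial>M)"
    unfolding path_kernel_def
    using Cons.prems by (intro integral_transfer[symmetric] K bd) auto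
  also have "\<dots> = (\<integral>z. K v z * (w z * path_kernel K ws z u) \<partial>M)"
    using Cons by (intro Bochner_Integration.integral_cong) (auto simp: sym[of v])
  also have "\<dots> = path_kernel K (w # ws) v u"
    by (simp add: path_kernel_def)
  finally show ?case .
qed

text \<open>Attaching the same walk to both sides of a Gram kernel gives a Gram kernel.\<close>

lemma gram_transfer:
  assumes K: "bounded_measurable (M \<Otimes>\<^sub>M M) (\<lambda>(x, y). K x y)" and ws: "\<And>w. w \<in> set ws \<Longrightarrow> bounded_measurable M w"
    and \<rho>: "bounded_measurable (M \<Otimes>\<^sub>M M) (\<lambda>(t, z). \<rho> t z)" and uv: "u \<in> space M" "v \<in> space M"
  shows "gram (\<lambda>u z. transfer K ws (\<lambda>t. \<rho> t z) u) u v
    = transfer K ws (\<lambda>t. transfer K ws (gram \<rho> t) v) u"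
proof -
  have T: "bounded_measurable M (\<lambda>z. transfer K ws (\<lambda>t. \<rho> t z) v)"
    using bounded_measurable_section[OF bounded_measurable_transfer2[OF K ws \<rho>] uv(2)] .
  have "gram (\<lambda>u z. transfer K ws (\<lambda>t. \<rho> t z) u) u v =
      transfer K ws (\<lambda>t. \<integral>z. \<rho> t z * transfer K ws (\<lambda>t. \<rho> t z) v \<partial>M) u"
    unfolding gram_def by (rule integral_transfer[OF K ws \<rho> T uv(1)])
  also have "\<dots> = transfer K ws (\<lambda>t. transfer K ws (gram \<rho> t) v) u"
  proof (rule transfer_cong[OF _ uv(1)])
    fix t assume t: "t \<in> space M"
    have "(\<integral>z. \<rho> t z * transfer K ws (\<lambda>t. \<rho> t z) v \<partial>M) = (\<integral>z. transfer K ws (\<lambda>s. \<rho> s z) v * \<rho> t z \<partial>M)"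
      by (simp add: mult.commute)
    also have "\<dots> = transfer K ws (\<lambda>s. \<integral>z. \<rho> s z * \<rho> t z \<partial>M) v"
      by (rule integral_transfer[OF K ws \<rho> bounded_measurable_section[OF \<rho> t] uv(2)])
    finally show "(\<integral>z. \<rho> t z * transfer K ws (\<lambda>t. \<rho> t z) v \<partial>M) = transfer K ws (gram \<rho> t) v"
      by (simp add: gram_def[abs_def] mult.commute)
  qed
  finally show ?thesis .
qed

end

section \<open>Cutting paths in the middle\<close>

lemma palindrome_cases:
  assumes "rev ws = ws"
  obtains (even) vs where "ws = vs @ rev vs" | (odd) vs m where "ws = vs @ m # rev vs"
proof -
  define n where "n = length ws div 2"
  have take: "rev (drop (length ws - n) ws) = take n ws"
    using assms by (metis rev_take rev_rev_ident)
  show ?thesis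
  proof (cases "Parity.even (length ws)")
    case True
    then have "length ws - n = n" unfolding n_def by presburger
    then have "ws = take n ws @ rev (take n ws)"
      using take by (metis append_take_drop_id rev_rev_ident)
    then show ?thesis using that(1) by blast
  next
    case False
    then have *: "length ws - n = Suc n" "n < length ws" unfolding n_def by presburger+
    then have "ws = take n ws @ ws ! n # rev (take n ws)"
      using take by (metis id_take_nth_drop rev_rev_ident)
    then show ?thesis using that(2) by blast
  qed
qed

locale gram_kernel = prob_space M for M :: "'a measure" +
  fixes h :: "'a \<Rightarrow> 'a \<Rightarrow> real"
  assumes h: "bounded_measurable (M \<Otimes>\<^sub>M M) (\<lambda>(x, z). h x z)"
begin

abbreviation K :: "'a \<Rightarrow> 'a \<Rightarrow> real" where "K \<equiv> gram h"

lemma K: "bounded_measurable (M \<Otimes>\<^sub>M M) (\<lambda>(x, y). K x y)"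
  by (rule bounded_measurable_gram[OF h])

lemma K_sym: "K x y = K y x"
  by (simp add: gram_def mult.commute)

lemma K_flip: "(\<lambda>s. K s t) = K t"
  by (rule ext) (rule K_sym)

text \<open>The conclusion lists what is needed to trade a symmetric path for two copies of a leg with
  weights \<open>us\<close>. Here \<open>n\<close> is \<open>1\<close> if the path has odd length and \<open>0\<close> otherwise. The path has
  \<open>length ws + 1\<close> edges, so its length is odd if the list of its inner weights has even
  length. Middle edges are cut through \<open>h\<close>; a middle vertex of weight \<open>m\<close> is split into two
  vertices of weight \<open>sqrt m\<close>.\<close>

lemma halve_path:
  assumes ws: "\<And>w. w \<in> set ws \<Longrightarrow> bounded_measurable M w \<and> (\<forall>t\<in>space M. 0 \<le> w t)" and pal: "rev ws = ws"
    and f: "bounded_measurable M f" "\<And>t. t \<in> space M \<Longrightarrow> 0 \<le> f t"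
  obtains D \<psi> us n where
    "bounded_measurable (M \<Otimes>\<^sub>M M) (\<lambda>(u, z). D u z)" "bounded_measurable M \<psi>"
    "\<And>u v. u \<in> space M \<Longrightarrow> v \<in> space M \<Longrightarrow> path_kernel K ws u v = gram D u v"
    "\<And>u. u \<in> space M \<Longrightarrow> transfer K us (\<lambda>_. 1) u = (\<integral>z. D u z * \<psi> z \<partial>M)"
    "(\<integral>z. (\<psi> z)\<^sup>2 \<partial>M) = form K f ^ n"
    "\<And>u. u \<in> set us \<Longrightarrow> bounded_measurable M u \<and> (\<forall>t\<in>space M. 0 \<le> u t)"
    "2 * length us = length ws + 1 + n"
    "\<And>t. t \<in> space M \<Longrightarrow> (\<Prod>u\<leftarrow>us. u t)\<^sup>2 = (\<Prod>w\<leftarrow>ws. w t) * f t ^ (2 * n)"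
proof -
  note witness = that
  have thesisI: ?thesis
    if vs: "set vs \<subseteq> set ws" and \<rho>: "bounded_measurable (M \<Otimes>\<^sub>M M) (\<lambda>(t, z). \<rho> t z)" and \<psi>: "bounded_measurable M \<psi>"
      and ker: "\<And>u v. u \<in> space M \<Longrightarrow> v \<in> space M \<Longrightarrow>
          path_kernel K ws u v = transfer K vs (\<lambda>t. transfer K vs (gram \<rho> t) v) u"
      and leg: "\<And>t. t \<in> space M \<Longrightarrow> (\<integral>z. K t z * m z \<partial>M) = (\<integral>z. \<rho> t z * \<psi> z \<partial>M)"
      and m: "bounded_measurable M m" "\<And>t. t \<in> space M \<Longrightarrow> 0 \<le> m t"
      and sq: "(\<integral>z. (\<psi> z)\<^sup>2 \<partial>M) = form K f ^ n"
      and len: "2 * length vs + 1 = length ws + n"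
      and prod: "\<And>t. t \<in> space M \<Longrightarrow> ((\<Prod>v\<leftarrow>vs. v t) * m t)\<^sup>2 = (\<Prod>w\<leftarrow>ws. w t) * f t ^ (2 * n)"
    for vs \<rho> \<psi> m n
  proof (rule witness[of "\<lambda>u z. transfer K vs (\<lambda>t. \<rho> t z) u" \<psi> "vs @ [m]" n])
    have vs': "\<And>v. v \<in> set vs \<Longrightarrow> bounded_measurable M v" using vs ws by auto
    show "bounded_measurable (M \<Otimes>\<^sub>M M) (\<lambda>(u, z). transfer K vs (\<lambda>t. \<rho> t z) u)"
      by (rule bounded_measurable_transfer2[OF K vs' \<rho>])
    show "path_kernel K ws u v = gram (\<lambda>u z. transfer K vs (\<lambda>t. \<rho> t z) u) u v"
      if "u \<in> space M" "v \<in> space M" for u v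
      using that by (simp add: ker gram_transfer[OF K vs' \<rho>])
    show "transfer K (vs @ [m]) (\<lambda>_. 1) u = (\<integral>z. transfer K vs (\<lambda>t. \<rho> t z) u * \<psi> z \<partial>M)"
      if "u \<in> space M" for u
    proof -
      have "transfer K (vs @ [m]) (\<lambda>_. 1) u = transfer K vs (\<lambda>t. \<integral>z. K t z * m z \<partial>M) u"
        by (simp add: transfer_append)
      also have "\<dots> = transfer K vs (\<lambda>t. \<integral>z. \<rho> t z * \<psi> z \<partial>M) u"
        by (rule transfer_cong[OF leg that])
      finally show ?thesis
        by (simp only: integral_transfer[OF K vs' \<rho> \<psi> that])
    qed
    show "bounded_measurable M u \<and> (\<forall>t\<in>space M. 0 \<le> u t)" if "u \<in> set (vs @ [m])" for u
      using that vs ws m by auto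
  qed (use \<psi> sq len prod in \<open>auto simp: mult.commute\<close>)
  from pal show thesis
  proof (cases rule: palindrome_cases)
    case (even vs)
    \<comment> \<open>Pairing \<open>h t\<close> with this \<open>\<psi>\<close> restores the cut edge, the new end having weight \<open>f\<close>.\<close>
    define \<psi> where "\<psi> z = (\<integral>y. f y * h y z \<partial>M)" for z
    have hf: "bounded_measurable (M \<Otimes>\<^sub>M M) (\<lambda>(z, y). f y * h y z)"
      unfolding case_prod_unfold
      by (intro bounded_measurable_mult bounded_measurable_comp[OF f(1)] bounded_measurable_comp2[OF h]) measurable
    have \<psi>: "bounded_measurable M \<psi>"
      unfolding \<psi>_def by (rule bounded_measurable_integral[OF hf])
    have vs: "\<And>v. v \<in> set vs \<Longrightarrow> bounded_measurable M v" using even ws by auto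
    show thesis
    proof (rule thesisI[of vs h \<psi> f 1])
      show "path_kernel K ws u v = transfer K vs (\<lambda>t. transfer K vs (K t) v) u"
        if uv: "u \<in> space M" "v \<in> space M" for u v
      proof -
        have "path_kernel K ws u v = transfer K vs (\<lambda>t. path_kernel K (rev vs) t v) u"
          by (simp add: path_kernel_def even transfer_append)
        also have "\<dots> = transfer K vs (\<lambda>t. path_kernel K vs v t) u"
          using uv path_kernel_rev[OF K K_sym vs] by (intro transfer_cong) auto
        finally show ?thesis by (simp add: path_kernel_def K_flip)
      qed
      show "(\<integral>z. K t z * f z \<partial>M) = (\<integral>z. h t z * \<psi> z \<partial>M)" if t: "t \<in> space M" for t
      proof -
        have "(\<integral>z. h t z * \<psi> z \<partial>M) = (\<integral>z. (\<integral>y. h t z * (f y * h y z) \<partial>M) \<partial>M)"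
          by (simp add: \<psi>_def)
        also have "\<dots> = (\<integral>y. (\<integral>z. h t z * (f y * h y z) \<partial>M) \<partial>M)"
          by (rule integral_swap, unfold case_prod_unfold)
             (intro bounded_measurable_mult bounded_measurable_comp[OF f(1)] bounded_measurable_comp2[OF h];
               use t in measurable)
        also have "\<dots> = (\<integral>y. K t y * f y \<partial>M)"
        proof (rule Bochner_Integration.integral_cong[OF refl])
          fix y
          have "(\<integral>z. h t z * (f y * h y z) \<partial>M) = (\<integral>z. (h t z * h y z) * f y \<partial>M)"
            by (simp only: mult_ac)
          then show "(\<integral>z. h t z * (f y * h y z) \<partial>M) = K t y * f y"
            by (simp only: gram_def Bochner_Integration.integral_mult_left_zero)
        qed
        finally show ?thesis by simp
      qed
      show "(\<integral>z. (\<psi> z)\<^sup>2 \<partial>M) = form K f ^ 1"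
        using form_mult_gram[of "\<lambda>_ _. 1", OF _ h f(1)]
        by (simp add: form_one \<psi>_def case_prod_unfold)
    qed (use even h \<psi> f in \<open>auto simp: power2_eq_square rev_map[symmetric] prod_list.rev\<close>)
  next
    case (odd vs m)
    have vs: "\<And>v. v \<in> set vs \<Longrightarrow> bounded_measurable M v" using odd ws by auto
    have m: "bounded_measurable M m" "\<And>t. t \<in> space M \<Longrightarrow> 0 \<le> m t" using odd ws by auto
    define \<rho> where "\<rho> t z = K t z * sqrt (m z)" for t z
    show thesis
    proof (rule thesisI[of vs \<rho> "\<lambda>_. 1" "\<lambda>t. sqrt (m t)" 0])
      show "bounded_measurable (M \<Otimes>\<^sub>M M) (\<lambda>(t, z). \<rho> t z)"
        unfolding case_prod_unfold \<rho>_def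
        by (intro bounded_measurable_mult bounded_measurable_sqrt bounded_measurable_comp[OF m(1)] bounded_measurable_comp2[OF K]) measurable
      show "path_kernel K ws u v = transfer K vs (\<lambda>t. transfer K vs (gram \<rho> t) v) u"
        if uv: "u \<in> space M" "v \<in> space M" for u v
      proof -
        have "path_kernel K ws u v =
            transfer K vs (\<lambda>t. \<integral>z. K t z * (m z * path_kernel K (rev vs) z v) \<partial>M) u"
          by (simp add: path_kernel_def odd transfer_append)
        also have "\<dots> = transfer K vs (\<lambda>t. transfer K vs (gram \<rho> t) v) u"
        proof (rule transfer_cong[OF _ uv(1)])
          fix t assume t: "t \<in> space M"
          have "(\<integral>z. K t z * (m z * path_kernel K (rev vs) z v) \<partial>M) =
              (\<integral>z. transfer K vs (\<lambda>s. K s z) v * (K t z * m z) \<partial>M)"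
            using uv path_kernel_rev[OF K K_sym vs]
            by (intro Bochner_Integration.integral_cong) (auto simp: path_kernel_def)
          also have "\<dots> = transfer K vs (\<lambda>s. \<integral>z. K s z * (K t z * m z) \<partial>M) v"
            using bounded_measurable_section[OF K t] m(1)
            by (intro integral_transfer[OF K vs K _ uv(2)] bounded_measurable_mult)
          also have "(\<lambda>s. \<integral>z. K s z * (K t z * m z) \<partial>M) = gram \<rho> t"
          proof
            fix s
            have "\<rho> t z * \<rho> s z = K s z * (K t z * m z)" if "z \<in> space M" for z
              using m(2)[OF that] by (simp add: \<rho>_def mult.assoc mult.left_commute)
            then show "(\<integral>z. K s z * (K t z * m z) \<partial>M) = gram \<rho> t s"
              unfolding gram_def[of \<rho>] by (intro Bochner_Integration.integral_cong) auto
          qed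
          finally show "(\<integral>z. K t z * (m z * path_kernel K (rev vs) z v) \<partial>M) = transfer K vs (gram \<rho> t) v" .
        qed
        finally show ?thesis .
      qed
    qed (use odd m prob_space in \<open>auto simp: \<rho>_def power_mult_distrib power2_eq_square rev_map[symmetric] prod_list.rev\<close>)
  qed
qed

text \<open>Paths are cut one at a time, the remaining ones forming the positive semidefinite kernel
  required by \<open>form_gram_ge\<close>. The test function \<open>\<phi>\<close> is arbitrary because the legs obtained so far
  are absorbed into it. The total \<open>n\<close> counts the paths of odd length.\<close>

lemma theta_ge_spider:
  assumes wss: "\<forall>ws\<in>set wss. rev ws = ws \<and> (\<forall>w\<in>set ws. bounded_measurable M w \<and> (\<forall>t\<in>space M. 0 \<le> w t))"
    and f: "bounded_measurable M f" "\<forall>t\<in>space M. 0 \<le> f t"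
  shows "\<exists>uss n. (\<forall>us\<in>set uss. \<forall>u\<in>set us. bounded_measurable M u \<and> (\<forall>t\<in>space M. 0 \<le> u t)) \<and>
    2 * (\<Sum>us\<leftarrow>uss. length us) = (\<Sum>ws\<leftarrow>wss. length ws + 1) + n \<and>
    (\<forall>t\<in>space M. (\<Prod>us\<leftarrow>uss. \<Prod>u\<leftarrow>us. u t)\<^sup>2 = (\<Prod>ws\<leftarrow>wss. \<Prod>w\<leftarrow>ws. w t) * f t ^ (2 * n)) \<and>
    psd (\<lambda>u v. \<Prod>ws\<leftarrow>wss. path_kernel K ws u v) \<and>
    (\<forall>\<phi>. 0 < form K f \<longrightarrow> bounded_measurable M \<phi> \<longrightarrow>
       (\<integral>u. \<phi> u * (\<Prod>us\<leftarrow>uss. transfer K us (\<lambda>_. 1) u) \<partial>M)\<^sup>2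
         \<le> form K f ^ n * form (\<lambda>u v. \<Prod>ws\<leftarrow>wss. path_kernel K ws u v) \<phi>)"
  using wss
proof (induction wss)
  case Nil
  show ?case
    by (rule exI[of _ "[]"], rule exI[of _ 0]) (simp add: form_one psd_one)
next
  case (Cons ws wss)
  have tail: "\<forall>ws\<in>set wss. rev ws = ws \<and> (\<forall>w\<in>set ws. bounded_measurable M w \<and> (\<forall>t\<in>space M. 0 \<le> w t))"
    using Cons.prems by simp
  obtain uss n where uss: "\<forall>us\<in>set uss. \<forall>u\<in>set us. bounded_measurable M u \<and> (\<forall>t\<in>space M. 0 \<le> u t)"
    and len: "2 * (\<Sum>us\<leftarrow>uss. length us) = (\<Sum>ws\<leftarrow>wss. length ws + 1) + n"
    and prod: "\<forall>t\<in>space M. (\<Prod>us\<leftarrow>uss. \<Prod>u\<leftarrow>us. u t)\<^sup>2 = (\<Prod>ws\<leftarrow>wss. \<Prod>w\<leftarrow>ws. w t) * f t ^ (2 * n)"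
    and psd: "psd (\<lambda>u v. \<Prod>ws\<leftarrow>wss. path_kernel K ws u v)"
    and IH: "\<forall>\<phi>. 0 < form K f \<longrightarrow> bounded_measurable M \<phi> \<longrightarrow>
       (\<integral>u. \<phi> u * (\<Prod>us\<leftarrow>uss. transfer K us (\<lambda>_. 1) u) \<partial>M)\<^sup>2
         \<le> form K f ^ n * form (\<lambda>u v. \<Prod>ws\<leftarrow>wss. path_kernel K ws u v) \<phi>"
    using Cons.IH[OF tail] by (elim exE conjE) (rule that)
  have ws: "\<And>w. w \<in> set ws \<Longrightarrow> bounded_measurable M w \<and> (\<forall>t\<in>space M. 0 \<le> w t)" "rev ws = ws"
    using Cons.prems by auto
  obtain D \<psi> us k where D: "bounded_measurable (M \<Otimes>\<^sub>M M) (\<lambda>(u, z). D u z)" and \<psi>: "bounded_measurable M \<psi>"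
    and ker: "\<And>u v. u \<in> space M \<Longrightarrow> v \<in> space M \<Longrightarrow> path_kernel K ws u v = gram D u v"
    and leg: "\<And>u. u \<in> space M \<Longrightarrow> transfer K us (\<lambda>_. 1) u = (\<integral>z. D u z * \<psi> z \<partial>M)"
    and sq: "(\<integral>z. (\<psi> z)\<^sup>2 \<partial>M) = form K f ^ k"
    and us: "\<And>u. u \<in> set us \<Longrightarrow> bounded_measurable M u \<and> (\<forall>t\<in>space M. 0 \<le> u t)"
    and len': "2 * length us = length ws + 1 + k"
    and prod': "\<And>t. t \<in> space M \<Longrightarrow> (\<Prod>u\<leftarrow>us. u t)\<^sup>2 = (\<Prod>w\<leftarrow>ws. w t) * f t ^ (2 * k)"
    by (rule halve_path[OF ws f(1) bspec[OF f(2)]], assumption, assumption) (rule that; assumption)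
  define B where "B u v = (\<Prod>ws\<leftarrow>wss. path_kernel K ws u v)" for u v
  have psd_B: "psd B" using psd by (simp add: B_def[abs_def])
  have bdB: "bounded_measurable (M \<Otimes>\<^sub>M M) (\<lambda>(u, v). \<Prod>ws\<leftarrow>ws # wss. path_kernel K ws u v)"
    unfolding case_prod_unfold
    by (intro bounded_measurable_prod_list bounded_measurable_comp2[OF bounded_measurable_path_kernel[OF K]])
       (use Cons.prems in auto)
  have form_eq: "form (\<lambda>u v. \<Prod>ws\<leftarrow>ws # wss. path_kernel K ws u v) \<phi> = form (\<lambda>u v. B u v * gram D u v) \<phi>" for \<phi>
    unfolding form_def
    by (intro Bochner_Integration.integral_cong refl) (simp add: ker B_def)
  have bdl: "bounded_measurable M (transfer K us (\<lambda>_. 1))"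
    using us by (intro bounded_measurable_transfer K) auto
  show ?case
  proof (rule exI[of _ "us # uss"], rule exI[of _ "k + n"], intro conjI allI impI)
    show "psd (\<lambda>u v. \<Prod>ws\<leftarrow>ws # wss. path_kernel K ws u v)"
      using psd_mult_gram[OF psd_B D] bdB unfolding psd_def form_eq by simp
    fix \<phi> assume Z: "0 < form K f" and \<phi>: "bounded_measurable M \<phi>"
    have "(\<integral>u. \<phi> u * (\<Prod>us\<leftarrow>us # uss. transfer K us (\<lambda>_. 1) u) \<partial>M)\<^sup>2
        = (\<integral>u. \<phi> u * transfer K us (\<lambda>_. 1) u * (\<Prod>us\<leftarrow>uss. transfer K us (\<lambda>_. 1) u) \<partial>M)\<^sup>2"
      by (simp add: mult.assoc)
    also have "\<dots> \<le> form K f ^ n * form B (\<lambda>u. \<phi> u * transfer K us (\<lambda>_. 1) u)"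
      using IH[rule_format, OF Z bounded_measurable_mult[OF \<phi> bdl]] by (simp add: B_def[abs_def])
    also have "\<dots> \<le> form K f ^ n * (form K f ^ k * form (\<lambda>u v. B u v * gram D u v) \<phi>)"
      using form_gram_ge[OF psd_B D \<phi> \<psi> leg] Z by (intro mult_left_mono) (auto simp: sq)
    finally show "(\<integral>u. \<phi> u * (\<Prod>us\<leftarrow>us # uss. transfer K us (\<lambda>_. 1) u) \<partial>M)\<^sup>2
        \<le> form K f ^ (k + n) * form (\<lambda>u v. \<Prod>ws\<leftarrow>ws # wss. path_kernel K ws u v) \<phi>"
      unfolding form_eq by (simp add: power_add mult_ac)
  next
    show "\<forall>us\<in>set (us # uss). \<forall>u\<in>set us. bounded_measurable M u \<and> (\<forall>t\<in>space M. 0 \<le> u t)"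
      using us uss by simp
    show "2 * (\<Sum>us\<leftarrow>us # uss. length us) = (\<Sum>ws\<leftarrow>ws # wss. length ws + 1) + (k + n)"
      using len len' by simp
    show "\<forall>t\<in>space M. (\<Prod>us\<leftarrow>us # uss. \<Prod>u\<leftarrow>us. u t)\<^sup>2
        = (\<Prod>ws\<leftarrow>ws # wss. \<Prod>w\<leftarrow>ws. w t) * f t ^ (2 * (k + n))"
      using prod prod' by (simp add: power_mult_distrib power_add distrib_left)
  qed
qed

end

section \<open>The entropy method for spiders\<close>

text \<open>Functions bounded away from zero have bounded logarithms, so that no integrability
  question arises.\<close>

definition bounded_pos :: "'a measure \<Rightarrow> ('a \<Rightarrow> real) \<Rightarrow> bool" where
  "bounded_pos M f \<longleftrightarrow> bounded_measurable M f \<and> (\<exists>\<epsilon>>0. \<forall>x\<in>space M. \<epsilon> \<le> f x)"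

lemma bounded_pos_measurable: "bounded_pos M f \<Longrightarrow> bounded_measurable M f"
  by (simp add: bounded_pos_def)

lemma bounded_pos_gt_0: "bounded_pos M f \<Longrightarrow> x \<in> space M \<Longrightarrow> 0 < f x"
  by (fastforce simp: bounded_pos_def)

lemma bounded_pos_const: "0 < c \<Longrightarrow> bounded_pos M (\<lambda>_. c)"
  by (auto simp: bounded_pos_def)

lemma bounded_pos_mult:
  assumes "bounded_pos M f" "bounded_pos M g" shows "bounded_pos M (\<lambda>x. f x * g x)"
proof -
  obtain a b where "a > 0" "\<And>x. x \<in> space M \<Longrightarrow> a \<le> f x" "b > 0" "\<And>x. x \<in> space M \<Longrightarrow> b \<le> g x"
    using assms by (auto simp: bounded_pos_def)
  then have "a * b > 0" "\<And>x. x \<in> space M \<Longrightarrow> a * b \<le> f x * g x"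
    by (auto intro!: mult_mono intro: order_trans[OF less_imp_le])
  then show ?thesis using assms unfolding bounded_pos_def by blast
qed

lemma bounded_pos_prod_list:
  "(\<And>f. f \<in> set fs \<Longrightarrow> bounded_pos M (F f)) \<Longrightarrow> bounded_pos M (\<lambda>x. \<Prod>f\<leftarrow>fs. F f x)"
  by (induction fs) (auto intro: bounded_pos_const bounded_pos_mult)

lemma bounded_pos_divide:
  assumes f: "bounded_pos M f" and g: "bounded_pos M g" shows "bounded_pos M (\<lambda>x. f x / g x)"
proof -
  obtain a where a: "a > 0" "\<And>x. x \<in> space M \<Longrightarrow> a \<le> g x"
    using g by (auto simp: bounded_pos_def)
  obtain B where B: "\<And>x. x \<in> space M \<Longrightarrow> \<bar>g x\<bar> \<le> B"
    using g by (auto simp: bounded_pos_def bounded_measurable_iff)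
  have "bounded_pos M (\<lambda>x. inverse (g x))"
    unfolding bounded_pos_def bounded_measurable_iff
  proof (intro conjI exI ballI)
    show "(\<lambda>x. inverse (g x)) \<in> borel_measurable M"
      using g by (auto simp: bounded_pos_def bounded_measurable_iff)
    show "0 < inverse (max B 1)" by simp
    fix x assume x: "x \<in> space M"
    show "\<bar>inverse (g x)\<bar> \<le> inverse a"
      using a x order_less_le_trans[OF a(1) a(2)[OF x]] by (auto intro: le_imp_inverse_le)
    show "inverse (max B 1) \<le> inverse (g x)"
      using B[OF x] order_less_le_trans[OF a(1) a(2)[OF x]] by (intro le_imp_inverse_le) auto
  qed
  from bounded_pos_mult[OF f this] show ?thesis by (simp add: divide_inverse)
qed

lemma bounded_pos_ln:
  assumes f: "bounded_pos M f" shows "bounded_measurable M (\<lambda>x. ln (f x))"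
proof -
  obtain a where a: "a > 0" "\<And>x. x \<in> space M \<Longrightarrow> a \<le> f x"
    using f by (auto simp: bounded_pos_def)
  obtain B where B: "\<And>x. x \<in> space M \<Longrightarrow> \<bar>f x\<bar> \<le> B"
    using f by (auto simp: bounded_pos_def bounded_measurable_iff)
  have "\<bar>ln (f x)\<bar> \<le> max \<bar>ln a\<bar> \<bar>ln B\<bar>" if x: "x \<in> space M" for x
  proof -
    have "0 < f x" using a(1) a(2)[OF x] by simp
    then have "ln a \<le> ln (f x)" "ln (f x) \<le> ln B"
      using a B[OF x] x by auto
    then show ?thesis by linarith
  qed
  then show ?thesis using f by (auto simp: bounded_pos_def bounded_measurable_iff)
qed

context prob_space
begin

lemma bounded_pos_integral:
  assumes f: "bounded_pos (M \<Otimes>\<^sub>M M) (\<lambda>(x, y). f x y)"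
  shows "bounded_pos M (\<lambda>x. \<integral>y. f x y \<partial>M)"
proof -
  obtain a where a: "a > 0" "\<And>x y. x \<in> space M \<Longrightarrow> y \<in> space M \<Longrightarrow> a \<le> f x y"
    using f by (auto simp: bounded_pos_def space_pair_measure)
  have bd: "bounded_measurable (M \<Otimes>\<^sub>M M) (\<lambda>(x, y). f x y)" using f by (simp add: bounded_pos_def)
  have "a \<le> (\<integral>y. f x y \<partial>M)" if "x \<in> space M" for x
    using a that by (intro integral_ge_const integrable_bounded_measurable bounded_measurable_section[OF bd]) auto
  with a(1) bounded_measurable_integral[OF bd] show ?thesis by (auto simp: bounded_pos_def)
qed

lemma bounded_pos_comp:
  assumes "bounded_pos N f" "p \<in> measurable L N" shows "bounded_pos L (\<lambda>x. f (p x))"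
  using assms measurable_space[OF assms(2)] bounded_measurable_comp[of N f p L]
  by (fastforce simp: bounded_pos_def)

lemma bounded_pos_transfer:
  assumes g: "bounded_pos (M \<Otimes>\<^sub>M M) (\<lambda>(x, y). g x y)" and us: "\<And>u. u \<in> set us \<Longrightarrow> bounded_pos M u"
  shows "bounded_pos M (transfer g us (\<lambda>_. 1))"
  using us
proof (induction us)
  case (Cons w us)
  have "bounded_pos (M \<Otimes>\<^sub>M M) (\<lambda>(x, z). g x z * (w z * transfer g us (\<lambda>_. 1) z))"
    using g Cons bounded_pos_comp[where N = M and L = "M \<Otimes>\<^sub>M M" and p = snd]
    unfolding case_prod_unfold by (intro bounded_pos_mult) auto
  then show ?case by (simp add: bounded_pos_integral)
qed (simp add: bounded_pos_const)

text \<open>Jensen's inequality for the logarithm, with respect to the measure of density \<open>p\<close>: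
  integrate \<open>ln t \<le> ln c + t / c - 1\<close>, where \<open>c\<close> is the mean of \<open>X\<close>.\<close>

lemma integral_ln_le:
  assumes p: "bounded_measurable M p" "\<And>x. x \<in> space M \<Longrightarrow> 0 \<le> p x" and P: "0 < (\<integral>x. p x \<partial>M)"
    and X: "bounded_pos M X"
  shows "(\<integral>x. p x * ln (X x) \<partial>M) \<le> (\<integral>x. p x \<partial>M) * ln ((\<integral>x. p x * X x \<partial>M) / (\<integral>x. p x \<partial>M))"
proof -
  define P where "P = (\<integral>x. p x \<partial>M)"
  define c where "c = (\<integral>x. p x * X x \<partial>M) / P"
  have X': "bounded_measurable M X" "bounded_measurable M (\<lambda>x. ln (X x))"
    using X by (simp_all add: bounded_pos_def bounded_pos_ln)
  obtain a where a: "a > 0" "\<And>x. x \<in> space M \<Longrightarrow> a \<le> X x"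
    using X by (auto simp: bounded_pos_def)
  have "a * P = (\<integral>x. p x * a \<partial>M)" by (simp add: P_def)
  also have "\<dots> \<le> (\<integral>x. p x * X x \<partial>M)"
    using p a X' by (intro integral_mono integrable_bounded_measurable) (auto intro: mult_left_mono)
  finally have c: "c > 0" using a P by (simp add: c_def P_def) (meson divide_pos_pos less_le_trans mult_pos_pos)
  have "(\<integral>x. p x * ln (X x) \<partial>M) \<le> (\<integral>x. p x * ln c + p x * X x / c - p x \<partial>M)"
  proof (rule integral_mono)
    show "integrable M (\<lambda>x. p x * ln (X x))" "integrable M (\<lambda>x. p x * ln c + p x * X x / c - p x)"
      using p X'
      by (intro integrable_bounded_measurable bounded_measurable_add bounded_measurable_diff
          bounded_measurable_divide_const bounded_measurable_mult bounded_measurable_const; simp)+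
    fix x assume x: "x \<in> space M"
    have Xx: "X x > 0" using bounded_pos_gt_0[OF X x] .
    have "ln (X x) - ln c \<le> X x / c - 1"
      using ln_le_minus_one[of "X x / c"] Xx c by (simp add: ln_div)
    from mult_left_mono[OF this p(2)[OF x]]
    show "p x * ln (X x) \<le> p x * ln c + p x * X x / c - p x"
      by (simp add: algebra_simps)
  qed
  also have "\<dots> = P * ln c + (\<integral>x. p x * X x \<partial>M) / c - P"
  proof -
    have "integrable M p" "integrable M (\<lambda>x. p x * X x)"
      using p X' by (auto intro!: integrable_bounded_measurable)
    then show ?thesis by (simp add: P_def)
  qed
  also have "(\<integral>x. p x * X x \<partial>M) / c = P"
    using P c by (auto simp: c_def P_def field_simps)
  finally show ?thesis by (simp add: P_def c_def)
qed

text \<open>The function \<open>f x * d x\<close> is the density of one vertex under the edge density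
  \<open>f x * g x y * f y\<close>. A step of the Markov chain from \<open>x\<close> contributes the factor \<open>d x\<close>, and the
  vertex that it reaches the factor \<open>u / f\<close>. As the chain is stationary, after Jensen's
  inequality every step sees the same density, whatever its distance from the root.\<close>

lemma integral_ln_transfer_ge:
  assumes g: "bounded_pos (M \<Otimes>\<^sub>M M) (\<lambda>(x, y). g x y)" and sym: "\<And>x y. g x y = g y x"
    and f: "bounded_pos M f"
    and us: "\<And>u. u \<in> set us \<Longrightarrow> bounded_pos M u"
  defines "d \<equiv> \<lambda>x. \<integral>y. g x y * f y \<partial>M"
  shows "(\<integral>x. f x * d x * ((\<Sum>u\<leftarrow>us. ln (u x)) + length us * (ln (d x) - ln (f x))) \<partial>M)
    \<le> (\<integral>x. f x * d x * ln (transfer g us (\<lambda>_. 1) x) \<partial>M)"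
  using us
proof (induction us)
  case (Cons w us)
  have gf: "bounded_pos (M \<Otimes>\<^sub>M M) (\<lambda>(x, y). g x y * f y)"
    using g f bounded_pos_comp[where N = M and L = "M \<Otimes>\<^sub>M M" and p = snd]
    unfolding case_prod_unfold by (intro bounded_pos_mult) auto
  have d: "bounded_pos M d"
    unfolding d_def by (rule bounded_pos_integral[OF gf])
  define b where "b = transfer g us (\<lambda>_. 1)"
  define b' where "b' = transfer g (w # us) (\<lambda>_. 1)"
  have w: "bounded_pos M w" using Cons.prems by simp
  have b: "bounded_pos M b" "bounded_pos M b'"
    using Cons.prems by (auto simp: b_def b'_def intro!: bounded_pos_transfer[OF g] simp del: transfer.simps)
  define X where "X y = w y * b y / f y" for y
  have X: "bounded_pos M X" unfolding X_def by (intro bounded_pos_divide bounded_pos_mult w b f)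
  define S where "S x = (\<Sum>u\<leftarrow>us. ln (u x)) + length us * (ln (d x) - ln (f x))" for x
  have S: "bounded_measurable M S"
    unfolding S_def using Cons.prems
    by (intro bounded_measurable_add bounded_measurable_mult bounded_measurable_diff
        bounded_measurable_sum_list bounded_measurable_const bounded_pos_ln d f) auto
  note bd = bounded_pos_measurable[OF d] bounded_pos_measurable[OF f] S
    bounded_pos_ln[OF d] bounded_pos_ln[OF f] bounded_pos_ln[OF w] bounded_pos_ln[OF b(1)]
    bounded_pos_ln[OF b(2)] bounded_pos_ln[OF X]
  \<comment> \<open>The random step from \<open>x\<close> with density \<open>g x y * f y / d x\<close> preserves the measure of
    density \<open>f x * d x\<close>.\<close>
  have "(\<integral>x. f x * d x * ln (X x) \<partial>M) = (\<integral>y. f y * (\<integral>x. g y x * f x * ln (X y) \<partial>M) \<partial>M)"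
  proof (rule Bochner_Integration.integral_cong[OF refl])
    fix y
    have "(\<integral>x. g y x * f x * ln (X y) \<partial>M) = d y * ln (X y)"
      unfolding d_def by (rule Bochner_Integration.integral_mult_left_zero)
    then show "f y * d y * ln (X y) = f y * (\<integral>x. g y x * f x * ln (X y) \<partial>M)"
      by (simp only: mult.assoc)
  qed
  also have "\<dots> = (\<integral>y. (\<integral>x. f y * (g y x * f x * ln (X y)) \<partial>M) \<partial>M)"
    by simp
  also have "\<dots> = (\<integral>x. (\<integral>y. f y * (g y x * f x * ln (X y)) \<partial>M) \<partial>M)"
  proof (rule integral_swap)
    show "bounded_measurable (M \<Otimes>\<^sub>M M) (\<lambda>(y, x). f y * (g y x * f x * ln (X y)))"
      unfolding case_prod_unfold
      by (intro bounded_measurable_mult bounded_measurable_comp[OF bd(2), of fst]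
          bounded_measurable_comp[OF bd(2), of snd] bounded_measurable_comp[OF bd(9), of fst]
          bounded_measurable_comp2[OF bounded_pos_measurable[OF g]]) simp_all
  qed
  also have "\<dots> = (\<integral>x. f x * (\<integral>y. g x y * f y * ln (X y) \<partial>M) \<partial>M)"
  proof (rule Bochner_Integration.integral_cong[OF refl])
    fix x
    have "f y * (g y x * f x * ln (X y)) = f x * (g x y * f y * ln (X y))" for y
      using sym[of x y] by simp
    then show "(\<integral>y. f y * (g y x * f x * ln (X y)) \<partial>M) = f x * (\<integral>y. g x y * f y * ln (X y) \<partial>M)"
      by (simp only: Bochner_Integration.integral_mult_right_zero)
  qed
  also have "\<dots> \<le> (\<integral>x. f x * (d x * (ln (b' x) - ln (d x))) \<partial>M)"
  proof (rule integral_mono)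
    have "bounded_measurable (M \<Otimes>\<^sub>M M) (\<lambda>(x, y). g x y * f y * ln (X y))"
      unfolding case_prod_unfold
      by (intro bounded_measurable_mult bounded_measurable_comp[OF bd(2), of snd]
          bounded_measurable_comp[OF bd(9), of snd]
          bounded_measurable_comp2[OF bounded_pos_measurable[OF g]]) simp_all
    from bounded_measurable_integral[OF this]
    show "integrable M (\<lambda>x. f x * (\<integral>y. g x y * f y * ln (X y) \<partial>M))"
      by (intro integrable_bounded_measurable bounded_measurable_mult bd)
    show "integrable M (\<lambda>x. f x * (d x * (ln (b' x) - ln (d x))))"
      by (intro integrable_bounded_measurable bounded_measurable_mult bounded_measurable_diff bd)
    fix x assume x: "x \<in> space M"
    have pos: "0 < d x" "0 < b' x" "0 < f x"
      by (rule bounded_pos_gt_0[OF d x] bounded_pos_gt_0[OF b(2) x] bounded_pos_gt_0[OF f x])+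
    have gfx: "bounded_measurable M (\<lambda>y. g x y * f y)"
      using bounded_measurable_section[OF bounded_pos_measurable[OF gf] x] .
    have jensen: "(\<integral>y. g x y * f y * ln (X y) \<partial>M) \<le> d x * ln ((\<integral>y. g x y * f y * X y \<partial>M) / d x)"
      unfolding d_def
    proof (rule integral_ln_le[OF gfx _ _ X])
      show "0 \<le> g x y * f y" if "y \<in> space M" for y
        using bounded_pos_gt_0[OF gf, of "(x, y)"] x that by (simp add: space_pair_measure)
      show "0 < (\<integral>y. g x y * f y \<partial>M)" using pos(1) by (simp add: d_def)
    qed
    have mean: "(\<integral>y. g x y * f y * X y \<partial>M) = b' x"
      unfolding b'_def transfer.simps b_def[symmetric]
    proof (rule Bochner_Integration.integral_cong[OF refl])
      fix y assume "y \<in> space M"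
      then have "f y \<noteq> 0" using bounded_pos_gt_0[OF f] by fastforce
      then show "g x y * f y * X y = g x y * (w y * b y)" by (simp add: X_def)
    qed
    have "ln (b' x / d x) = ln (b' x) - ln (d x)" using pos by (simp add: ln_div)
    with jensen have "(\<integral>y. g x y * f y * ln (X y) \<partial>M) \<le> d x * (ln (b' x) - ln (d x))"
      by (simp only: mean)
    then show "f x * (\<integral>y. g x y * f y * ln (X y) \<partial>M) \<le> f x * (d x * (ln (b' x) - ln (d x)))"
      using pos by (intro mult_left_mono) auto
  qed
  finally have step: "(\<integral>x. f x * d x * ln (X x) \<partial>M) \<le> (\<integral>x. f x * (d x * (ln (b' x) - ln (d x))) \<partial>M)" .
  have "(\<integral>x. f x * d x * ((\<Sum>u\<leftarrow>w # us. ln (u x)) + length (w # us) * (ln (d x) - ln (f x))) \<partial>M)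
      = (\<integral>x. f x * d x * S x + (f x * d x * ln (X x) - f x * d x * ln (b x) + f x * d x * ln (d x)) \<partial>M)"
  proof (rule Bochner_Integration.integral_cong[OF refl])
    fix x assume x: "x \<in> space M"
    have "0 < w x" "0 < b x" "0 < f x"
      by (rule bounded_pos_gt_0[OF w x] bounded_pos_gt_0[OF b(1) x] bounded_pos_gt_0[OF f x])+
    then have ln_X: "ln (X x) = ln (w x) + ln (b x) - ln (f x)"
      by (simp add: X_def ln_div ln_mult)
    show "f x * d x * ((\<Sum>u\<leftarrow>w # us. ln (u x)) + length (w # us) * (ln (d x) - ln (f x)))
      = f x * d x * S x + (f x * d x * ln (X x) - f x * d x * ln (b x) + f x * d x * ln (d x))"
      by (simp add: S_def ln_X algebra_simps)
  qed
  also have "\<dots> = (\<integral>x. f x * d x * S x \<partial>M) + ((\<integral>x. f x * d x * ln (X x) \<partial>M)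
      - (\<integral>x. f x * d x * ln (b x) \<partial>M) + (\<integral>x. f x * d x * ln (d x) \<partial>M))"
  proof -
    have "integrable M (\<lambda>x. f x * d x * S x)" "integrable M (\<lambda>x. f x * d x * ln (X x))"
      "integrable M (\<lambda>x. f x * d x * ln (b x))" "integrable M (\<lambda>x. f x * d x * ln (d x))"
      by (intro integrable_bounded_measurable bounded_measurable_mult bd)+
    then show ?thesis by simp
  qed
  also have "\<dots> \<le> (\<integral>x. f x * (d x * (ln (b' x) - ln (d x))) \<partial>M) + (\<integral>x. f x * d x * ln (d x) \<partial>M)"
  proof -
    have "(\<integral>x. f x * d x * S x \<partial>M) \<le> (\<integral>x. f x * d x * ln (b x) \<partial>M)"
      unfolding S_def b_def using Cons.prems by (intro Cons.IH) auto
    then show ?thesis using step by linarith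
  qed
  also have "\<dots> = (\<integral>x. f x * (d x * (ln (b' x) - ln (d x))) + f x * d x * ln (d x) \<partial>M)"
    by (intro Bochner_Integration.integral_add[symmetric] integrable_bounded_measurable
        bounded_measurable_mult bounded_measurable_diff bd)
  also have "\<dots> = (\<integral>x. f x * d x * ln (b' x) \<partial>M)"
    by (intro Bochner_Integration.integral_cong refl) (simp add: algebra_simps)
  finally show ?case by (simp only: b'_def)
qed simp

lemma integral_ln_prod_list:
  assumes "bounded_measurable M p" "\<And>F. F \<in> set Fs \<Longrightarrow> bounded_pos M F"
  shows "(\<integral>x. p x * ln (\<Prod>F\<leftarrow>Fs. F x) \<partial>M) = (\<Sum>F\<leftarrow>Fs. \<integral>x. p x * ln (F x) \<partial>M)"
  using assms(2)
proof (induction Fs)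
  case (Cons F Fs)
  have P: "bounded_pos M (\<lambda>x. \<Prod>F\<leftarrow>Fs. F x)" using Cons by (intro bounded_pos_prod_list) auto
  have "(\<integral>x. p x * ln (\<Prod>F\<leftarrow>F # Fs. F x) \<partial>M)
      = (\<integral>x. p x * ln (F x) + p x * ln (\<Prod>F\<leftarrow>Fs. F x) \<partial>M)"
  proof (rule Bochner_Integration.integral_cong[OF refl])
    fix x assume "x \<in> space M"
    then have "0 < F x" "0 < (\<Prod>F\<leftarrow>Fs. F x)"
      using bounded_pos_gt_0[OF P] bounded_pos_gt_0[of M F] Cons.prems by auto
    then show "p x * ln (\<Prod>F\<leftarrow>F # Fs. F x) = p x * ln (F x) + p x * ln (\<Prod>F\<leftarrow>Fs. F x)"
      by (simp add: ln_mult distrib_left)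
  qed
  also have "\<dots> = (\<integral>x. p x * ln (F x) \<partial>M) + (\<integral>x. p x * ln (\<Prod>F\<leftarrow>Fs. F x) \<partial>M)"
    using Cons.prems assms(1) P
    by (intro Bochner_Integration.integral_add integrable_bounded_measurable bounded_measurable_mult bounded_pos_ln) auto
  finally show ?case using Cons by simp
qed simp

text \<open>With the logarithms of all legs bounded from below, a last application of Jensen's
  inequality at the root leaves \<open>(e - 1) * \<integral> p * ln p\<close>: the weights have turned into
  \<open>2 * e * ln f\<close>, each of the \<open>e\<close> edges brought \<open>ln d - ln f\<close>, and dividing by the density at the
  root removes one \<open>ln p = ln f + ln d\<close>.\<close>

lemma spider_ge_pos:
  assumes g: "bounded_pos (M \<Otimes>\<^sub>M M) (\<lambda>(x, y). g x y)" and sym: "\<And>x y. g x y = g y x"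
    and f: "bounded_pos M f" and \<phi>: "bounded_pos M \<phi>"
    and uss: "\<And>us u. us \<in> set uss \<Longrightarrow> u \<in> set us \<Longrightarrow> bounded_pos M u"
    and e: "e = (\<Sum>us\<leftarrow>uss. length us)" "1 \<le> e"
    and prod: "\<And>t. t \<in> space M \<Longrightarrow> \<phi> t * (\<Prod>us\<leftarrow>uss. \<Prod>u\<leftarrow>us. u t) = f t ^ (2 * e)"
  shows "form g f ^ e \<le> (\<integral>t. \<phi> t * (\<Prod>us\<leftarrow>uss. transfer g us (\<lambda>_. 1) t) \<partial>M)"
proof -
  define d where "d x = (\<integral>y. g x y * f y \<partial>M)" for x
  define p where "p x = f x * d x" for x
  define b where "b us = transfer g us (\<lambda>_. 1)" for us
  define N where "N = (\<integral>t. \<phi> t * (\<Prod>us\<leftarrow>uss. b us t) \<partial>M)"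
  define Z where "Z = form g f"
  have gf: "bounded_pos (M \<Otimes>\<^sub>M M) (\<lambda>(x, y). g x y * f y)"
    using g f bounded_pos_comp[where N = M and L = "M \<Otimes>\<^sub>M M" and p = snd]
    unfolding case_prod_unfold by (intro bounded_pos_mult) auto
  have d: "bounded_pos M d"
    unfolding d_def by (rule bounded_pos_integral[OF gf])
  have p: "bounded_pos M p" unfolding p_def by (intro bounded_pos_mult f d)
  have Z_p: "Z = (\<integral>x. p x \<partial>M)"
    unfolding Z_def form_def p_def d_def by (simp add: mult.assoc)
  have Z: "Z > 0"
  proof -
    obtain a where "a > 0" "\<And>x. x \<in> space M \<Longrightarrow> a \<le> p x" using p by (auto simp: bounded_pos_def)
    then have "a \<le> Z" unfolding Z_p
      by (intro integral_ge_const integrable_bounded_measurable bounded_pos_measurable[OF p]) auto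
    with \<open>a > 0\<close> show ?thesis by simp
  qed
  have b: "bounded_pos M (b us)" if "us \<in> set uss" for us
    unfolding b_def using uss[OF that] by (intro bounded_pos_transfer g)
  define B where "B x = (\<Prod>us\<leftarrow>uss. b us x)" for x
  have B: "bounded_pos M B" unfolding B_def by (intro bounded_pos_prod_list b)
  define S where "S us x = (\<Sum>u\<leftarrow>us. ln (u x)) + length us * (ln (d x) - ln (f x))" for us x
  have S: "bounded_measurable M (S us)" if "us \<in> set uss" for us
    unfolding S_def using uss[OF that]
    by (intro bounded_measurable_add bounded_measurable_mult bounded_measurable_diff
        bounded_measurable_sum_list bounded_measurable_const bounded_pos_ln d f) auto
  note bd = bounded_pos_measurable[OF p] bounded_pos_ln[OF p] bounded_pos_ln[OF \<phi>] bounded_pos_ln[OF B]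
    bounded_pos_ln[OF d] bounded_pos_ln[OF f]
  have "(\<integral>x. p x * (\<Sum>us\<leftarrow>uss. S us x) \<partial>M) = (\<Sum>us\<leftarrow>uss. \<integral>x. p x * S us x \<partial>M)"
    using S
  proof (induction uss)
    case (Cons us uss)
    have "bounded_measurable M (\<lambda>x. \<Sum>us\<leftarrow>uss. S us x)" "bounded_measurable M (S us)"
      using Cons.prems by auto
    then have "integrable M (\<lambda>x. p x * (\<Sum>us\<leftarrow>uss. S us x))" "integrable M (\<lambda>x. p x * S us x)"
      by (auto intro!: integrable_bounded_measurable bounded_measurable_mult bd)
    then show ?case using Cons by (simp add: distrib_left)
  qed simp
  also have "\<dots> \<le> (\<Sum>us\<leftarrow>uss. \<integral>x. p x * ln (b us x) \<partial>M)"
    using integral_ln_transfer_ge[OF g sym f] uss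
    by (intro sum_list_mono) (simp add: p_def S_def d_def b_def)
  also have "\<dots> = (\<integral>x. p x * ln (B x) \<partial>M)"
  proof -
    have *: "\<And>F. F \<in> set (map b uss) \<Longrightarrow> bounded_pos M F" using b by auto
    show ?thesis using integral_ln_prod_list[OF bd(1), of "map b uss", OF *] by (simp add: B_def comp_def)
  qed
  finally have legs: "(\<integral>x. p x * (\<Sum>us\<leftarrow>uss. S us x) \<partial>M) \<le> (\<integral>x. p x * ln (B x) \<partial>M)" .
  have real_e: "real e = (\<Sum>us\<leftarrow>uss. real (length us))"
    unfolding e(1) by (induction uss) auto
  have S_sum: "ln (\<phi> x) + (\<Sum>us\<leftarrow>uss. S us x) = 2 * e * ln (f x) + e * (ln (d x) - ln (f x))"
    if x: "x \<in> space M" for x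
  proof -
    have ln_prod: "ln (\<Prod>u\<leftarrow>us. u x) = (\<Sum>u\<leftarrow>us. ln (u x)) \<and> 0 < (\<Prod>u\<leftarrow>us. u x)"
      if "\<And>u. u \<in> set us \<Longrightarrow> 0 < u x" for us :: "('a \<Rightarrow> real) list"
      using that
    proof (induction us)
      case (Cons u us)
      have "0 < u x" and IH: "ln (\<Prod>u\<leftarrow>us. u x) = (\<Sum>u\<leftarrow>us. ln (u x)) \<and> 0 < (\<Prod>u\<leftarrow>us. u x)"
        using Cons by auto
      then show ?case by (simp add: ln_mult)
    qed simp
    have pos: "0 < u x" if "us \<in> set uss" "u \<in> set us" for us u
      using bounded_pos_gt_0[OF uss[OF that] x] .
    have "ln (\<Prod>us\<leftarrow>uss. \<Prod>u\<leftarrow>us. u x) = (\<Sum>us\<leftarrow>uss. \<Sum>u\<leftarrow>us. ln (u x)) \<and> 0 < (\<Prod>us\<leftarrow>uss. \<Prod>u\<leftarrow>us. u x)"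
      using pos
    proof (induction uss)
      case (Cons us uss)
      have "ln (\<Prod>u\<leftarrow>us. u x) = (\<Sum>u\<leftarrow>us. ln (u x)) \<and> 0 < (\<Prod>u\<leftarrow>us. u x)"
        using Cons.prems by (intro ln_prod) auto
      moreover have "ln (\<Prod>us\<leftarrow>uss. \<Prod>u\<leftarrow>us. u x) = (\<Sum>us\<leftarrow>uss. \<Sum>u\<leftarrow>us. ln (u x))
          \<and> 0 < (\<Prod>us\<leftarrow>uss. \<Prod>u\<leftarrow>us. u x)"
        using Cons.prems by (intro Cons.IH) auto
      ultimately show ?case by (simp add: ln_mult)
    qed simp
    then have "ln (\<phi> x) + (\<Sum>us\<leftarrow>uss. \<Sum>u\<leftarrow>us. ln (u x)) = ln (f x ^ (2 * e))"
      using bounded_pos_gt_0[OF \<phi> x] by (simp add: prod[OF x, symmetric] ln_mult)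
    also have "\<dots> = 2 * e * ln (f x)"
      using bounded_pos_gt_0[OF f x] by (simp add: ln_realpow)
    finally show ?thesis
      by (simp add: S_def sum_list_addf sum_list_mult_const real_e)
  qed
  have S': "bounded_measurable M (\<lambda>x. \<Sum>us\<leftarrow>uss. S us x)" using S by auto
  have mean: "(\<integral>x. p x * (\<phi> x * B x / p x) \<partial>M) = N"
    unfolding N_def B_def[symmetric]
  proof (rule Bochner_Integration.integral_cong[OF refl])
    fix x assume "x \<in> space M"
    then have "p x \<noteq> 0" using bounded_pos_gt_0[OF p] by fastforce
    then show "p x * (\<phi> x * B x / p x) = \<phi> x * B x" by simp
  qed
  have "(real e - 1) * (Z * ln Z) \<le> (real e - 1) * (\<integral>x. p x * ln (p x) \<partial>M)"
  proof (rule mult_left_mono)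
    \<comment> \<open>The relative entropy of the vertex distribution \<open>p / Z\<close> is nonnegative.\<close>
    have "(\<integral>x. p x * ln (1 / p x) \<partial>M) \<le> Z * ln ((\<integral>x. p x * (1 / p x) \<partial>M) / Z)"
      unfolding Z_p using Z bounded_pos_gt_0[OF p]
      by (intro integral_ln_le bd bounded_pos_divide p bounded_pos_const) (simp_all add: Z_p less_imp_le)
    moreover have "(\<integral>x. p x * ln (1 / p x) \<partial>M) = - (\<integral>x. p x * ln (p x) \<partial>M)"
      using bounded_pos_gt_0[OF p]
      by (subst Bochner_Integration.integral_minus[symmetric], intro Bochner_Integration.integral_cong) (auto simp: ln_div)
    moreover have "(\<integral>x. p x * (1 / p x) \<partial>M) = (\<integral>x. 1 \<partial>M)"
      using bounded_pos_gt_0[OF p] by (intro Bochner_Integration.integral_cong) force+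
    ultimately show "Z * ln Z \<le> (\<integral>x. p x * ln (p x) \<partial>M)"
      using Z by (simp add: prob_space ln_div)
  qed (use e(2) in simp)
  also have "\<dots> = (\<integral>x. p x * ((real e - 1) * ln (p x)) \<partial>M)"
    by (subst Bochner_Integration.integral_mult_right_zero[symmetric]) (simp only: mult_ac)
  also have "\<dots> = (\<integral>x. p x * (\<Sum>us\<leftarrow>uss. S us x) + p x * (ln (\<phi> x) - ln (p x)) \<partial>M)"
  proof (rule Bochner_Integration.integral_cong[OF refl])
    fix x assume x: "x \<in> space M"
    have "ln (p x) = ln (f x) + ln (d x)"
      using bounded_pos_gt_0[OF f x] bounded_pos_gt_0[OF d x] by (simp add: p_def ln_mult)
    then have "(real e - 1) * ln (p x) = (\<Sum>us\<leftarrow>uss. S us x) + (ln (\<phi> x) - ln (p x))"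
      using S_sum[OF x] by (simp add: algebra_simps)
    then show "p x * ((real e - 1) * ln (p x)) = p x * (\<Sum>us\<leftarrow>uss. S us x) + p x * (ln (\<phi> x) - ln (p x))"
      by (simp add: distrib_left)
  qed
  also have "\<dots> = (\<integral>x. p x * (\<Sum>us\<leftarrow>uss. S us x) \<partial>M) + (\<integral>x. p x * (ln (\<phi> x) - ln (p x)) \<partial>M)"
    by (intro Bochner_Integration.integral_add integrable_bounded_measurable bounded_measurable_mult
        bounded_measurable_diff S' bd)
  also have "\<dots> \<le> (\<integral>x. p x * ln (B x) \<partial>M) + (\<integral>x. p x * (ln (\<phi> x) - ln (p x)) \<partial>M)"
    using legs by simp
  also have "\<dots> = (\<integral>x. p x * ln (B x) + p x * (ln (\<phi> x) - ln (p x)) \<partial>M)"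
    by (intro Bochner_Integration.integral_add[symmetric] integrable_bounded_measurable bounded_measurable_mult
        bounded_measurable_diff bd)
  also have "\<dots> = (\<integral>x. p x * ln (\<phi> x * B x / p x) \<partial>M)"
  proof (rule Bochner_Integration.integral_cong[OF refl])
    fix x assume x: "x \<in> space M"
    show "p x * ln (B x) + p x * (ln (\<phi> x) - ln (p x)) = p x * ln (\<phi> x * B x / p x)"
      using bounded_pos_gt_0[OF p x] bounded_pos_gt_0[OF \<phi> x] bounded_pos_gt_0[OF B x]
      by (simp add: ln_div ln_mult algebra_simps)
  qed
  also have "\<dots> \<le> Z * ln (N / Z)"
    unfolding mean[symmetric] Z_p using Z bounded_pos_gt_0[OF p]
    by (intro integral_ln_le bd bounded_pos_divide bounded_pos_mult p \<phi> B) (simp_all add: Z_p less_imp_le)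
  finally have "Z * ((real e - 1) * ln Z) \<le> Z * ln (N / Z)"
    by (simp add: mult.left_commute)
  then have le: "(real e - 1) * ln Z \<le> ln (N / Z)"
    using Z by simp
  have N: "N > 0"
  proof -
    have bp: "bounded_pos M (\<lambda>x. \<phi> x * B x)" by (intro bounded_pos_mult \<phi> B)
    then obtain a where "a > 0" "\<And>x. x \<in> space M \<Longrightarrow> a \<le> \<phi> x * B x" by (auto simp: bounded_pos_def)
    then have "a \<le> N" unfolding N_def B_def[symmetric]
      by (intro integral_ge_const integrable_bounded_measurable bounded_pos_measurable[OF bp]) auto
    with \<open>a > 0\<close> show ?thesis by simp
  qed
  have "ln (Z ^ e) = real e * ln Z" using Z by (simp add: ln_realpow)
  also have "\<dots> \<le> ln N" using le N Z by (simp add: ln_div algebra_simps)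
  finally have "Z ^ e \<le> N" using Z N by simp
  then show ?thesis by (simp add: Z_def N_def b_def)
qed


text \<open>The uniform bound \<open>C\<close> is what lets dominated convergence pass to the next step of the walk;
  it also serves the outer integral over the root.\<close>

lemma transfer_tendsto:
  fixes g :: "nat \<Rightarrow> 'a \<Rightarrow> 'a \<Rightarrow> real" and B :: real
  assumes g: "\<And>n. bounded_measurable (M \<Otimes>\<^sub>M M) (\<lambda>(x, y). g n x y)"
    "\<And>n x y. x \<in> space M \<Longrightarrow> y \<in> space M \<Longrightarrow> \<bar>g n x y\<bar> \<le> B"
    "\<And>x y. x \<in> space M \<Longrightarrow> y \<in> space M \<Longrightarrow> (\<lambda>n. g n x y) \<longlonglongrightarrow> g' x y"
    and g': "bounded_measurable (M \<Otimes>\<^sub>M M) (\<lambda>(x, y). g' x y)"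
    and us: "\<And>v n. v \<in> set us \<Longrightarrow> bounded_measurable M (w n v)"
    "\<And>v n x. v \<in> set us \<Longrightarrow> x \<in> space M \<Longrightarrow> \<bar>w n v x\<bar> \<le> B"
    "\<And>v x. v \<in> set us \<Longrightarrow> x \<in> space M \<Longrightarrow> (\<lambda>n. w n v x) \<longlonglongrightarrow> v x"
    "\<And>v. v \<in> set us \<Longrightarrow> bounded_measurable M v"
  shows "\<exists>C. \<forall>x\<in>space M. (\<forall>n. \<bar>transfer (g n) (map (w n) us) (\<lambda>_. 1) x\<bar> \<le> C) \<and>
    (\<lambda>n. transfer (g n) (map (w n) us) (\<lambda>_. 1) x) \<longlonglongrightarrow> transfer g' us (\<lambda>_. 1) x"
  using us
proof (induction us)
  case Nil
  show ?case by (auto intro!: exI[of _ 1])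
next
  case (Cons v us)
  define b where "b n = transfer (g n) (map (w n) us) (\<lambda>_. 1)" for n
  define b' where "b' = transfer g' us (\<lambda>_. 1)"
  obtain C where C: "\<And>x n. x \<in> space M \<Longrightarrow> \<bar>b n x\<bar> \<le> C" "\<And>x. x \<in> space M \<Longrightarrow> (\<lambda>n. b n x) \<longlonglongrightarrow> b' x"
    using Cons.IH Cons.prems unfolding b_def b'_def by fastforce
  have bd: "bounded_measurable M (b n)" "bounded_measurable M b'" for n
    unfolding b_def b'_def using Cons.prems g g' by (auto intro!: bounded_measurable_transfer)
  have v: "bounded_measurable M (w n v)" "bounded_measurable M v"
    "x \<in> space M \<Longrightarrow> \<bar>w n v x\<bar> \<le> B" "x \<in> space M \<Longrightarrow> (\<lambda>n. w n v x) \<longlonglongrightarrow> v x" for n x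
    using Cons.prems by auto
  have bound: "\<bar>g n x z * (w n v z * b n z)\<bar> \<le> B * (B * C)" if "x \<in> space M" "z \<in> space M" for n x z
    unfolding abs_mult using that g(2)[OF that] v(3)[OF that(2)] C(1)[OF that(2)]
    by (intro mult_mono mult_nonneg_nonneg) (auto intro: order_trans[OF abs_ge_zero])
  show ?case
  proof (intro exI[of _ "B * (B * C)"] ballI conjI allI)
    fix x n assume x: "x \<in> space M"
    show "\<bar>transfer (g n) (map (w n) (v # us)) (\<lambda>_. 1) x\<bar> \<le> B * (B * C)"
      using bound[OF x] by (auto simp: b_def[symmetric] intro!: integral_abs_le)
  next
    fix x assume x: "x \<in> space M"
    have "(\<lambda>n. \<integral>z. g n x z * (w n v z * b n z) \<partial>M) \<longlonglongrightarrow> (\<integral>z. g' x z * (v z * b' z) \<partial>M)"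
    proof (rule integral_dominated_convergence[where w = "\<lambda>_. B * (B * C)"])
      show "(\<lambda>z. g' x z * (v z * b' z)) \<in> borel_measurable M"
        using bounded_measurable_section[OF g' x] v(2) bd(2)
        by (auto simp: bounded_measurable_iff)
      show "(\<lambda>z. g n x z * (w n v z * b n z)) \<in> borel_measurable M" for n
        using bounded_measurable_section[OF g(1) x, of n] v(1)[of n] bd(1)[of n]
        by (auto simp: bounded_measurable_iff)
      show "AE z in M. (\<lambda>n. g n x z * (w n v z * b n z)) \<longlonglongrightarrow> g' x z * (v z * b' z)"
        using x by (intro AE_I2 tendsto_mult g(3) v(4) C(2))
      show "AE z in M. norm (g n x z * (w n v z * b n z)) \<le> B * (B * C)" for n
        using bound[OF x] by (intro AE_I2) simp
    qed simp
    then show "(\<lambda>n. transfer (g n) (map (w n) (v # us)) (\<lambda>_. 1) x) \<longlonglongrightarrow> transfer g' (v # us) (\<lambda>_. 1) x"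
      by (simp add: b_def b'_def)
  qed
qed

text \<open>Adding \<open>\<delta> n\<close> to \<open>g\<close> and to all weights reduces to the positive case. The function \<open>F n\<close> that
  replaces \<open>f\<close> is dictated by the product of the new weights; it is at least \<open>f\<close>, so only the
  integral over the spider has to be shown to converge.\<close>

lemma spider_ge:
  assumes g: "bounded_measurable (M \<Otimes>\<^sub>M M) (\<lambda>(x, y). g x y)" "\<And>x y. g x y = g y x"
      "\<And>x y. x \<in> space M \<Longrightarrow> y \<in> space M \<Longrightarrow> 0 \<le> g x y"
    and f: "bounded_measurable M f" "\<And>t. t \<in> space M \<Longrightarrow> 0 \<le> f t"
    and \<phi>: "bounded_measurable M \<phi>" "\<And>t. t \<in> space M \<Longrightarrow> 0 \<le> \<phi> t"
    and uss: "\<And>us u. us \<in> set uss \<Longrightarrow> u \<in> set us \<Longrightarrow> bounded_measurable M u"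
      "\<And>us u t. us \<in> set uss \<Longrightarrow> u \<in> set us \<Longrightarrow> t \<in> space M \<Longrightarrow> 0 \<le> u t"
    and e: "e = (\<Sum>us\<leftarrow>uss. length us)" "1 \<le> e"
    and prod: "\<And>t. t \<in> space M \<Longrightarrow> \<phi> t * (\<Prod>us\<leftarrow>uss. \<Prod>u\<leftarrow>us. u t) = f t ^ (2 * e)"
  shows "form g f ^ e \<le> (\<integral>t. \<phi> t * (\<Prod>us\<leftarrow>uss. transfer g us (\<lambda>_. 1) t) \<partial>M)"
proof -
  define \<delta> where "\<delta> n = inverse (real (Suc n))" for n
  have \<delta>: "0 < \<delta> n" "\<delta> n \<le> 1" for n by (simp_all add: \<delta>_def inverse_le_1_iff)
  have \<delta>_lim: "\<delta> \<longlonglongrightarrow> 0" unfolding \<delta>_def by (rule LIMSEQ_inverse_real_of_nat)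
  have raise: "bounded_pos N (\<lambda>t. u t + \<delta> n)"
    if "bounded_measurable N u" "\<And>t. t \<in> space N \<Longrightarrow> 0 \<le> u t" for N :: "'b measure" and u n
    unfolding bounded_pos_def using that \<delta>(1)[of n] by (auto intro!: exI[of _ "\<delta> n"])
  define G where "G n x y = g x y + \<delta> n" for n x y
  define W where "W n u t = u t + \<delta> n" for n and u :: "'a \<Rightarrow> real" and t
  define F where "F n t = root (2 * e) (W n \<phi> t * (\<Prod>us\<leftarrow>uss. \<Prod>u\<leftarrow>us. W n u t))" for n t
  have G: "bounded_pos (M \<Otimes>\<^sub>M M) (\<lambda>(x, y). G n x y)" for n
    using raise[OF g(1), of n] g(3) by (auto simp: G_def case_prod_unfold space_pair_measure)
  have W: "bounded_pos M (W n u)" if "us \<in> set uss" "u \<in> set us" for n us u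
    unfolding W_def using that by (intro raise uss)
  have W\<phi>: "bounded_pos M (W n \<phi>)" for n
    unfolding W_def by (intro raise \<phi>)
  define Q where "Q n t = W n \<phi> t * (\<Prod>us\<leftarrow>uss. \<Prod>u\<leftarrow>us. W n u t)" for n t
  have Q: "bounded_pos M (Q n)" for n
    unfolding Q_def using W by (intro bounded_pos_mult bounded_pos_prod_list W\<phi>) auto
  have F_pow: "F n t ^ (2 * e) = Q n t" if "t \<in> space M" for n t
    using bounded_pos_gt_0[OF Q that, of n] e(2) by (simp add: F_def Q_def[symmetric] real_root_pow_pos2)
  have f_le_F: "f t \<le> F n t" if t: "t \<in> space M" for n t
  proof -
    have mono: "(\<Prod>u\<leftarrow>us. u t) \<le> (\<Prod>u\<leftarrow>us. W n u t) \<and> 0 \<le> (\<Prod>u\<leftarrow>us. u t)"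
      if "\<And>u. u \<in> set us \<Longrightarrow> 0 \<le> u t" for us
      using that
    proof (induction us)
      case (Cons u us)
      then show ?case using \<delta>(1)[of n] by (auto intro!: mult_mono simp: W_def)
    qed simp
    have "(\<Prod>us\<leftarrow>uss. \<Prod>u\<leftarrow>us. u t) \<le> (\<Prod>us\<leftarrow>uss. \<Prod>u\<leftarrow>us. W n u t) \<and> 0 \<le> (\<Prod>us\<leftarrow>uss. \<Prod>u\<leftarrow>us. u t)"
      using uss(2)[OF _ _ t]
    proof (induction uss)
      case (Cons us uss)
      have "(\<Prod>u\<leftarrow>us. u t) \<le> (\<Prod>u\<leftarrow>us. W n u t) \<and> 0 \<le> (\<Prod>u\<leftarrow>us. u t)"
        using Cons.prems by (intro mono) auto
      with Cons.IH Cons.prems show ?case by (auto intro!: mult_mono mult_nonneg_nonneg)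
    qed simp
    then have "f t ^ (2 * e) \<le> Q n t"
      unfolding prod[OF t, symmetric] Q_def using \<phi>(2)[OF t] \<delta>(1)[of n]
      by (intro mult_mono) (auto simp: W_def)
    then show ?thesis
      using F_pow[OF t, of n] power_mono_iff[of "f t" "F n t" "2 * e"] f(2)[OF t] e(2)
        bounded_pos_gt_0[OF Q t, of n] by (simp add: F_def Q_def)
  qed
  have F: "bounded_pos M (F n)" for n
  proof -
    obtain a where a: "a > 0" "\<And>t. t \<in> space M \<Longrightarrow> a \<le> Q n t" using Q[of n] by (auto simp: bounded_pos_def)
    obtain C where C: "\<And>t. t \<in> space M \<Longrightarrow> \<bar>Q n t\<bar> \<le> C"
      using Q[of n] by (auto simp: bounded_pos_def bounded_measurable_iff)
    show ?thesis unfolding bounded_pos_def bounded_measurable_iff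
    proof (intro conjI exI ballI)
      have [measurable]: "Q n \<in> borel_measurable M" using Q[of n] by (auto simp: bounded_pos_def bounded_measurable_iff)
      show "F n \<in> borel_measurable M" unfolding F_def Q_def[symmetric] by measurable
      show "0 < root (2 * e) a" using a e(2) by simp
      fix t assume t: "t \<in> space M"
      show "root (2 * e) a \<le> F n t" using a(2)[OF t] e(2) by (simp add: F_def Q_def)
      show "\<bar>F n t\<bar> \<le> root (2 * e) C"
        using C[OF t] a(1) a(2)[OF t] e(2) by (simp add: F_def Q_def[symmetric] real_root_abs[symmetric])
    qed
  qed
  have lower: "form g f ^ e \<le> (\<integral>t. W n \<phi> t * (\<Prod>us\<leftarrow>uss. transfer (G n) (map (W n) us) (\<lambda>_. 1) t) \<partial>M)" for n
  proof -
    have ffg: "bounded_measurable (M \<Otimes>\<^sub>M M) (\<lambda>(x, y). q x * k x y * q y)"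
      if "bounded_measurable M q" "bounded_measurable (M \<Otimes>\<^sub>M M) (\<lambda>(x, y). k x y)" for q and k :: "'a \<Rightarrow> 'a \<Rightarrow> real"
      unfolding case_prod_unfold
      by (intro bounded_measurable_mult bounded_measurable_comp[OF that(1)] bounded_measurable_comp2[OF that(2)]) auto
    note gf = ffg[OF f(1) g(1)] and GF = ffg[OF bounded_pos_measurable[OF F] bounded_pos_measurable[OF G], of n n]
    have "form g f \<le> form (G n) (F n)"
      unfolding form_def
    proof (rule integral_mono)
      show "integrable M (\<lambda>u. \<integral>v. f u * g u v * f v \<partial>M)" "integrable M (\<lambda>u. \<integral>v. F n u * G n u v * F n v \<partial>M)"
        using bounded_measurable_integral[OF gf] bounded_measurable_integral[OF GF] by auto
      fix u assume u: "u \<in> space M"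
      show "(\<integral>v. f u * g u v * f v \<partial>M) \<le> (\<integral>v. F n u * G n u v * F n v \<partial>M)"
      proof (rule integral_mono)
        show "integrable M (\<lambda>v. f u * g u v * f v)" "integrable M (\<lambda>v. F n u * G n u v * F n v)"
          using bounded_measurable_section[OF gf u] bounded_measurable_section[OF GF u] by auto
        fix v assume v: "v \<in> space M"
        have nn: "0 \<le> f u" "0 \<le> f v" "0 \<le> g u v" "f u \<le> F n u" "f v \<le> F n v" "g u v \<le> G n u v"
          using u v f(2) g(3) f_le_F \<delta>(1)[of n] by (auto simp: G_def)
        then show "f u * g u v * f v \<le> F n u * G n u v * F n v"
          by (intro mult_mono mult_nonneg_nonneg) auto
      qed
    qed
    moreover have "0 \<le> form g f"
      unfolding form_def using f(2) g(3) by (intro Bochner_Integration.integral_nonneg) auto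
    ultimately have "form g f ^ e \<le> form (G n) (F n) ^ e" by (rule power_mono)
    also have "\<dots> \<le> (\<integral>t. W n \<phi> t * (\<Prod>us\<leftarrow>map (map (W n)) uss. transfer (G n) us (\<lambda>_. 1) t) \<partial>M)"
    proof (rule spider_ge_pos[OF G _ F W\<phi>])
      show "G n x y = G n y x" for x y using g(2) by (simp add: G_def)
      show "bounded_pos M u" if "us \<in> set (map (map (W n)) uss)" "u \<in> set us" for us u
        using that W by auto
      show "e = (\<Sum>us\<leftarrow>map (map (W n)) uss. length us)" by (simp add: e(1) comp_def)
      show "W n \<phi> t * (\<Prod>us\<leftarrow>map (map (W n)) uss. \<Prod>u\<leftarrow>us. u t) = F n t ^ (2 * e)" if "t \<in> space M" for t
        using F_pow[OF that, of n] by (simp add: Q_def comp_def)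
    qed (rule e(2))
    finally show ?thesis by (simp add: comp_def)
  qed
  obtain Bg where Bg: "\<And>x y. x \<in> space M \<Longrightarrow> y \<in> space M \<Longrightarrow> \<bar>g x y\<bar> \<le> Bg"
    using g(1) by (auto simp: bounded_measurable_iff space_pair_measure)
  have transfer_lim: "\<exists>C. \<forall>x\<in>space M. (\<forall>n. \<bar>transfer (G n) (map (W n) us) (\<lambda>_. 1) x\<bar> \<le> C) \<and>
    (\<lambda>n. transfer (G n) (map (W n) us) (\<lambda>_. 1) x) \<longlonglongrightarrow> transfer g us (\<lambda>_. 1) x" if us: "us \<in> set uss" for us
  proof -
    have "\<exists>B. \<forall>v\<in>set us. \<forall>x\<in>space M. \<bar>v x\<bar> \<le> B"
      using uss(1)[OF us]
    proof (induction us)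
      case (Cons u us)
      then obtain B1 where B1: "\<forall>v\<in>set us. \<forall>x\<in>space M. \<bar>v x\<bar> \<le> B1" by auto
      obtain B2 where "\<forall>x\<in>space M. \<bar>u x\<bar> \<le> B2"
        using Cons.prems[of u] by (auto simp: bounded_measurable_iff)
      with B1 show ?case by (intro exI[of _ "max B1 B2"]) (auto simp: le_max_iff_disj)
    qed simp
    then obtain Bu where Bu: "\<And>v x. v \<in> set us \<Longrightarrow> x \<in> space M \<Longrightarrow> \<bar>v x\<bar> \<le> Bu" by auto
    have add: "\<bar>a + \<delta> n\<bar> \<le> max Bg Bu + 1" if "\<bar>a\<bar> \<le> Bg \<or> \<bar>a\<bar> \<le> Bu" for a n
      using that \<delta>[of n] by linarith
    have lim: "(\<lambda>n. a + \<delta> n) \<longlonglongrightarrow> a" for a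
      using tendsto_add[OF tendsto_const \<delta>_lim, of a] by simp
    have W': "bounded_measurable M (W n v)" if "v \<in> set us" for n v
      using W[OF us that] by (rule bounded_pos_measurable)
    show ?thesis
      by (rule transfer_tendsto[where B = "max Bg Bu + 1"])
         (use G W' g(1) us uss(1) Bg Bu lim add in \<open>auto simp: G_def W_def[abs_def] dest: bounded_pos_measurable\<close>)
  qed
  define b where "b n us = transfer (G n) (map (W n) us) (\<lambda>_. 1)" for n us
  have prod_lim: "\<exists>C. \<forall>x\<in>space M. (\<forall>n. \<bar>\<Prod>us\<leftarrow>uss. b n us x\<bar> \<le> C) \<and>
      (\<lambda>n. \<Prod>us\<leftarrow>uss. b n us x) \<longlonglongrightarrow> (\<Prod>us\<leftarrow>uss. transfer g us (\<lambda>_. 1) x)"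
    using transfer_lim
  proof (induction uss)
    case (Cons us uss)
    obtain C1 where C1: "\<forall>x\<in>space M. (\<forall>n. \<bar>b n us x\<bar> \<le> C1) \<and> (\<lambda>n. b n us x) \<longlonglongrightarrow> transfer g us (\<lambda>_. 1) x"
      using Cons.prems[of us] by (auto simp: b_def)
    obtain C2 where C2: "\<forall>x\<in>space M. (\<forall>n. \<bar>\<Prod>us\<leftarrow>uss. b n us x\<bar> \<le> C2) \<and>
      (\<lambda>n. \<Prod>us\<leftarrow>uss. b n us x) \<longlonglongrightarrow> (\<Prod>us\<leftarrow>uss. transfer g us (\<lambda>_. 1) x)"
      using Cons.IH Cons.prems by auto
    have "\<bar>b n us x * (\<Prod>us\<leftarrow>uss. b n us x)\<bar> \<le> C1 * C2" if "x \<in> space M" for n x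
      unfolding abs_mult using that C1 C2 by (intro mult_mono) (auto intro: order_trans[OF abs_ge_zero])
    then show ?case
      using C1 C2 by (intro exI[of _ "C1 * C2"]) (auto intro: tendsto_mult)
  qed (auto intro!: exI[of _ 1])
  then obtain C where C: "\<And>x n. x \<in> space M \<Longrightarrow> \<bar>\<Prod>us\<leftarrow>uss. b n us x\<bar> \<le> C"
    "\<And>x. x \<in> space M \<Longrightarrow> (\<lambda>n. \<Prod>us\<leftarrow>uss. b n us x) \<longlonglongrightarrow> (\<Prod>us\<leftarrow>uss. transfer g us (\<lambda>_. 1) x)"
    by auto
  obtain B\<phi> where B\<phi>: "\<And>x. x \<in> space M \<Longrightarrow> \<bar>\<phi> x\<bar> \<le> B\<phi>"
    using \<phi>(1) by (auto simp: bounded_measurable_iff)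
  have bd_b: "bounded_measurable M (b n us)" if "us \<in> set uss" for n us
    unfolding b_def using that bounded_pos_measurable[OF W]
    by (intro bounded_measurable_transfer bounded_pos_measurable[OF G]) auto
  have "(\<lambda>n. \<integral>t. W n \<phi> t * (\<Prod>us\<leftarrow>uss. b n us t) \<partial>M) \<longlonglongrightarrow> (\<integral>t. \<phi> t * (\<Prod>us\<leftarrow>uss. transfer g us (\<lambda>_. 1) t) \<partial>M)"
  proof (rule integral_dominated_convergence[where w = "\<lambda>_. (B\<phi> + 1) * C"])
    have "bounded_measurable M (\<lambda>t. \<phi> t * (\<Prod>us\<leftarrow>uss. transfer g us (\<lambda>_. 1) t))"
      using g(1) uss(1) by (intro bounded_measurable_mult bounded_measurable_prod_list bounded_measurable_transfer \<phi>(1)) auto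
    then show "(\<lambda>t. \<phi> t * (\<Prod>us\<leftarrow>uss. transfer g us (\<lambda>_. 1) t)) \<in> borel_measurable M"
      by (simp add: bounded_measurable_iff)
    have "bounded_measurable M (\<lambda>t. W n \<phi> t * (\<Prod>us\<leftarrow>uss. b n us t))" for n
      by (intro bounded_measurable_mult bounded_measurable_prod_list bounded_pos_measurable[OF W\<phi>] bd_b)
    then show "(\<lambda>t. W n \<phi> t * (\<Prod>us\<leftarrow>uss. b n us t)) \<in> borel_measurable M" for n
      by (simp add: bounded_measurable_iff)
    have W_lim: "(\<lambda>n. W n \<phi> t) \<longlonglongrightarrow> \<phi> t" for t
      using tendsto_add[OF tendsto_const \<delta>_lim, of "\<phi> t"] by (simp add: W_def)
    show "AE t in M. (\<lambda>n. W n \<phi> t * (\<Prod>us\<leftarrow>uss. b n us t)) \<longlonglongrightarrow> \<phi> t * (\<Prod>us\<leftarrow>uss. transfer g us (\<lambda>_. 1) t)"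
      by (intro AE_I2 tendsto_mult W_lim C(2))
    show "AE t in M. norm (W n \<phi> t * (\<Prod>us\<leftarrow>uss. b n us t)) \<le> (B\<phi> + 1) * C" for n
    proof (rule AE_I2)
      fix t assume t: "t \<in> space M"
      have "\<bar>W n \<phi> t\<bar> \<le> B\<phi> + 1" using B\<phi>[OF t] \<delta>[of n] by (simp add: W_def)
      then show "norm (W n \<phi> t * (\<Prod>us\<leftarrow>uss. b n us t)) \<le> (B\<phi> + 1) * C"
        unfolding real_norm_def abs_mult using C(1)[OF t, of n] by (intro mult_mono) auto
    qed
  qed simp
  moreover have "\<And>n. form g f ^ e \<le> (\<integral>t. W n \<phi> t * (\<Prod>us\<leftarrow>uss. b n us t) \<partial>M)"
    using lower by (simp add: b_def)
  ultimately show ?thesis by (intro LIMSEQ_le_const) auto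
qed

end

section \<open>The inequality for theta graphs\<close>

context prob_space
begin

lemma transfer_cong_AE:
  assumes K: "bounded_measurable (M \<Otimes>\<^sub>M M) (\<lambda>(x, y). K x y)"
    and g: "bounded_measurable (M \<Otimes>\<^sub>M M) (\<lambda>(x, y). g x y)"
    and eq: "AE x in M. AE y in M. K x y = g x y"
    and us: "\<And>u. u \<in> set us \<Longrightarrow> bounded_measurable M u"
  shows "AE x in M. transfer K us (\<lambda>_. 1) x = transfer g us (\<lambda>_. 1) x"
  using us
proof (induction us)
  case (Cons u us)
  have IH: "AE x in M. transfer K us (\<lambda>_. 1) x = transfer g us (\<lambda>_. 1) x"
    using Cons by auto
  have bd: "bounded_measurable M u" "bounded_measurable M (transfer K us (\<lambda>_. 1))"
    "bounded_measurable M (transfer g us (\<lambda>_. 1))"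
    using Cons.prems by (auto intro!: bounded_measurable_transfer K g)
  from eq AE_space show ?case
  proof eventually_elim
    case (elim x)
    have "(\<integral>z. K x z * (u z * transfer K us (\<lambda>_. 1) z) \<partial>M) = (\<integral>z. g x z * (u z * transfer g us (\<lambda>_. 1) z) \<partial>M)"
    proof (rule integral_cong_AE)
      show "AE z in M. K x z * (u z * transfer K us (\<lambda>_. 1) z) = g x z * (u z * transfer g us (\<lambda>_. 1) z)"
        using elim(1) IH by eventually_elim simp
    qed (use bd bounded_measurable_section[OF K elim(2)] bounded_measurable_section[OF g elim(2)]
         in \<open>auto simp: bounded_measurable_iff\<close>)
    then show ?case by simp
  qed
qed simp

lemma bounded_measurable_form:
  assumes "bounded_measurable M q" "bounded_measurable (M \<Otimes>\<^sub>M M) (\<lambda>(x, y). k x y)"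
  shows "bounded_measurable (M \<Otimes>\<^sub>M M) (\<lambda>(x, y). q x * k x y * q y)"
  unfolding case_prod_unfold
  by (intro bounded_measurable_mult bounded_measurable_comp[OF assms(1)] bounded_measurable_comp2[OF assms(2)]) auto

lemma form_cong_AE:
  assumes K: "bounded_measurable (M \<Otimes>\<^sub>M M) (\<lambda>(x, y). K x y)"
    and g: "bounded_measurable (M \<Otimes>\<^sub>M M) (\<lambda>(x, y). g x y)"
    and eq: "AE x in M. AE y in M. K x y = g x y"
    and f: "bounded_measurable M f"
  shows "form K f = form g f"
  unfolding form_def
proof (rule integral_cong_AE)
  note bd = bounded_measurable_form[OF f K] bounded_measurable_form[OF f g]
  show "(\<lambda>u. \<integral>v. f u * K u v * f v \<partial>M) \<in> borel_measurable M"
    "(\<lambda>u. \<integral>v. f u * g u v * f v \<partial>M) \<in> borel_measurable M"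
    using bounded_measurable_integral[OF bd(1)] bounded_measurable_integral[OF bd(2)]
    by (auto simp: bounded_measurable_iff)
  from eq AE_space show "AE u in M. (\<integral>v. f u * K u v * f v \<partial>M) = (\<integral>v. f u * g u v * f v \<partial>M)"
  proof eventually_elim
    case (elim u)
    show ?case
    proof (rule integral_cong_AE)
      show "AE v in M. f u * K u v * f v = f u * g u v * f v"
        using elim(1) by eventually_elim simp
    qed (use bounded_measurable_section[OF bd(1) elim(2)] bounded_measurable_section[OF bd(2) elim(2)]
         in \<open>auto simp: bounded_measurable_iff\<close>)
  qed
qed

end

context gram_kernel
begin

text \<open>If \<open>Z = form K f\<close> vanishes, the path kernel being positive semidefinite suffices. Otherwise the two spiders
  have \<open>2 * e = m + n\<close> edges together, and the cost \<open>Z ^ n\<close> of cutting cancels against \<open>Z ^ (2 * e)\<close>.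
  The kernel \<open>K\<close> is nonnegative only almost everywhere, whereas the spider inequality takes
  logarithms of pointwise values; so \<open>K\<close> is replaced by its positive part.\<close>

lemma theta_ge:
  assumes nonneg: "AE x in M. AE y in M. 0 \<le> K x y"
    and wss: "\<forall>ws\<in>set wss. rev ws = ws \<and> (\<forall>w\<in>set ws. bounded_measurable M w \<and> (\<forall>t\<in>space M. 0 \<le> w t))"
    and \<phi>: "bounded_measurable M \<phi>" "\<And>t. t \<in> space M \<Longrightarrow> 0 \<le> \<phi> t"
    and f: "bounded_measurable M f" "\<And>t. t \<in> space M \<Longrightarrow> 0 \<le> f t"
    and m: "m = (\<Sum>ws\<leftarrow>wss. length ws + 1)" "1 \<le> m"
    and prod: "\<And>t. t \<in> space M \<Longrightarrow> (\<phi> t)\<^sup>2 * (\<Prod>ws\<leftarrow>wss. \<Prod>w\<leftarrow>ws. w t) = f t ^ (2 * m)"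
  shows "form K f ^ m \<le> form (\<lambda>u v. \<Prod>ws\<leftarrow>wss. path_kernel K ws u v) \<phi>"
proof -
  have f_nonneg: "\<forall>t\<in>space M. 0 \<le> f t" using f(2) by simp
  obtain uss n where uss: "\<forall>us\<in>set uss. \<forall>u\<in>set us. bounded_measurable M u \<and> (\<forall>t\<in>space M. 0 \<le> u t)"
    and len: "2 * (\<Sum>us\<leftarrow>uss. length us) = (\<Sum>ws\<leftarrow>wss. length ws + 1) + n"
    and prod': "\<forall>t\<in>space M. (\<Prod>us\<leftarrow>uss. \<Prod>u\<leftarrow>us. u t)\<^sup>2 = (\<Prod>ws\<leftarrow>wss. \<Prod>w\<leftarrow>ws. w t) * f t ^ (2 * n)"
    and psd: "psd (\<lambda>u v. \<Prod>ws\<leftarrow>wss. path_kernel K ws u v)"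
    and spider: "\<forall>\<phi>. 0 < form K f \<longrightarrow> bounded_measurable M \<phi> \<longrightarrow>
       (\<integral>u. \<phi> u * (\<Prod>us\<leftarrow>uss. transfer K us (\<lambda>_. 1) u) \<partial>M)\<^sup>2
         \<le> form K f ^ n * form (\<lambda>u v. \<Prod>ws\<leftarrow>wss. path_kernel K ws u v) \<phi>"
    using theta_ge_spider[OF wss f(1) f_nonneg] by (elim exE conjE) (rule that)
  have "psd K"
    using psd_mult_gram[OF psd_one h] by simp
  then have "0 \<le> form K f" using f by (simp add: psd_def)
  show ?thesis
  proof (cases "form K f = 0")
    case True
    then show ?thesis using psd \<phi> m(2) by (simp add: psd_def power_0_left)
  next
    case False
    with \<open>0 \<le> form K f\<close> have Z: "0 < form K f" by simp
    define e where "e = (\<Sum>us\<leftarrow>uss. length us)"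
    have e: "2 * e = m + n" using len by (simp add: e_def m(1))
    define g where "g x y = max 0 (K x y)" for x y
    have g: "bounded_measurable (M \<Otimes>\<^sub>M M) (\<lambda>(x, y). g x y)"
    proof -
      obtain B where "\<forall>x\<in>space (M \<Otimes>\<^sub>M M). \<bar>(\<lambda>(x, y). K x y) x\<bar> \<le> B"
        using K by (auto simp: bounded_measurable_iff)
      then have "\<forall>x\<in>space (M \<Otimes>\<^sub>M M). \<bar>(\<lambda>(x, y). g x y) x\<bar> \<le> B"
        by (fastforce simp: g_def)
      then show ?thesis using K unfolding bounded_measurable_iff by (auto simp: g_def case_prod_unfold)
    qed
    have eq: "AE x in M. AE y in M. K x y = g x y"
      using nonneg by eventually_elim (auto simp: g_def elim: eventually_mono)
    have prod_us: "\<phi> t * (\<Prod>us\<leftarrow>uss. \<Prod>u\<leftarrow>us. u t) = f t ^ (2 * e)" if t: "t \<in> space M" for t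
    proof -
      have "(\<phi> t * (\<Prod>us\<leftarrow>uss. \<Prod>u\<leftarrow>us. u t))\<^sup>2 = f t ^ (2 * m) * f t ^ (2 * n)"
        using prod[OF t] prod' t by (simp add: power_mult_distrib mult.assoc[symmetric])
      also have "\<dots> = (f t ^ (2 * e))\<^sup>2"
        unfolding e by (simp add: power_add[symmetric] power_mult[symmetric] distrib_left distrib_right mult.commute)
      finally have "(\<phi> t * (\<Prod>us\<leftarrow>uss. \<Prod>u\<leftarrow>us. u t))\<^sup>2 = (f t ^ (2 * e))\<^sup>2" .
      moreover have "0 \<le> (\<Prod>us\<leftarrow>uss. \<Prod>u\<leftarrow>us. u t)"
        using uss t by (auto intro!: prod_list_nonneg)
      ultimately show ?thesis
        using \<phi>(2)[OF t] f(2)[OF t] by (simp add: power2_eq_iff_nonneg)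
    qed
    have "form K f ^ e = form g f ^ e"
      using form_cong_AE[OF K g eq f(1)] by simp
    also have "\<dots> \<le> (\<integral>t. \<phi> t * (\<Prod>us\<leftarrow>uss. transfer g us (\<lambda>_. 1) t) \<partial>M)"
    proof (rule spider_ge[OF g _ _ f \<phi>])
      show "1 \<le> e" using e m(2) by simp
    qed (use uss K_sym prod_us in \<open>auto simp: g_def e_def\<close>)
    also have "\<dots> = (\<integral>t. \<phi> t * (\<Prod>us\<leftarrow>uss. transfer K us (\<lambda>_. 1) t) \<partial>M)"
    proof (rule integral_cong_AE)
      have "AE t in M. \<forall>us\<in>set uss. transfer K us (\<lambda>_. 1) t = transfer g us (\<lambda>_. 1) t"
        using uss by (intro AE_finite_allI transfer_cong_AE[OF K g eq]) auto
      then show "AE t in M. \<phi> t * (\<Prod>us\<leftarrow>uss. transfer g us (\<lambda>_. 1) t) = \<phi> t * (\<Prod>us\<leftarrow>uss. transfer K us (\<lambda>_. 1) t)"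
        by eventually_elim (simp cong: map_cong)
      have "bounded_measurable M (\<lambda>t. \<phi> t * (\<Prod>us\<leftarrow>uss. transfer k us (\<lambda>_. 1) t))"
        if "bounded_measurable (M \<Otimes>\<^sub>M M) (\<lambda>(x, y). k x y)" for k
        using uss by (intro bounded_measurable_mult bounded_measurable_prod_list bounded_measurable_transfer \<phi> that) auto
      from this[OF g] this[OF K]
      show "(\<lambda>t. \<phi> t * (\<Prod>us\<leftarrow>uss. transfer g us (\<lambda>_. 1) t)) \<in> borel_measurable M"
        "(\<lambda>t. \<phi> t * (\<Prod>us\<leftarrow>uss. transfer K us (\<lambda>_. 1) t)) \<in> borel_measurable M"
        by (auto simp: bounded_measurable_iff)
    qed
    finally have le: "form K f ^ e \<le> (\<integral>t. \<phi> t * (\<Prod>us\<leftarrow>uss. transfer K us (\<lambda>_. 1) t) \<partial>M)" .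
    have "form K f ^ n * form K f ^ m = (form K f ^ e)\<^sup>2"
      using e by (simp add: power_mult[symmetric] power_add[symmetric] mult.commute add.commute)
    also have "\<dots> \<le> (\<integral>t. \<phi> t * (\<Prod>us\<leftarrow>uss. transfer K us (\<lambda>_. 1) t) \<partial>M)\<^sup>2"
      using le Z by (intro power_mono) auto
    also have "\<dots> \<le> form K f ^ n * form (\<lambda>u v. \<Prod>ws\<leftarrow>wss. path_kernel K ws u v) \<phi>"
      using spider Z \<phi>(1) by blast
    finally show ?thesis using Z by simp
  qed
qed

end

section \<open>Integrating out the inner vertices of a path\<close>

text \<open>The integrand that belongs to one path from \<open>s\<close> to \<open>t\<close>; the list gives its inner vertices
  with their weights.\<close>

primrec walk :: "('a \<Rightarrow> 'a \<Rightarrow> real) \<Rightarrow> 'i \<Rightarrow> 'i \<Rightarrow> ('i \<times> ('a \<Rightarrow> real)) list \<Rightarrow> ('i \<Rightarrow> 'a) \<Rightarrow> real" where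
  "walk K t s [] x = K (x s) (x t)"
| "walk K t s (p # ps) x = K (x s) (x (fst p)) * (snd p (x (fst p)) * walk K t (fst p) ps x)"

definition determined_by :: "'i set \<Rightarrow> (('i \<Rightarrow> 'a) \<Rightarrow> real) \<Rightarrow> bool" where
  "determined_by I R \<longleftrightarrow> (\<forall>x y. (\<forall>i\<in>I. x i = y i) \<longrightarrow> R x = R y)"

lemma determined_by_mult:
  assumes "determined_by I R" "determined_by I S" shows "determined_by I (\<lambda>x. R x * S x)"
  unfolding determined_by_def
proof (intro allI impI)
  fix x y :: "'a \<Rightarrow> 'b" assume "\<forall>i\<in>I. x i = y i"
  then have "R x = R y" "S x = S y" using assms by (simp_all add: determined_by_def)
  then show "R x * S x = R y * S y" by simp
qed

lemma determined_by_walk: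
  "insert s (insert t (fst ` set ps)) \<subseteq> I \<Longrightarrow> determined_by I (walk K t s ps)"
proof (induction ps arbitrary: s)
  case (Cons p ps)
  have "determined_by I (walk K t (fst p) ps)" using Cons.prems by (intro Cons.IH) auto
  moreover have "determined_by I (\<lambda>x. K (x s) (x (fst p)))" "determined_by I (\<lambda>x. snd p (x (fst p)))"
    using Cons.prems by (auto simp: determined_by_def)
  ultimately show ?case
    unfolding walk.simps(2)[abs_def] by (intro determined_by_mult)
qed (simp add: determined_by_def)

lemma determined_by_prod_list:
  assumes "\<And>p. p \<in> set ps \<Longrightarrow> determined_by I (W p)"
  shows "determined_by I (\<lambda>x. \<Prod>p\<leftarrow>ps. W p x)"
  using assms
proof (induction ps)
  case Nil then show ?case by (simp add: determined_by_def)
next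
  case (Cons p ps) then show ?case by (simp add: determined_by_mult)
qed

lemma bounded_measurable_PiM_mono:
  assumes R: "bounded_measurable (Pi\<^sub>M I N) R" "determined_by I R" and "I \<subseteq> J"
  shows "bounded_measurable (Pi\<^sub>M J N) R"
proof -
  have "bounded_measurable (Pi\<^sub>M J N) (\<lambda>x. R (restrict x I))"
    using measurable_restrict_subset[OF \<open>I \<subseteq> J\<close>] by (rule bounded_measurable_comp[OF R(1)])
  moreover have "R (restrict x I) = R x" for x
    using R(2)[unfolded determined_by_def, rule_format, of "restrict x I" x] by simp
  ultimately show ?thesis by simp
qed

context prob_space
begin

lemma bounded_measurable_walk:
  assumes K: "bounded_measurable (M \<Otimes>\<^sub>M M) (\<lambda>(x, y). K x y)"
    and ps: "insert s (insert t (fst ` set ps)) \<subseteq> I" "\<And>p. p \<in> set ps \<Longrightarrow> bounded_measurable M (snd p)"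
  shows "bounded_measurable (Pi\<^sub>M I (\<lambda>_. M)) (walk K t s ps)"
  using ps
proof (induction ps arbitrary: s)
  case Nil
  then show ?case by (simp, intro bounded_measurable_comp2[OF K] measurable_component_singleton) auto
next
  case (Cons p ps)
  have "bounded_measurable (Pi\<^sub>M I (\<lambda>_. M)) (walk K t (fst p) ps)"
    using Cons.prems by (intro Cons.IH) auto
  moreover have "bounded_measurable (Pi\<^sub>M I (\<lambda>_. M)) (\<lambda>x. K (x s) (x (fst p)))"
    using Cons.prems by (intro bounded_measurable_comp2[OF K] measurable_component_singleton) auto
  moreover have "bounded_measurable (Pi\<^sub>M I (\<lambda>_. M)) (\<lambda>x. snd p (x (fst p)))"
    using Cons.prems by (intro bounded_measurable_comp[where N = M and p = "\<lambda>x. x (fst p)"] measurable_component_singleton) auto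
  ultimately show ?case by (simp add: bounded_measurable_mult)
qed

lemma integrable_PiM:
  assumes "bounded_measurable (Pi\<^sub>M I (\<lambda>_. M)) R"
  shows "integrable (Pi\<^sub>M I (\<lambda>_. M)) R"
proof -
  interpret P: prob_space "Pi\<^sub>M I (\<lambda>_. M)" by (intro prob_space_PiM prob_space_axioms)
  show ?thesis using assms by (rule P.integrable_bounded_measurable)
qed

lemma product_sigma_finite_self: "product_sigma_finite (\<lambda>_. M)"
  by (simp add: product_sigma_finite_def sigma_finite_measure_axioms)

text \<open>Vertices are removed from the far end: the first inner vertex is added to the coordinates
  that are kept, the rest of the path is integrated out by induction, and then the integral over
  that one vertex is the defining integral of \<open>transfer\<close>.\<close>

lemma integral_walk:
  assumes K: "bounded_measurable (M \<Otimes>\<^sub>M M) (\<lambda>(x, y). K x y)"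
    and I: "finite I" "s \<in> I" "t \<in> I"
    and ps: "distinct (map fst ps)" "fst ` set ps \<inter> I = {}" "\<And>p. p \<in> set ps \<Longrightarrow> bounded_measurable M (snd p)"
    and R: "bounded_measurable (Pi\<^sub>M I (\<lambda>_. M)) R" "determined_by I R"
  shows "(\<integral>x. R x * walk K t s ps x \<partial>Pi\<^sub>M (I \<union> fst ` set ps) (\<lambda>_. M))
    = (\<integral>x. R x * path_kernel K (map snd ps) (x s) (x t) \<partial>Pi\<^sub>M I (\<lambda>_. M))"
  using I ps R
proof (induction ps arbitrary: I s R)
  case Nil
  then show ?case by (simp add: path_kernel_def)
next
  case (Cons p ps)
  interpret P: product_sigma_finite "\<lambda>_. M" by (rule product_sigma_finite_self)
  obtain v w where p: "p = (v, w)" by (cases p)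
  define I' where "I' = insert v I"
  define R' where "R' x = R x * (K (x s) (x v) * w (x v))" for x :: "'b \<Rightarrow> 'a"
  define A where "A = path_kernel K (map snd ps)"
  have v: "v \<notin> I" "v \<noteq> s" "v \<noteq> t" and w: "bounded_measurable M w"
    using Cons.prems(1-5) Cons.prems(6)[of p] p by auto
  have A: "bounded_measurable (M \<Otimes>\<^sub>M M) (\<lambda>(x, y). A x y)"
    unfolding A_def using Cons.prems by (intro bounded_measurable_path_kernel K) auto
  have R': "bounded_measurable (Pi\<^sub>M I' (\<lambda>_. M)) R'"
    unfolding R'_def
  proof (intro bounded_measurable_mult)
    show "bounded_measurable (Pi\<^sub>M I' (\<lambda>_. M)) R"
      using Cons.prems(7,8) by (rule bounded_measurable_PiM_mono) (auto simp: I'_def)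
    show "bounded_measurable (Pi\<^sub>M I' (\<lambda>_. M)) (\<lambda>x. K (x s) (x v))"
      using Cons.prems(2) by (intro bounded_measurable_comp2[OF K] measurable_component_singleton) (auto simp: I'_def)
    show "bounded_measurable (Pi\<^sub>M I' (\<lambda>_. M)) (\<lambda>x. w (x v))"
      by (intro bounded_measurable_comp[OF w, of "\<lambda>x. x v"] measurable_component_singleton) (auto simp: I'_def)
  qed
  have "determined_by I' R'"
    unfolding determined_by_def
  proof (intro allI impI)
    fix x y :: "'b \<Rightarrow> 'a" assume xy: "\<forall>i\<in>I'. x i = y i"
    then have "R x = R y"
      by (intro Cons.prems(8)[unfolded determined_by_def, rule_format]) (simp add: I'_def)
    moreover have "x s = y s" "x v = y v" using xy Cons.prems(2) by (auto simp: I'_def)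
    ultimately show "R' x = R' y" by (simp add: R'_def)
  qed
  with R' have IH: "(\<integral>x. R' x * walk K t v ps x \<partial>Pi\<^sub>M (I' \<union> fst ` set ps) (\<lambda>_. M))
      = (\<integral>x. R' x * A (x v) (x t) \<partial>Pi\<^sub>M I' (\<lambda>_. M))"
    unfolding A_def using Cons.prems p by (intro Cons.IH) (auto simp: I'_def)
  have bd: "bounded_measurable (Pi\<^sub>M I' (\<lambda>_. M)) (\<lambda>x. R' x * A (x v) (x t))"
  proof (intro bounded_measurable_mult R')
    show "bounded_measurable (Pi\<^sub>M I' (\<lambda>_. M)) (\<lambda>x. A (x v) (x t))"
      using Cons.prems(3) by (intro bounded_measurable_comp2[OF A] measurable_component_singleton) (auto simp: I'_def)
  qed
  have "(\<integral>x. R x * walk K t s (p # ps) x \<partial>Pi\<^sub>M (I \<union> fst ` set (p # ps)) (\<lambda>_. M))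
      = (\<integral>x. R' x * walk K t v ps x \<partial>Pi\<^sub>M (I' \<union> fst ` set ps) (\<lambda>_. M))"
    by (simp add: p R'_def I'_def mult.assoc)
  also have "\<dots> = (\<integral>x. R' x * A (x v) (x t) \<partial>Pi\<^sub>M I' (\<lambda>_. M))" by (rule IH)
  also have "\<dots> = (\<integral>x. (\<integral>y. R' (x(v := y)) * A y (x t) \<partial>M) \<partial>Pi\<^sub>M I (\<lambda>_. M))"
    using P.product_integral_insert[OF \<open>finite I\<close> v(1) integrable_PiM[OF bd[unfolded I'_def]]] v
    by (simp add: I'_def)
  also have "\<dots> = (\<integral>x. R x * path_kernel K (map snd (p # ps)) (x s) (x t) \<partial>Pi\<^sub>M I (\<lambda>_. M))"
  proof (rule Bochner_Integration.integral_cong[OF refl])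
    fix x
    have R_upd: "R (x(v := y)) = R x" for y
      using v(1) by (intro Cons.prems(8)[unfolded determined_by_def, rule_format]) auto
    have "(\<integral>y. R' (x(v := y)) * A y (x t) \<partial>M) = (\<integral>y. R x * (K (x s) y * (w y * A y (x t))) \<partial>M)"
      using v by (simp add: R'_def R_upd mult.assoc)
    also have "\<dots> = R x * (\<integral>y. K (x s) y * (w y * A y (x t)) \<partial>M)"
      by (rule Bochner_Integration.integral_mult_right_zero)
    finally show "(\<integral>y. R' (x(v := y)) * A y (x t) \<partial>M) = R x * path_kernel K (map snd (p # ps)) (x s) (x t)"
      by (simp add: path_kernel_def A_def p)
  qed
  finally show ?case .
qed

text \<open>Each path in turn becomes a factor of the kernel \<open>S\<close> between the two ends, which is why
  \<open>S\<close> is arbitrary.\<close>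

lemma integral_walks:
  assumes K: "bounded_measurable (M \<Otimes>\<^sub>M M) (\<lambda>(x, y). K x y)"
    and st: "s \<noteq> t"
    and pss: "distinct (map fst (concat pss))" "fst ` set (concat pss) \<inter> {s, t} = {}"
      "\<And>p. p \<in> set (concat pss) \<Longrightarrow> bounded_measurable M (snd p)"
    and S: "bounded_measurable (M \<Otimes>\<^sub>M M) (\<lambda>(x, y). S x y)"
  shows "(\<integral>x. S (x s) (x t) * (\<Prod>ps\<leftarrow>pss. walk K t s ps x) \<partial>Pi\<^sub>M ({s, t} \<union> fst ` set (concat pss)) (\<lambda>_. M))
    = (\<integral>u. (\<integral>v. S u v * (\<Prod>ps\<leftarrow>pss. path_kernel K (map snd ps) u v) \<partial>M) \<partial>M)"
  using pss S
proof (induction pss arbitrary: S)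
  case Nil
  interpret P: product_sigma_finite "\<lambda>_. M" by (rule product_sigma_finite_self)
  have bd: "bounded_measurable (Pi\<^sub>M {s, t} (\<lambda>_. M)) (\<lambda>x. S (x s) (x t))"
    by (intro bounded_measurable_comp2[OF Nil(4)] measurable_component_singleton) auto
  have sw: "bounded_measurable (M \<Otimes>\<^sub>M M) (\<lambda>(y, x). S x y)"
    unfolding case_prod_unfold by (intro bounded_measurable_comp2[OF Nil(4)]) measurable
  have "(\<integral>x. S (x s) (x t) \<partial>Pi\<^sub>M {s, t} (\<lambda>_. M)) = (\<integral>x. (\<integral>y. S y (x t) \<partial>M) \<partial>Pi\<^sub>M {t} (\<lambda>_. M))"
    using P.product_integral_insert[OF _ _ integrable_PiM[OF bd]] st by simp
  also have "\<dots> = (\<integral>x. (\<integral>y. S y x \<partial>M) \<partial>M)"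
    using bounded_measurable_integral[OF sw]
    by (intro P.product_integral_singleton) (simp add: bounded_measurable_iff)
  also have "\<dots> = (\<integral>u. (\<integral>v. S u v \<partial>M) \<partial>M)"
    by (rule integral_swap[OF sw])
  finally show ?case by simp
next
  case (Cons ps pss)
  define I where "I = {s, t} \<union> fst ` set (concat pss)"
  define A where "A = path_kernel K (map snd ps)"
  define R where "R x = S (x s) (x t) * (\<Prod>ps\<leftarrow>pss. walk K t s ps x)" for x
  have A: "bounded_measurable (M \<Otimes>\<^sub>M M) (\<lambda>(x, y). A x y)"
    unfolding A_def using Cons.prems by (intro bounded_measurable_path_kernel K) auto
  have SA: "bounded_measurable (M \<Otimes>\<^sub>M M) (\<lambda>(x, y). S x y * A x y)"
    using A Cons.prems(4) by (simp add: case_prod_unfold bounded_measurable_mult)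
  have "bounded_measurable (Pi\<^sub>M I (\<lambda>_. M)) (\<lambda>x. S (x s) (x t))"
    by (intro bounded_measurable_comp2[OF Cons.prems(4)] measurable_component_singleton) (auto simp: I_def)
  moreover have "bounded_measurable (Pi\<^sub>M I (\<lambda>_. M)) (\<lambda>x. \<Prod>ps\<leftarrow>pss. walk K t s ps x)"
    using Cons.prems(3) by (intro bounded_measurable_prod_list bounded_measurable_walk K) (auto simp: I_def)
  ultimately have R: "bounded_measurable (Pi\<^sub>M I (\<lambda>_. M)) R"
    unfolding R_def by (rule bounded_measurable_mult)
  have "determined_by I (\<lambda>x. S (x s) (x t))" by (simp add: determined_by_def I_def)
  moreover have "determined_by I (\<lambda>x. \<Prod>ps\<leftarrow>pss. walk K t s ps x)"
    by (intro determined_by_prod_list determined_by_walk) (auto simp: I_def)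
  ultimately have R': "determined_by I R" unfolding R_def by (rule determined_by_mult)
  have "(\<integral>x. S (x s) (x t) * (\<Prod>ps\<leftarrow>ps # pss. walk K t s ps x)
        \<partial>Pi\<^sub>M ({s, t} \<union> fst ` set (concat (ps # pss))) (\<lambda>_. M))
      = (\<integral>x. R x * walk K t s ps x \<partial>Pi\<^sub>M (I \<union> fst ` set ps) (\<lambda>_. M))"
  proof -
    have "{s, t} \<union> fst ` set (concat (ps # pss)) = I \<union> fst ` set ps" by (auto simp: I_def)
    then show ?thesis by (simp add: R_def mult_ac)
  qed
  also have "\<dots> = (\<integral>x. R x * A (x s) (x t) \<partial>Pi\<^sub>M I (\<lambda>_. M))"
    unfolding A_def using Cons.prems
    by (intro integral_walk K R R') (auto simp: I_def)
  also have "\<dots> = (\<integral>x. S (x s) (x t) * A (x s) (x t) * (\<Prod>ps\<leftarrow>pss. walk K t s ps x)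
        \<partial>Pi\<^sub>M ({s, t} \<union> fst ` set (concat pss)) (\<lambda>_. M))"
    by (simp add: R_def I_def mult_ac)
  also have "\<dots> = (\<integral>u. (\<integral>v. S u v * A u v * (\<Prod>ps\<leftarrow>pss. path_kernel K (map snd ps) u v) \<partial>M) \<partial>M)"
    using Cons.prems SA by (intro Cons.IH) auto
  finally show ?case by (simp add: A_def mult.assoc)
qed

end

section \<open>Null sets in cubes and completions\<close>

context prob_space
begin

text \<open>The two-dimensional marginals of the cube are the square, so that an identity almost
  everywhere on the square holds along each edge for almost all points of the cube.\<close>

lemma distr_PiM_pair:
  assumes I: "finite I" "u \<in> I" "v \<in> I" "u \<noteq> v"
  shows "distr (Pi\<^sub>M I (\<lambda>_. M)) (M \<Otimes>\<^sub>M M) (\<lambda>x. (x u, x v)) = M \<Otimes>\<^sub>M M"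
proof (rule pair_measure_eqI[symmetric])
  interpret P: product_sigma_finite "\<lambda>_. M" by (rule product_sigma_finite_self)
  show "sigma_finite_measure M" "sigma_finite_measure M" by (rule sigma_finite_measure_axioms)+
  have meas: "(\<lambda>x. (x u, x v)) \<in> measurable (Pi\<^sub>M I (\<lambda>_. M)) (M \<Otimes>\<^sub>M M)"
    using I by (intro measurable_Pair measurable_component_singleton)
  fix A B assume AB: "A \<in> sets M" "B \<in> sets M"
  define C where "C i = (if i = u then A else if i = v then B else space M)" for i
  have "emeasure (distr (Pi\<^sub>M I (\<lambda>_. M)) (M \<Otimes>\<^sub>M M) (\<lambda>x. (x u, x v))) (A \<times> B)
      = emeasure (Pi\<^sub>M I (\<lambda>_. M)) ((\<lambda>x. (x u, x v)) -` (A \<times> B) \<inter> space (Pi\<^sub>M I (\<lambda>_. M)))"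
    using AB by (intro emeasure_distr meas) auto
  also have "(\<lambda>x. (x u, x v)) -` (A \<times> B) \<inter> space (Pi\<^sub>M I (\<lambda>_. M)) = Pi\<^sub>E I C"
  proof (intro subset_antisym subsetI)
    fix x assume "x \<in> Pi\<^sub>E I C"
    moreover from this have "x u \<in> C u" "x v \<in> C v" using I by auto
    moreover have "Pi\<^sub>E I C \<subseteq> Pi\<^sub>E I (\<lambda>_. space M)"
      using AB[THEN sets.sets_into_space] by (intro PiE_mono) (auto simp: C_def)
    ultimately show "x \<in> (\<lambda>x. (x u, x v)) -` (A \<times> B) \<inter> space (Pi\<^sub>M I (\<lambda>_. M))"
      using I by (auto simp: space_PiM C_def)
  qed (use I in \<open>auto simp: space_PiM C_def PiE_iff\<close>)
  also have "emeasure (Pi\<^sub>M I (\<lambda>_. M)) (Pi\<^sub>E I C) = (\<Prod>i\<in>I. emeasure M (C i))"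
    using I AB by (intro P.emeasure_PiM) (auto simp: C_def)
  also have "\<dots> = (\<Prod>i\<in>{u, v}. emeasure M (C i))"
    using I by (intro prod.mono_neutral_right) (auto simp: C_def emeasure_space_1)
  also have "\<dots> = emeasure M A * emeasure M B"
    using I by (simp add: C_def)
  finally show "emeasure M A * emeasure M B = emeasure (distr (Pi\<^sub>M I (\<lambda>_. M)) (M \<Otimes>\<^sub>M M) (\<lambda>x. (x u, x v))) (A \<times> B)"
    by simp
qed simp

lemma AE_PiM_pair:
  assumes I: "finite I" "u \<in> I" "v \<in> I" "u \<noteq> v" and P: "AE p in M \<Otimes>\<^sub>M M. P (fst p) (snd p)"
  shows "AE x in Pi\<^sub>M I (\<lambda>_. M). P (x u) (x v)"
proof -
  have "(\<lambda>x. (x u, x v)) \<in> measurable (Pi\<^sub>M I (\<lambda>_. M)) (M \<Otimes>\<^sub>M M)"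
    using I by (intro measurable_Pair measurable_component_singleton)
  moreover have "AE p in distr (Pi\<^sub>M I (\<lambda>_. M)) (M \<Otimes>\<^sub>M M) (\<lambda>x. (x u, x v)). P (fst p) (snd p)"
    unfolding distr_PiM_pair[OF I] by (rule P)
  ultimately have "AE x in Pi\<^sub>M I (\<lambda>_. M). P (fst (x u, x v)) (snd (x u, x v))"
    by (rule AE_distrD)
  then show ?thesis by simp
qed

end

lemma (in complete_measure) borel_measurable_AE:
  fixes f g :: "'a \<Rightarrow> real"
  assumes g: "g \<in> borel_measurable M" and ae: "AE x in M. f x = g x"
  shows "f \<in> borel_measurable M"
proof (rule borel_measurableI)
  fix S :: "real set" assume "open S"
  then have "g -` S \<inter> space M \<in> sets M" using g by (auto intro: measurable_sets)
  moreover have "AE x in M. x \<in> g -` S \<inter> space M \<longleftrightarrow> x \<in> f -` S \<inter> space M"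
    using ae by eventually_elim auto
  ultimately show "f -` S \<inter> space M \<in> sets M"
    using in_sets_AE[of "g -` S \<inter> space M" "f -` S \<inter> space M"] by blast
qed

lemma integral_completion_AE:
  fixes f g :: "'a \<Rightarrow> real"
  assumes g: "g \<in> borel_measurable M" and ae: "AE x in M. f x = g x"
  shows "(\<integral>x. f x \<partial>completion M) = (\<integral>x. g x \<partial>M)"
proof -
  have g': "g \<in> borel_measurable (completion M)" using g by (rule measurable_completion)
  have ae': "AE x in completion M. f x = g x" using ae by (rule AE_completion)
  have "(\<integral>x. f x \<partial>completion M) = (\<integral>x. g x \<partial>completion M)"
    by (intro integral_cong_AE completion.borel_measurable_AE[OF g' ae'] g' ae')
  then show ?thesis by (simp add: integral_completion[OF g])
qed

section \<open>Doubly nonnegative functions as Gram kernels\<close>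

lemma prob_space_unit_interval: "prob_space unit_interval"
  unfolding unit_interval_def
  by (rule prob_spaceI) (simp add: emeasure_restrict_space space_restrict_space)

lemma space_unit_interval [simp]: "space unit_interval = {0..1}"
  by (simp add: unit_interval_def space_restrict_space)

lemma complete_measure_unit_interval: "complete_measure unit_interval"
proof
  fix A B assume "B \<subseteq> A" "A \<in> null_sets unit_interval"
  then have "A \<subseteq> {0..1}" "A \<in> null_sets lebesgue" "B \<subseteq> {0..1}"
    by (auto simp: unit_interval_def null_sets_restrict_space)
  moreover have "B \<in> null_sets lebesgue"
    using \<open>B \<subseteq> A\<close> \<open>A \<in> null_sets lebesgue\<close> by (rule null_sets_completion_subset)
  ultimately have "B \<in> null_sets unit_interval"
    by (simp add: unit_interval_def null_sets_restrict_space)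
  then show "B \<in> sets unit_interval" by auto
qed

text \<open>The function \<open>h\<close> in the definition is measurable only for the completed product. It agrees
  almost everywhere with a function measurable for the product itself, which is cut off to stay
  bounded; for almost all \<open>x\<close> their sections agree almost everywhere, so the Gram kernel
  changes only on a null set.\<close>

lemma doubly_nonnegative_gram:
  assumes g: "doubly_nonnegative g"
  obtains h where "bounded_measurable (unit_interval \<Otimes>\<^sub>M unit_interval) (\<lambda>(x, z). h x z)"
    "AE p in unit_interval \<Otimes>\<^sub>M unit_interval. g (fst p) (snd p) = prob_space.gram unit_interval h (fst p) (snd p)"
proof -
  interpret prob_space unit_interval by (rule prob_space_unit_interval)
  interpret C: complete_measure unit_interval by (rule complete_measure_unit_interval)
  interpret P: pair_sigma_finite unit_interval unit_interval by (rule pair_sigma_finite_self)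
  obtain h where h: "bounded_measurable unit_square (\<lambda>(x, y). h x y)"
    and gh: "AE (x, y) in unit_square. g x y = (\<integral>z. h x z * h y z \<partial>unit_interval)"
    using g unfolding doubly_nonnegative_def by auto
  obtain k where k: "k \<in> borel_measurable (unit_interval \<Otimes>\<^sub>M unit_interval)"
    and hk: "AE p in unit_interval \<Otimes>\<^sub>M unit_interval. (case p of (x, y) \<Rightarrow> h x y) = k p"
  proof -
    have "(\<lambda>(x, y). h x y) \<in> borel_measurable (completion (unit_interval \<Otimes>\<^sub>M unit_interval))"
      using h by (simp add: unit_square_def bounded_measurable_iff)
    from completion_ex_borel_measurable_real[OF this] show thesis by (rule bexE) (rule that)
  qed
  obtain B where B: "\<forall>p\<in>space (unit_interval \<Otimes>\<^sub>M unit_interval). \<bar>case p of (x, y) \<Rightarrow> h x y\<bar> \<le> B"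
    using h unfolding unit_square_def bounded_measurable_iff by auto
  define h' where "h' x z = max (- B) (min B (k (x, z)))" for x z
  have "(0, 0) \<in> space (unit_interval \<Otimes>\<^sub>M unit_interval)" by (simp add: space_pair_measure)
  then have "0 \<le> B" using B by fastforce
  then have h': "bounded_measurable (unit_interval \<Otimes>\<^sub>M unit_interval) (\<lambda>(x, z). h' x z)"
    unfolding bounded_measurable_iff h'_def case_prod_unfold using k by (auto intro!: exI[of _ B])
  have "AE p in unit_interval \<Otimes>\<^sub>M unit_interval. h (fst p) (snd p) = h' (fst p) (snd p)"
    using hk AE_space
  proof eventually_elim
    case (elim p)
    then have "\<bar>k p\<bar> \<le> B" using B by auto
    then show ?case using elim(1) by (auto simp: h'_def case_prod_unfold)
  qed
  from P.AE_pair[OF this] have "AE x in unit_interval. AE z in unit_interval. h x z = h' x z" by simp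
  then have good1: "AE x in unit_interval. (AE z in unit_interval. h x z = h' x z) \<and> x \<in> space unit_interval"
    using AE_space by eventually_elim (rule conjI)
  have good: "AE p in unit_interval \<Otimes>\<^sub>M unit_interval.
      ((AE z in unit_interval. h (fst p) z = h' (fst p) z) \<and> fst p \<in> space unit_interval) \<and>
      ((AE z in unit_interval. h (snd p) z = h' (snd p) z) \<and> snd p \<in> space unit_interval)"
  proof -
    have *: "AE p in unit_interval \<Otimes>\<^sub>M unit_interval. Q (fst p) \<and> Q (snd p)"
      if "AE x in unit_interval. Q x" for Q
    proof -
      have ae: "AE x in unit_interval. Q x" by (rule that)
      obtain N where N: "{x \<in> space unit_interval. \<not> Q x} \<subseteq> N" "emeasure unit_interval N = 0" "N \<in> sets unit_interval"
        by (rule AE_E[OF ae])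
      have "AE p in unit_interval \<Otimes>\<^sub>M unit_interval. fst p \<notin> N \<and> snd p \<notin> N"
      proof (rule P.AE_pair_measure)
        show "{p \<in> space (unit_interval \<Otimes>\<^sub>M unit_interval). fst p \<notin> N \<and> snd p \<notin> N}
            \<in> sets (unit_interval \<Otimes>\<^sub>M unit_interval)"
          using N(3) by measurable
        have N': "AE y in unit_interval. y \<notin> N"
          using N(2,3) by (intro AE_not_in) (simp add: null_setsI)
        from N' show "AE x in unit_interval. AE y in unit_interval. fst (x, y) \<notin> N \<and> snd (x, y) \<notin> N"
        proof eventually_elim
          case (elim x)
          show ?case using N' by eventually_elim (simp add: elim)
        qed
      qed
      with AE_space show ?thesis
        by eventually_elim (use N(1) in \<open>auto simp: space_pair_measure\<close>)
    qed
    show ?thesis by (rule *[OF good1])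
  qed
  have "AE p in unit_interval \<Otimes>\<^sub>M unit_interval. g (fst p) (snd p) = (\<integral>z. h (fst p) z * h (snd p) z \<partial>unit_interval)"
    using gh unfolding unit_square_def AE_completion_iff case_prod_unfold .
  then have "AE p in unit_interval \<Otimes>\<^sub>M unit_interval. g (fst p) (snd p) = gram h' (fst p) (snd p)"
    using good
  proof eventually_elim
    case (elim p)
    have sec: "h' x \<in> borel_measurable unit_interval" if "x \<in> space unit_interval" for x
      using bounded_measurable_section[OF h' that] by (simp add: bounded_measurable_iff)
    have meas: "h x \<in> borel_measurable unit_interval"
      if "AE z in unit_interval. h x z = h' x z" "x \<in> space unit_interval" for x
      using C.borel_measurable_AE[OF sec[OF that(2)] that(1)] .
    have "(\<integral>z. h (fst p) z * h (snd p) z \<partial>unit_interval) = (\<integral>z. h' (fst p) z * h' (snd p) z \<partial>unit_interval)"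
    proof (rule integral_cong_AE)
      show "(\<lambda>z. h (fst p) z * h (snd p) z) \<in> borel_measurable unit_interval"
        using elim(2) meas by (intro borel_measurable_times) auto
      show "(\<lambda>z. h' (fst p) z * h' (snd p) z) \<in> borel_measurable unit_interval"
        using elim(2) sec by (intro borel_measurable_times) auto
      have "AE z in unit_interval. h (fst p) z = h' (fst p) z" "AE z in unit_interval. h (snd p) z = h' (snd p) z"
        using elim(2) by auto
      then show "AE z in unit_interval. h (fst p) z * h (snd p) z = h' (fst p) z * h' (snd p) z"
        by eventually_elim simp
    qed
    then show ?case using elim(1) by (simp add: gram_def)
  qed
  then show ?thesis by (rule that[OF h'])
qed

section \<open>Edges and vertices of the path graph\<close>

lemma path_vertex_eq_iff:
  assumes "j \<le> ks ! i" "j' \<le> ks ! i"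
  shows "path_vertex ks i j = path_vertex ks i j' \<longleftrightarrow> j = j'"
  using assms by (auto simp: path_vertex_def)

locale theta =
  fixes ks :: "nat list"
  assumes nonempty: "1 \<le> length ks"
    and pos: "\<And>i. i < length ks \<Longrightarrow> 1 \<le> ks ! i"
    and simple: "\<And>i i'. i < length ks \<Longrightarrow> i' < length ks \<Longrightarrow> ks ! i = 1 \<Longrightarrow> ks ! i' = 1 \<Longrightarrow> i = i'"
begin

abbreviation V :: "pvertex set" where "V \<equiv> vertices (path_graph ks)"

lemma Inner_in_iff:
  "Inner i j \<in> (\<Union>i<length ks. Inner i ` {1..<ks ! i}) \<longleftrightarrow> i < length ks \<and> 1 \<le> j \<and> j < ks ! i"
proof
  assume "i < length ks \<and> 1 \<le> j \<and> j < ks ! i"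
  then show "Inner i j \<in> (\<Union>i<length ks. Inner i ` {1..<ks ! i})"
    by (intro UN_I[of i] imageI) auto
qed auto

lemma vertices_eq: "V = {Start, Finish} \<union> (\<Union>i<length ks. Inner i ` {1..<ks ! i})"
proof (intro subset_antisym subsetI)
  fix v assume "v \<in> V"
  then obtain i j where ij: "i < length ks" "j \<le> ks ! i" "v = path_vertex ks i j"
    by (auto simp: path_graph_def)
  then have "v = Start \<or> v = Finish \<or> v = Inner i j \<and> 1 \<le> j \<and> j < ks ! i"
    by (simp add: path_vertex_def)
  with ij(1) show "v \<in> {Start, Finish} \<union> (\<Union>i<length ks. Inner i ` {1..<ks ! i})"
    using Inner_in_iff[of i j] by blast
next
  fix v assume v: "v \<in> {Start, Finish} \<union> (\<Union>i<length ks. Inner i ` {1..<ks ! i})"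
  have "0 < length ks" using nonempty by linarith
  have "v = path_vertex ks 0 0" if "v = Start" using that by (simp add: path_vertex_def)
  moreover have "v = path_vertex ks 0 (ks ! 0)" if "v = Finish"
    using that pos[OF \<open>0 < length ks\<close>] by (simp add: path_vertex_def)
  moreover have "v = path_vertex ks i j" if "v = Inner i j" "1 \<le> j" "j < ks ! i" for i j
    using that by (simp add: path_vertex_def)
  ultimately show "v \<in> V" using v \<open>0 < length ks\<close>
    unfolding path_graph_def by (fastforce simp: image_iff)
qed

lemma finite_vertices: "finite V"
  by (simp add: vertices_eq)

lemma path_vertex_in: "i < length ks \<Longrightarrow> j \<le> ks ! i \<Longrightarrow> path_vertex ks i j \<in> V"
  by (auto simp: path_graph_def)

lemma prod_vertices:
  "(\<Prod>v\<in>V. G v) = G Start * G Finish * (\<Prod>i<length ks. \<Prod>j\<in>{1..<ks ! i}. G (Inner i j))"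
  for G :: "pvertex \<Rightarrow> real"
proof -
  have "(\<Prod>v\<in>V. G v) = (\<Prod>v\<in>{Start, Finish}. G v) * (\<Prod>v\<in>(\<Union>i<length ks. Inner i ` {1..<ks ! i}). G v)"
    unfolding vertices_eq by (rule prod.union_disjoint) auto
  also have "(\<Prod>v\<in>(\<Union>i<length ks. Inner i ` {1..<ks ! i}). G v)
      = (\<Prod>i<length ks. \<Prod>v\<in>Inner i ` {1..<ks ! i}. G v)"
    by (rule prod.UNION_disjoint) auto
  also have "\<dots> = (\<Prod>i<length ks. \<Prod>j\<in>{1..<ks ! i}. G (Inner i j))"
    by (intro prod.cong refl) (simp add: prod.reindex inj_on_def)
  finally show ?thesis by simp
qed

definition path_edge :: "nat \<times> nat \<Rightarrow> pvertex set" where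
  "path_edge = (\<lambda>(i, j). {path_vertex ks i j, path_vertex ks i (Suc j)})"

definition edge_index :: "(nat \<times> nat) set" where
  "edge_index = (SIGMA i:{..<length ks}. {..<ks ! i})"

lemma edges_eq: "edges (path_graph ks) = path_edge ` edge_index"
  by (auto simp: path_graph_def path_edge_def edge_index_def image_iff)

lemma Inner_in_path_edge: "(i, j) \<in> edge_index \<Longrightarrow> Inner i' j' \<in> path_edge (i, j) \<Longrightarrow> i' = i"
  by (auto simp: path_edge_def path_vertex_def split: if_splits)

lemma Inner_ex_path_edge:
  assumes "(i, j) \<in> edge_index" "ks ! i \<noteq> 1"
  shows "\<exists>j'. Inner i j' \<in> path_edge (i, j)"
proof (cases "j = 0")
  case True
  then show ?thesis using assms by (auto simp: path_edge_def path_vertex_def edge_index_def)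
next
  case False
  then show ?thesis using assms by (auto simp: path_edge_def path_vertex_def edge_index_def)
qed

text \<open>An edge with an inner vertex reveals its path. The only other edge joins the two ends
  directly, and it lies on a unique path because at most one path has length \<open>1\<close>. Without this,
  edges of different paths would be identified.\<close>

lemma inj_path_edge: "inj_on path_edge edge_index"
proof (rule inj_onI)
  fix p q assume p: "p \<in> edge_index" and q: "q \<in> edge_index" and eq: "path_edge p = path_edge q"
  obtain i j i' j' where ij: "p = (i, j)" "q = (i', j')" by (cases p, cases q)
  have i: "i < length ks" "j < ks ! i" "i' < length ks" "j' < ks ! i'"
    using p q by (auto simp: ij edge_index_def)
  have "i = i'"
  proof (cases "ks ! i = 1 \<and> ks ! i' = 1")
    case True
    then show ?thesis using simple i by blast
  next
    case False
    then show ?thesis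
      using Inner_ex_path_edge[of i j] Inner_ex_path_edge[of i' j'] Inner_in_path_edge[of i j] Inner_in_path_edge[of i' j'] p q eq
      unfolding ij by metis
  qed
  moreover have "j = j'"
  proof -
    have "{path_vertex ks i j, path_vertex ks i (Suc j)} = {path_vertex ks i j', path_vertex ks i (Suc j')}"
      using eq \<open>i = i'\<close> by (simp add: ij path_edge_def)
    then show ?thesis
      using i \<open>i = i'\<close> by (auto simp: doubleton_eq_iff path_vertex_eq_iff)
  qed
  ultimately show "p = q" by (simp add: ij)
qed

lemma prod_edges:
  "(\<Prod>e\<in>edges (path_graph ks). G e)
    = (\<Prod>i<length ks. \<Prod>j<ks ! i. G {path_vertex ks i j, path_vertex ks i (Suc j)})"
  for G :: "pvertex set \<Rightarrow> real"
  unfolding edges_eq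
  by (subst prod.reindex[OF inj_path_edge]) (simp add: edge_index_def prod.Sigma path_edge_def case_prod_unfold comp_def)

lemma card_edges: "card (edges (path_graph ks)) = (\<Sum>i<length ks. ks ! i)"
  unfolding edges_eq by (subst card_image[OF inj_path_edge]) (simp add: edge_index_def)

lemma card_edges_pos: "1 \<le> card (edges (path_graph ks))"
proof -
  have "0 < length ks" using nonempty by linarith
  then have "ks ! 0 \<le> card (edges (path_graph ks))"
    unfolding card_edges by (intro member_le_sum) auto
  with pos[OF \<open>0 < length ks\<close>] show ?thesis by simp
qed

lemma path_vertex_neq: "i < length ks \<Longrightarrow> j < ks ! i \<Longrightarrow> path_vertex ks i j \<noteq> path_vertex ks i (Suc j)"
  by (simp add: path_vertex_eq_iff)

lemma simple_graph: "simple_graph (path_graph ks)"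
  unfolding simple_graph_def
proof (intro conjI ballI)
  show "finite V" by (rule finite_vertices)
  fix e assume "e \<in> edges (path_graph ks)"
  then obtain i j where ij: "i < length ks" "j < ks ! i" "e = {path_vertex ks i j, path_vertex ks i (Suc j)}"
    by (auto simp: path_graph_def)
  then show "\<exists>u\<in>V. \<exists>v\<in>V. u \<noteq> v \<and> e = {u, v}"
    by (intro bexI[of _ "path_vertex ks i j"] bexI[of _ "path_vertex ks i (Suc j)"] conjI
        path_vertex_neq path_vertex_in) auto
qed

text \<open>The automorphism that exchanges the ends and reverses every path.\<close>

definition reflect :: "pvertex \<Rightarrow> pvertex" where
  "reflect v = (case v of Start \<Rightarrow> Finish | Finish \<Rightarrow> Start | Inner i j \<Rightarrow> Inner i (ks ! i - j))"

lemma reflect_path_vertex: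
  "i < length ks \<Longrightarrow> j \<le> ks ! i \<Longrightarrow> reflect (path_vertex ks i j) = path_vertex ks i (ks ! i - j)"
  using pos[of i] by (auto simp: reflect_def path_vertex_def)

lemma reflect_in:
  assumes "v \<in> V" shows "reflect v \<in> V"
proof (cases v)
  case (Inner i j)
  then show ?thesis
    using assms Inner_in_iff[of i j] Inner_in_iff[of i "ks ! i - j"]
    by (auto simp: vertices_eq reflect_def simp del: UN_iff)
qed (simp_all add: vertices_eq reflect_def)

lemma reflect_reflect: "v \<in> V \<Longrightarrow> reflect (reflect v) = v"
  by (auto simp: vertices_eq reflect_def)

lemma bij_reflect: "bij_betw reflect V V"
  by (rule bij_betw_byWitness[of _ reflect]) (auto simp: reflect_in reflect_reflect)

end

section \<open>Symmetrising the weights\<close>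

lemma walk_eq_prod:
  assumes "a < b"
  shows "walk K (q b) (q a) (map (\<lambda>j. (q j, w j)) [Suc a..<b]) x
    = (\<Prod>j\<in>{a..<b}. K (x (q j)) (x (q (Suc j)))) * (\<Prod>j\<in>{Suc a..<b}. w j (x (q j)))"
  using assms
proof (induction "b - Suc a" arbitrary: a)
  case 0
  then have b: "b = Suc a" by simp
  then show ?case by simp
next
  case (Suc n)
  then have less: "Suc a < b" and n: "n = b - Suc (Suc a)" by auto
  have "walk K (q b) (q a) (map (\<lambda>j. (q j, w j)) [Suc a..<b]) x
      = K (x (q a)) (x (q (Suc a))) * (w (Suc a) (x (q (Suc a)))
        * walk K (q b) (q (Suc a)) (map (\<lambda>j. (q j, w j)) [Suc (Suc a)..<b]) x)"
    using less by (simp add: upt_conv_Cons del: upt_Suc)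
  also have "\<dots> = K (x (q a)) (x (q (Suc a))) * (w (Suc a) (x (q (Suc a)))
      * ((\<Prod>j\<in>{Suc a..<b}. K (x (q j)) (x (q (Suc j)))) * (\<Prod>j\<in>{Suc (Suc a)..<b}. w j (x (q j)))))"
    using Suc.hyps(1)[OF n less] by simp
  also have "\<dots> = (\<Prod>j\<in>{a..<b}. K (x (q j)) (x (q (Suc j)))) * (\<Prod>j\<in>{Suc a..<b}. w j (x (q j)))"
    using less Suc.prems by (simp add: prod.atLeast_Suc_lessThan mult_ac)
  finally show ?case .
qed

lemma sqrt_prod: "sqrt (\<Prod>i\<in>I. G i) = (\<Prod>i\<in>I. sqrt (G i))"
  by (induction I rule: infinite_finite_induct) (simp_all add: real_sqrt_mult)

lemma prod_list_upt: "(\<Prod>i\<leftarrow>[a..<b]. G i) = (\<Prod>i\<in>{a..<b}. G i)" for G :: "nat \<Rightarrow> real"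
  using prod.distinct_set_conv_list[of "[a..<b]" G] by simp

lemma (in prob_space) distr_PiM_permute:
  assumes "bij_betw p I I"
  shows "distr (Pi\<^sub>M I (\<lambda>_. M)) (Pi\<^sub>M I (\<lambda>_. M)) (\<lambda>x. \<lambda>i\<in>I. x (p i)) = Pi\<^sub>M I (\<lambda>_. M)"
  using assms distr_PiM_reindex[of I "\<lambda>_. M" p I] prob_space_axioms
  by (auto simp: bij_betw_def)

locale theta_kernel = theta ks + gram_kernel M h
  for ks :: "nat list" and M :: "'a measure" and h
begin

abbreviation cube :: "(pvertex \<Rightarrow> 'a) measure" where "cube \<equiv> Pi\<^sub>M V (\<lambda>_. M)"

definition edge_weight :: "(pvertex \<Rightarrow> 'a) \<Rightarrow> real" where
  "edge_weight x = (\<Prod>i<length ks. \<Prod>j<ks ! i. K (x (path_vertex ks i j)) (x (path_vertex ks i (Suc j))))"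

definition vertex_weight :: "(pvertex \<Rightarrow> 'a \<Rightarrow> real) \<Rightarrow> (pvertex \<Rightarrow> 'a) \<Rightarrow> real" where
  "vertex_weight f x = (\<Prod>v\<in>V. f v (x v))"

lemma edge_index_vertices:
  assumes "i < length ks" "j < ks ! i"
  shows "path_vertex ks i j \<in> V" "path_vertex ks i (Suc j) \<in> V"
    "path_vertex ks i j \<noteq> path_vertex ks i (Suc j)"
  using assms path_vertex_in[of i j] path_vertex_in[of i "Suc j"] path_vertex_neq[of i j] by auto

lemma bounded_measurable_edge_weight: "bounded_measurable cube edge_weight"
  unfolding edge_weight_def
  by (intro bounded_measurable_prod bounded_measurable_comp2[OF K] measurable_component_singleton)
     (auto intro: edge_index_vertices)

lemma bounded_measurable_vertex_weight:
  assumes "\<And>v. v \<in> V \<Longrightarrow> bounded_measurable M (f v)"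
  shows "bounded_measurable cube (vertex_weight f)"
  unfolding vertex_weight_def
proof (rule bounded_measurable_prod)
  fix v assume v: "v \<in> V"
  show "bounded_measurable cube (\<lambda>x. f v (x v))"
    using v by (intro bounded_measurable_comp[OF assms[OF v]] measurable_component_singleton)
qed

lemma edge_weight_reflect: "edge_weight (\<lambda>v\<in>V. x (reflect v)) = edge_weight x"
proof -
  have "(\<Prod>j<ks ! i. K ((\<lambda>v\<in>V. x (reflect v)) (path_vertex ks i j)) ((\<lambda>v\<in>V. x (reflect v)) (path_vertex ks i (Suc j))))
      = (\<Prod>j<ks ! i. K (x (path_vertex ks i j)) (x (path_vertex ks i (Suc j))))" if i: "i < length ks" for i
  proof -
    have "(\<Prod>j<ks ! i. K ((\<lambda>v\<in>V. x (reflect v)) (path_vertex ks i j)) ((\<lambda>v\<in>V. x (reflect v)) (path_vertex ks i (Suc j))))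
        = (\<Prod>j<ks ! i. K (x (path_vertex ks i (Suc (ks ! i - Suc j)))) (x (path_vertex ks i (ks ! i - Suc j))))"
    proof (rule prod.cong[OF refl])
      fix j assume j: "j \<in> {..<ks ! i}"
      then have "Suc (ks ! i - Suc j) = ks ! i - j" by auto
      with j show "K ((\<lambda>v\<in>V. x (reflect v)) (path_vertex ks i j)) ((\<lambda>v\<in>V. x (reflect v)) (path_vertex ks i (Suc j)))
        = K (x (path_vertex ks i (Suc (ks ! i - Suc j)))) (x (path_vertex ks i (ks ! i - Suc j)))"
        using i edge_index_vertices[of i j] by (simp add: reflect_path_vertex)
    qed
    also have "\<dots> = (\<Prod>j<ks ! i. K (x (path_vertex ks i (Suc j))) (x (path_vertex ks i j)))"
      by (rule prod.nat_diff_reindex)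
    also have "\<dots> = (\<Prod>j<ks ! i. K (x (path_vertex ks i j)) (x (path_vertex ks i (Suc j))))"
      by (intro prod.cong refl K_sym)
    finally show ?thesis .
  qed
  then show ?thesis by (simp add: edge_weight_def del: restrict_apply)
qed

lemma vertex_weight_reflect: "vertex_weight f (\<lambda>v\<in>V. x (reflect v)) = vertex_weight (\<lambda>v. f (reflect v)) x"
proof -
  have "vertex_weight f (\<lambda>v\<in>V. x (reflect v)) = (\<Prod>v\<in>V. f v (x (reflect v)))"
    by (simp add: vertex_weight_def)
  also have "\<dots> = (\<Prod>v\<in>V. f (reflect v) (x (reflect (reflect v))))"
    by (rule prod.reindex_bij_betw[OF bij_reflect, symmetric])
  also have "\<dots> = vertex_weight (\<lambda>v. f (reflect v)) x"
    unfolding vertex_weight_def by (intro prod.cong refl) (simp add: reflect_reflect)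
  finally show ?thesis .
qed

lemma integral_reflect:
  fixes R :: "(pvertex \<Rightarrow> 'a) \<Rightarrow> real"
  assumes "R \<in> borel_measurable cube"
  shows "(\<integral>x. R (\<lambda>v\<in>V. x (reflect v)) \<partial>cube) = (\<integral>x. R x \<partial>cube)"
proof -
  have "(\<lambda>x. \<lambda>v\<in>V. x (reflect v)) \<in> measurable cube cube"
    by (intro measurable_restrict measurable_component_singleton reflect_in)
  then have "(\<integral>x. R x \<partial>distr cube cube (\<lambda>x. \<lambda>v\<in>V. x (reflect v))) = (\<integral>x. R (\<lambda>v\<in>V. x (reflect v)) \<partial>cube)"
    using assms by (rule integral_distr)
  then show ?thesis by (simp add: distr_PiM_permute[OF bij_reflect])
qed

text \<open>The integral does not change under reflection, and the edge weight is invariant, so the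
  integrand may be averaged with its reflection. Pointwise, the mean of the two vertex weights is
  at least their geometric mean, which is again a product over the vertices.\<close>

lemma integral_symmetrise_le:
  assumes f: "\<And>v. v \<in> V \<Longrightarrow> bounded_measurable M (f v)"
    "\<And>v t. v \<in> V \<Longrightarrow> t \<in> space M \<Longrightarrow> 0 \<le> f v t"
    and nonneg: "AE x in cube. 0 \<le> edge_weight x"
  defines "f' \<equiv> \<lambda>v t. sqrt (f v t * f (reflect v) t)"
  shows "(\<integral>x. edge_weight x * vertex_weight f' x \<partial>cube) \<le> (\<integral>x. edge_weight x * vertex_weight f x \<partial>cube)"
proof -
  define fm where "fm v = f (reflect v)" for v
  have fm: "bounded_measurable M (fm v)" if "v \<in> V" for v
    using f(1) reflect_in[OF that] by (simp add: fm_def)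
  have f': "bounded_measurable M (f' v)" if "v \<in> V" for v
    unfolding f'_def using f(1)[OF that] f(1)[OF reflect_in[OF that]] by auto
  have int: "integrable cube (\<lambda>x. edge_weight x * vertex_weight u x)"
    if "\<And>v. v \<in> V \<Longrightarrow> bounded_measurable M (u v)" for u
    using that by (intro integrable_PiM bounded_measurable_mult bounded_measurable_edge_weight bounded_measurable_vertex_weight)
  have int_f: "integrable cube (\<lambda>x. edge_weight x * vertex_weight f x)"
    and int_fm: "integrable cube (\<lambda>x. edge_weight x * vertex_weight fm x)"
    and int_f': "integrable cube (\<lambda>x. edge_weight x * vertex_weight f' x)"
    by (intro int f(1) fm f'; assumption)+
  have reflect_eq: "(\<integral>x. edge_weight x * vertex_weight fm x \<partial>cube) = (\<integral>x. edge_weight x * vertex_weight f x \<partial>cube)"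
    using integral_reflect[OF borel_measurable_integrable[OF int_f]]
    by (simp add: edge_weight_reflect vertex_weight_reflect fm_def[abs_def])
  have "(\<integral>x. edge_weight x * vertex_weight f' x \<partial>cube)
      \<le> (\<integral>x. (edge_weight x * vertex_weight f x + edge_weight x * vertex_weight fm x) / 2 \<partial>cube)"
  proof (rule integral_mono_AE)
    show "integrable cube (\<lambda>x. edge_weight x * vertex_weight f' x)"
      "integrable cube (\<lambda>x. (edge_weight x * vertex_weight f x + edge_weight x * vertex_weight fm x) / 2)"
      using int_f int_fm int_f' by auto
    show "AE x in cube. edge_weight x * vertex_weight f' x
        \<le> (edge_weight x * vertex_weight f x + edge_weight x * vertex_weight fm x) / 2"
      using nonneg AE_space
    proof eventually_elim
      case (elim x)
      have x: "x v \<in> space M" if "v \<in> V" for v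
        using elim(2) that by (auto simp: space_PiM)
      have nn: "0 \<le> vertex_weight f x" "0 \<le> vertex_weight fm x"
        using x f(2) reflect_in by (auto simp: vertex_weight_def fm_def intro!: prod_nonneg)
      have "vertex_weight f' x = sqrt (vertex_weight f x * vertex_weight fm x)"
        by (simp add: vertex_weight_def f'_def fm_def sqrt_prod prod.distrib[symmetric])
      also have "\<dots> \<le> (vertex_weight f x + vertex_weight fm x) / 2"
        by (rule arith_geo_mean_sqrt[OF nn])
      finally show ?case
        using mult_left_mono[OF _ elim(1)] by (fastforce simp: distrib_left)
    qed
  qed
  also have "\<dots> = (\<integral>x. edge_weight x * vertex_weight f x \<partial>cube)"
    using int_f int_fm by (simp add: reflect_eq)
  finally show ?thesis .
qed

lemma integral_eq_form:
  assumes f: "\<And>v. v \<in> V \<Longrightarrow> bounded_measurable M (f v)" and ends: "f Finish = f Start"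
  shows "(\<integral>x. edge_weight x * vertex_weight f x \<partial>cube)
    = form (\<lambda>u v. \<Prod>ws\<leftarrow>map (\<lambda>i. map (\<lambda>j. f (Inner i j)) [1..<ks ! i]) [0..<length ks]. path_kernel K ws u v) (f Start)"
proof -
  define ps where "ps i = map (\<lambda>j. (Inner i j, f (Inner i j))) [1..<ks ! i]" for i
  define pss where "pss = map ps [0..<length ks]"
  have set_pss: "set (concat pss) = (\<Union>i<length ks. (\<lambda>j. (Inner i j, f (Inner i j))) ` {1..<ks ! i})"
    by (auto simp: pss_def ps_def)
  have V_eq: "V = {Start, Finish} \<union> fst ` set (concat pss)"
    unfolding vertices_eq set_pss by (simp add: image_UN image_image)
  have fS: "bounded_measurable M (f Start)" using f by (simp add: vertices_eq)
  have walk_eq: "walk K Finish Start (ps i) x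
      = (\<Prod>j<ks ! i. K (x (path_vertex ks i j)) (x (path_vertex ks i (Suc j)))) * (\<Prod>j\<in>{1..<ks ! i}. f (Inner i j) (x (Inner i j)))"
    if i: "i < length ks" for i x
  proof -
    have "0 < ks ! i" using pos[OF i] by simp
    have "ps i = map (\<lambda>j. (path_vertex ks i j, f (Inner i j))) [Suc 0..<ks ! i]"
      by (auto simp: ps_def path_vertex_def)
    moreover have "path_vertex ks i 0 = Start" "path_vertex ks i (ks ! i) = Finish"
      using \<open>0 < ks ! i\<close> by (auto simp: path_vertex_def)
    ultimately have "walk K Finish Start (ps i) x
        = (\<Prod>j\<in>{0..<ks ! i}. K (x (path_vertex ks i j)) (x (path_vertex ks i (Suc j))))
          * (\<Prod>j\<in>{Suc 0..<ks ! i}. f (Inner i j) (x (path_vertex ks i j)))"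
      using walk_eq_prod[OF \<open>0 < ks ! i\<close>, of K "path_vertex ks i" "\<lambda>j. f (Inner i j)" x] by simp
    also have "(\<Prod>j\<in>{Suc 0..<ks ! i}. f (Inner i j) (x (path_vertex ks i j))) = (\<Prod>j\<in>{1..<ks ! i}. f (Inner i j) (x (Inner i j)))"
      by (intro prod.cong) (auto simp: path_vertex_def)
    finally show ?thesis by (simp add: lessThan_atLeast0)
  qed
  have "edge_weight x * vertex_weight f x
      = f Start (x Start) * f Start (x Finish) * (\<Prod>ps\<leftarrow>pss. walk K Finish Start ps x)" for x
  proof -
    have "(\<Prod>ps\<leftarrow>pss. walk K Finish Start ps x) = (\<Prod>i<length ks. walk K Finish Start (ps i) x)"
      by (simp add: pss_def comp_def prod_list_upt lessThan_atLeast0)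
    also have "\<dots> = edge_weight x * (\<Prod>i<length ks. \<Prod>j\<in>{1..<ks ! i}. f (Inner i j) (x (Inner i j)))"
      by (simp add: walk_eq edge_weight_def prod.distrib)
    finally show ?thesis
      unfolding vertex_weight_def prod_vertices ends by (simp only: mult_ac)
  qed
  then have "(\<integral>x. edge_weight x * vertex_weight f x \<partial>cube)
      = (\<integral>x. f Start (x Start) * f Start (x Finish) * (\<Prod>ps\<leftarrow>pss. walk K Finish Start ps x)
          \<partial>Pi\<^sub>M ({Start, Finish} \<union> fst ` set (concat pss)) (\<lambda>_. M))"
    by (simp only: V_eq[symmetric])
  also have "\<dots> = (\<integral>u. (\<integral>v. f Start u * f Start v * (\<Prod>ps\<leftarrow>pss. path_kernel K (map snd ps) u v) \<partial>M) \<partial>M)"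
  proof (rule integral_walks[OF K, where S = "\<lambda>u v. f Start u * f Start v"])
    show "distinct (map fst (concat pss))"
    proof -
      have inj: "inj_on (\<lambda>j. Inner i j) A" for i A by (simp add: inj_on_def)
      have "map fst (concat pss) = concat (map (\<lambda>i. map (Inner i) [1..<ks ! i]) [0..<length ks])"
        by (simp add: pss_def ps_def map_concat comp_def)
      moreover have "distinct (concat (map (\<lambda>i. map (Inner i) [1..<ks ! i]) [0..<n]))" for n
        by (induction n) (auto simp: distinct_map inj_on_def)
      ultimately show ?thesis by simp
    qed
    show "bounded_measurable M (snd p)" if "p \<in> set (concat pss)" for p
    proof -
      have "fst p \<in> V" unfolding V_eq using that by auto
      moreover have "snd p = f (fst p)" using that unfolding set_pss by auto
      ultimately show ?thesis using f by simp
    qed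
    show "bounded_measurable (M \<Otimes>\<^sub>M M) (\<lambda>(u, v). f Start u * f Start v)"
      unfolding case_prod_unfold
      by (intro bounded_measurable_mult bounded_measurable_comp[OF fS]) measurable
    show "fst ` set (concat pss) \<inter> {Start, Finish} = {}"
      unfolding set_pss by auto
  qed simp
  also have "\<dots> = form (\<lambda>u v. \<Prod>ws\<leftarrow>map (\<lambda>i. map (\<lambda>j. f (Inner i j)) [1..<ks ! i]) [0..<length ks]. path_kernel K ws u v) (f Start)"
    by (simp add: form_def pss_def ps_def comp_def mult_ac)
  finally show ?thesis .
qed

section \<open>Path graphs are extra-good\<close>

lemma path_graph_integral_ge:
  assumes f: "\<And>v. v \<in> V \<Longrightarrow> bounded_measurable M (f v)"
    "\<And>v t. v \<in> V \<Longrightarrow> t \<in> space M \<Longrightarrow> 0 \<le> f v t"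
    and nonneg: "AE p in M \<Otimes>\<^sub>M M. 0 \<le> K (fst p) (snd p)"
    and F: "bounded_measurable M F" "\<And>t. t \<in> space M \<Longrightarrow> 0 \<le> F t"
      "\<And>t. t \<in> space M \<Longrightarrow> F t ^ (2 * card (edges (path_graph ks))) = (\<Prod>v\<in>V. f v t)"
  shows "form K F ^ card (edges (path_graph ks)) \<le> (\<integral>x. edge_weight x * vertex_weight f x \<partial>cube)"
proof -
  interpret P: pair_sigma_finite M M by (rule pair_sigma_finite_self)
  define m where "m = card (edges (path_graph ks))"
  define f' where "f' v t = sqrt (f v t * f (reflect v) t)" for v t
  define ws where "ws i = map (\<lambda>j. f' (Inner i j)) [1..<ks ! i]" for i
  define wss where "wss = map ws [0..<length ks]"
  have f'_bd: "bounded_measurable M (f' v)" if "v \<in> V" for v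
    unfolding f'_def using f(1)[OF that] f(1)[OF reflect_in[OF that]] by auto
  have f'_nonneg: "0 \<le> f' v t" if "v \<in> V" "t \<in> space M" for v t
    using f(2)[OF that] f(2)[OF reflect_in[OF that(1)] that(2)] by (simp add: f'_def)
  have Inner_in: "Inner i j \<in> V" if "i < length ks" "1 \<le> j" "j < ks ! i" for i j
    using that Inner_in_iff[of i j] by (simp add: vertices_eq)
  have Start_in: "Start \<in> V" by (simp add: vertices_eq)
  have ends: "f' Finish = f' Start" by (simp add: f'_def reflect_def mult.commute fun_eq_iff)
  have m_sum: "m = (\<Sum>ws\<leftarrow>wss. length ws + 1)"
  proof -
    have "(\<Sum>ws\<leftarrow>wss. length ws + 1) = (\<Sum>i\<in>{0..<length ks}. length (ws i) + 1)"
      unfolding wss_def by (simp add: comp_def sum_list_distinct_conv_sum_set)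
    also have "\<dots> = (\<Sum>i<length ks. ks ! i)"
      unfolding lessThan_atLeast0
    proof (rule sum.cong[OF refl])
      fix i assume "i \<in> {0..<length ks}"
      then show "length (ws i) + 1 = ks ! i" using pos[of i] by (simp add: ws_def)
    qed
    finally show ?thesis by (simp add: m_def card_edges)
  qed
  have "1 \<le> m" unfolding m_def by (rule card_edges_pos)
  have pal: "rev (ws i) = ws i" if i: "i < length ks" for i
  proof (rule nth_equalityI)
    fix k assume "k < length (rev (ws i))"
    then have k: "k < ks ! i - 1" by (simp add: ws_def)
    then have "Suc 0 + (ks ! i - Suc (Suc k)) < ks ! i" by linarith
    then have "rev (ws i) ! k = f' (Inner i (1 + (ks ! i - 1 - Suc k)))"
      using k nth_upt[of "Suc 0" "ks ! i - Suc (Suc k)" "ks ! i"] by (simp add: ws_def rev_nth)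
    also have "\<dots> = f' (Inner i (1 + k))"
      using k by (simp add: f'_def reflect_def mult.commute fun_eq_iff Suc_diff_Suc)
    finally show "rev (ws i) ! k = ws i ! k" using k by (simp add: ws_def)
  qed simp
  have prod: "(f' Start t)\<^sup>2 * (\<Prod>ws\<leftarrow>wss. \<Prod>w\<leftarrow>ws. w t) = F t ^ (2 * m)" if t: "t \<in> space M" for t
  proof -
    have "(f' Start t)\<^sup>2 * (\<Prod>ws\<leftarrow>wss. \<Prod>w\<leftarrow>ws. w t) = (\<Prod>v\<in>V. f' v t)"
      by (simp add: prod_vertices ends wss_def ws_def comp_def prod_list_upt lessThan_atLeast0 power2_eq_square)
    also have "\<dots> = sqrt ((\<Prod>v\<in>V. f v t) * (\<Prod>v\<in>V. f (reflect v) t))"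
      by (simp add: f'_def sqrt_prod prod.distrib[symmetric])
    also have "(\<Prod>v\<in>V. f (reflect v) t) = (\<Prod>v\<in>V. f v t)"
      by (rule prod.reindex_bij_betw[OF bij_reflect])
    finally show ?thesis
      using F(3)[OF t] f(2)[OF _ t] by (simp add: m_def prod_nonneg)
  qed
  have "AE x in cube. 0 \<le> edge_weight x"
  proof -
    have "AE x in cube. \<forall>i<length ks. \<forall>j<ks ! i. 0 \<le> K (x (path_vertex ks i j)) (x (path_vertex ks i (Suc j)))"
      using AE_PiM_pair[OF finite_vertices edge_index_vertices, of _ _ "\<lambda>x y. 0 \<le> K x y"] nonneg
      by (simp add: AE_all_countable)
    then show ?thesis
      by eventually_elim (auto simp: edge_weight_def intro!: prod_nonneg)
  qed
  then have "(\<integral>x. edge_weight x * vertex_weight f' x \<partial>cube) \<le> (\<integral>x. edge_weight x * vertex_weight f x \<partial>cube)"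
    unfolding f'_def[abs_def] using f by (intro integral_symmetrise_le) auto
  moreover have "(\<integral>x. edge_weight x * vertex_weight f' x \<partial>cube) = form (\<lambda>u v. \<Prod>ws\<leftarrow>wss. path_kernel K ws u v) (f' Start)"
    unfolding wss_def ws_def by (rule integral_eq_form[OF f'_bd ends])
  moreover have "form K F ^ m \<le> form (\<lambda>u v. \<Prod>ws\<leftarrow>wss. path_kernel K ws u v) (f' Start)"
  proof (rule theta_ge)
    show "AE x in M. AE y in M. 0 \<le> K x y" using P.AE_pair[OF nonneg] by simp
    show "\<forall>ws\<in>set wss. rev ws = ws \<and> (\<forall>w\<in>set ws. bounded_measurable M w \<and> (\<forall>t\<in>space M. 0 \<le> w t))"
      using pal f'_bd[OF Inner_in] f'_nonneg[OF Inner_in] by (auto simp: wss_def ws_def)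
  qed (use f'_bd[OF Start_in] f'_nonneg[OF Start_in] F m_sum \<open>1 \<le> m\<close> prod in auto)
  ultimately show ?thesis by (simp add: m_def)
qed

end

text \<open>What remains is to pass from \<open>g\<close>, and from the completed measures, to a Gram kernel on
  the product spaces, and to see that the given \<open>f\<close> is the function \<open>F\<close> of
  \<open>path_graph_integral_ge\<close>, also where the product of the weights vanishes.\<close>

theorem theorem6p5:
  fixes ks :: "nat list"
  assumes "length ks \<ge> 1"
    and "\<forall>i<length ks. ks ! i \<ge> 1"
    and "card {i. i < length ks \<and> ks ! i = 1} \<le> 1"
  shows "extra_good (path_graph ks)"
proof -
  interpret theta ks
  proof
    fix i i' assume "i < length ks" "i' < length ks" "ks ! i = 1" "ks ! i' = 1"
    moreover have "finite {i. i < length ks \<and> ks ! i = 1}" by simp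
    ultimately show "i = i'"
      using assms(3) card_le_Suc0_iff_eq[of "{i. i < length ks \<and> ks ! i = 1}"] by simp
  qed (use assms in auto)
  define m where "m = card (edges (path_graph ks))"
  have "1 \<le> m" unfolding m_def by (rule card_edges_pos)
  let ?I = unit_interval
  show ?thesis
    unfolding extra_good_def Let_def m_def[symmetric]
  proof (intro conjI allI impI)
    show "simple_graph (path_graph ks)" by (rule simple_graph)
    show "edges (path_graph ks) \<noteq> {}" using \<open>1 \<le> m\<close> by (auto simp: m_def)
    fix g :: "real \<Rightarrow> real \<Rightarrow> real" and f :: "pvertex \<Rightarrow> real \<Rightarrow> real"
    assume g: "doubly_nonnegative g"
      and f: "\<forall>v\<in>V. bounded_measurable ?I (f v) \<and> (\<forall>t\<in>{0..1}. 0 \<le> f v t)"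
    obtain h where h: "bounded_measurable (?I \<Otimes>\<^sub>M ?I) (\<lambda>(x, z). h x z)"
      and gh: "AE p in ?I \<Otimes>\<^sub>M ?I. g (fst p) (snd p) = prob_space.gram ?I h (fst p) (snd p)"
      using doubly_nonnegative_gram[OF g] .
    interpret theta_kernel ks ?I h
      by (intro theta_kernel.intro theta_axioms gram_kernel.intro prob_space_unit_interval
          gram_kernel_axioms.intro h)
    have g_sym: "g x y = g y x" and g_nonneg: "0 \<le> g x y" if "x \<in> {0..1}" "y \<in> {0..1}" for x y
      using g that unfolding doubly_nonnegative_def by blast+
    define P where "P t = (\<Prod>v\<in>V. f v t)" for t
    define F where "F t = P t powr (1 / (2 * real m))" for t
    have P_nonneg: "0 \<le> P t" if "t \<in> {0..1}" for t
      using f that by (auto simp: P_def intro!: prod_nonneg)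
    have F_nonneg: "0 \<le> F t" for t by (simp add: F_def)
    have F_pow: "F t ^ (2 * m) = P t" if "t \<in> {0..1}" for t
    proof (cases "P t = 0")
      case True
      then show ?thesis using \<open>1 \<le> m\<close> by (simp add: F_def)
    next
      case False
      then have "0 < P t" using P_nonneg[OF that] by simp
      then have "F t ^ (2 * m) = P t powr (1 / (2 * real m) * real (2 * m))"
        by (simp add: F_def powr_realpow[symmetric] powr_powr)
      also have "\<dots> = P t" using \<open>1 \<le> m\<close> \<open>0 < P t\<close> by simp
      finally show ?thesis .
    qed
    have P_bd: "bounded_measurable ?I P"
      unfolding P_def using f by (intro bounded_measurable_prod) auto
    have F_bd: "bounded_measurable ?I F"
    proof -
      obtain B where B: "\<forall>t\<in>{0..1}. \<bar>P t\<bar> \<le> B"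
        using P_bd by (auto simp: bounded_measurable_iff)
      have "\<bar>F t\<bar> \<le> max 1 B" if t: "t \<in> {0..1}" for t
      proof (cases "F t \<le> 1")
        case False
        then have "F t \<le> F t ^ (2 * m)" using \<open>1 \<le> m\<close> by (intro self_le_power) auto
        then show ?thesis using F_pow[OF t] B[rule_format, OF t] F_nonneg[of t] by auto
      qed (use F_nonneg[of t] in auto)
      moreover have "F \<in> borel_measurable ?I"
        unfolding F_def using P_bd by (auto simp: bounded_measurable_iff)
      ultimately show ?thesis by (auto simp: bounded_measurable_iff intro!: exI[of _ "max 1 B"])
    qed
    have lhs: "(\<integral>x. (\<Prod>e\<in>edges (path_graph ks). edge_value g x e) * (\<Prod>v\<in>V. f v (x v)) \<partial>unit_cube V)
        = (\<integral>x. edge_weight x * vertex_weight f x \<partial>cube)"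
      unfolding unit_cube_def
    proof (rule integral_completion_AE)
      show "(\<lambda>x. edge_weight x * vertex_weight f x) \<in> borel_measurable cube"
      proof -
        have "bounded_measurable cube (\<lambda>x. edge_weight x * vertex_weight f x)"
          using f by (intro bounded_measurable_mult bounded_measurable_edge_weight bounded_measurable_vertex_weight) simp
        then show ?thesis by (simp add: bounded_measurable_iff)
      qed
      have "AE x in cube. \<forall>i<length ks. \<forall>j<ks ! i.
          g (x (path_vertex ks i j)) (x (path_vertex ks i (Suc j))) = K (x (path_vertex ks i j)) (x (path_vertex ks i (Suc j)))"
        using AE_PiM_pair[OF finite_vertices edge_index_vertices, of _ _ "\<lambda>x y. g x y = K x y"] gh
        by (simp add: AE_all_countable)
      with AE_space show "AE x in cube. (\<Prod>e\<in>edges (path_graph ks). edge_value g x e) * (\<Prod>v\<in>V. f v (x v))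
          = edge_weight x * vertex_weight f x"
      proof eventually_elim
        case (elim x)
        have x: "x v \<in> {0..1}" if "v \<in> V" for v
          using elim(1) that by (auto simp: space_PiM)
        have "edge_value g x {path_vertex ks i j, path_vertex ks i (Suc j)}
            = K (x (path_vertex ks i j)) (x (path_vertex ks i (Suc j)))" if "i < length ks" "j < ks ! i" for i j
        proof -
          have "g (x (path_vertex ks i j)) (x (path_vertex ks i (Suc j)))
              = g (x (path_vertex ks i (Suc j))) (x (path_vertex ks i j))"
            by (intro g_sym x edge_index_vertices that)
          from edge_value_insert[of g x, OF this] show ?thesis using elim(2) that by simp
        qed
        then show ?case
          by (simp add: prod_edges edge_weight_def vertex_weight_def)
      qed
    qed
    have rhs: "(\<integral>(s, t). F s * g s t * F t \<partial>unit_square) = form K F"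
    proof -
      note bd = bounded_measurable_form[OF F_bd K]
      have "(\<integral>p. (case p of (s, t) \<Rightarrow> F s * g s t * F t) \<partial>unit_square)
          = (\<integral>p. (case p of (s, t) \<Rightarrow> F s * K s t * F t) \<partial>(?I \<Otimes>\<^sub>M ?I))"
        unfolding unit_square_def
      proof (rule integral_completion_AE)
        show "(\<lambda>(s, t). F s * K s t * F t) \<in> borel_measurable (?I \<Otimes>\<^sub>M ?I)"
          using bd by (simp add: bounded_measurable_iff)
        show "AE p in ?I \<Otimes>\<^sub>M ?I. (case p of (s, t) \<Rightarrow> F s * g s t * F t) = (case p of (s, t) \<Rightarrow> F s * K s t * F t)"
          using gh by eventually_elim (simp add: case_prod_unfold)
      qed
      also have "\<dots> = form K F"
        unfolding form_def by (rule integral_pair_eq[OF bd])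
      finally show ?thesis .
    qed
    have "AE p in ?I \<Otimes>\<^sub>M ?I. 0 \<le> K (fst p) (snd p)"
      using gh AE_space
    proof eventually_elim
      case (elim p)
      then show ?case using g_nonneg[of "fst p" "snd p"] by (auto simp: space_pair_measure)
    qed
    then have "form K F ^ m \<le> (\<integral>x. edge_weight x * vertex_weight f x \<partial>cube)"
      unfolding m_def using f F_bd F_nonneg F_pow
      by (intro path_graph_integral_ge) (auto simp: m_def P_def)
    then show "(\<integral>(s, t). (\<Prod>v\<in>V. f v s) powr (1 / (2 * real m)) * g s t * (\<Prod>v\<in>V. f v t) powr (1 / (2 * real m)) \<partial>unit_square) ^ m
        \<le> (\<integral>x. (\<Prod>e\<in>edges (path_graph ks). edge_value g x e) * (\<Prod>v\<in>V. f v (x v)) \<partial>unit_cube V)"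
      unfolding lhs P_def[symmetric] F_def[symmetric] rhs .
  qed
qed

end
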